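(* Let $\mathcal{P}$ be a (shaded) subfactor planar algebra of index $4$ whose principal graph $\Gamma_+$ and dual principal graph $\Gamma_-$ are both the $\tilde{A}_\infty$ Dynkin diagram. Then $\mathcal{P}$ has elements $P_1,Q_1\in\mathcal P_{1,+}$ satisfying the bubble, strand decomposition, colour disagreement and saddle relations (i)–(iv) listed in the context. Further, the equivalence classes of minimal projections are as follows: $\Gamma_+$ is the two-sided infinite path $$\cdots - Q_3 - Q_2 - Q_1 - \emptyset_+ - P_1 - P_2 - P_3 - \cdots$$ and $\Gamma_-$ is the two-sided infinite path $$\cdots - Q'_3 - Q'_2 - Q'_1 - \emptyset_- - P'_1 - P'_2 - P'_3 - \cdots,$$ where $P_k=P_1\otimes\overline{Q}_1\otimes P_1\otimes\cdots$, $P_k'=\overline{P}_1\otimes Q_1\otimes\overline{P}_1\otimes\cdots$, $Q_k=Q_1\otimes\overline{P}_1\otimes Q_1\otimes\cdots$, $Q'_k=\overline{Q}_1\otimes P_1\otimes\overline{Q}_1\otimes\cdots$ ($k$ alternating factors each).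
   Context: Shaded planar algebras. A planar algebra $\mathcal P$ is a family of complex vector spaces $\mathcal P_{k,\pm}$ ($k\ge 0$) with an action of Jones' shaded planar operad: each checkerboard-shaded planar tangle $T$ (an outer box, inner boxes, non-crossing strands, a star marking a region at each box; every box has $k$ strands on top and $k$ on the bottom, and has type $(k,+)$ if its star is in an unshaded region, $(k,-)$ if in a shaded region) gives a multilinear map $Z_T$; isotopic tangles give the same map, the identity tangle gives the identity, and composition of tangles corresponds to composition of maps. Elements are drawn as diagrams with star on the left. $fg$ is $f$ stacked on top of $g$; $\otimes$ is horizontal juxtaposition (defined when shadings match); $\overline{T}$ is rotation by $\pi$; $\mathrm{tr}=\mathrm{tr}^R$ (resp. $\mathrm{tr}^L$) closes all strands up to the right (resp. left). $\emptyset_\pm\in\mathcal P_{0,\pm}$ are the empty diagrams (unshaded, shaded). $X\in\mathcal P_{1,+}$ is the vertical strand with unshaded left and shaded right; $Y=\overline X\in\mathcal P_{1,-}$. Subfactor planar algebra: a planar algebra such that (1) $\dim\mathcal P_{0,\pm}=1$ (closed diagrams are scalars, $\emptyset_\pm=1$); (2) $\mathrm{tr}^L=\mathrm{tr}^R$ on $\mathcal P_{1,\pm}$; (3) there is an antilinear adjoint $*$ on each $\mathcal P_{k,\pm}$, compatible with reflection of tangles over a horizontal line, such that $\langle f,g\rangle=\mathrm{tr}(f^*g)$ is positive definite. A closed loop is a scalar $\delta>0$; the index is $\delta^2$ (so index $4$ means $\delta=2$). Principal graphs. A projection is $p$ with $p=p^2=p^*$. $\mathrm{Hom}(p,q)$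 is the space of diagrams $f$ with bottom boundary that of $p$, top boundary that of $q$ and $qfp=f$ (the numbers of bottom and top points may differ; such diagrams are identified with elements of box spaces by bending strands). $p$ is minimal if $\dim\mathrm{Hom}(p,p)=1$; $p\cong q$ if there is $f\in\mathrm{Hom}(p,q)$ with $f^*f=p$, $ff^*=q$. The principal graph $\Gamma_+$ (resp. dual principal graph $\Gamma_-$) has as vertices the isomorphism classes of minimal projections in the $\mathcal P_{k,+}$ (resp. $\mathcal P_{k,-}$), $k\ge0$, with $\dim\mathrm{Hom}(p\otimes X^{\pm},q)$ edges between $p$ and $q$, where $X^\pm$ is whichever of $X$, $Y$ can be placed to the right of $p$. $\tilde A_\infty$ is the two-sided infinite path. Relations. A red (resp. blue) strand is a strand carrying $P_1$ (resp. $Q_1$): vertical with shading on the right it is $P_1$ (resp. $Q_1$), with shading on the left it is $\overline{P}_1$ (resp. $\overline{Q}_1$). (i) (bubble) red and blue closed loops with shaded interior in an unshaded region equal $\emptyset_+$; red and blue closed loops with unshaded interior in a shaded region equal $\emptyset_-$; (ii) (strand decomposition) $X=P_1+Q_1$, $Y=\overline{P}_1+\overline{Q}_1$; (iii) (colour disagreement) $P_1Q_1=Q_1P_1=0$; (iv) (saddle) the diagram in $\mathcal P_{2,+}$ (resp. $\mathcal P_{2,-}$) consisting of a red arc joining the two top points and a red arc joining the two bottom points equals $P_1\otimes\overline{P}_1$ (resp. $\overline{P}_1\otimes P_1$); the same with blue arcs equals $Q_1\otimes\overline{Q}_1$ (resp. $\overline{Q}_1\otimes Q_1$). *)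

theory Defs
  imports Complex_Main
begin

section \<open>Shaded planar tangles up to isotopy\<close>

text \<open>
  Tangles are handled through the usual presentation of planar string diagrams: after an isotopy,
  every box has its star on the left, and the height function on the strands is a Morse function
  whose critical points, and the boxes, lie at different heights.  Reading from bottom to top, such
  a tangle is a word of pieces, each being a cup (local minimum of a strand), a cap (local maximum)
  or an inner box with \<open>k\<close> strands at the bottom and \<open>k\<close> at the top, together with the number of
  strands that pass to the left of the piece; the strands that pass to its right are implicit.
  Two words give isotopic tangles iff they are related by the moves below: exchange of the heights
  of pieces lying side by side, straightening of a zigzag, and a full turn of an inner box
  (equivalently: turning the box by half a turn clockwise or counterclockwise is the same); this
  is the coherence theorem of Joyal and Street, Freyd and Yetter for pivotal categories.  Inner
  boxes whose star is elsewhere, and rotated boxes, are drawn by bending the strands around the box.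

  A region at the right of \<open>a\<close> strands has the shading of the leftmost region iff \<open>a\<close> is even.  So
  the shading of a tangle is determined by that of its leftmost region, which is where the star of
  the outer box is.  The inner boxes of a tangle carry pairwise different labels.
\<close>

datatype shading = Unshaded | Shaded

fun opposite :: "shading \<Rightarrow> shading" where
  "opposite Unshaded = Shaded"
| "opposite Shaded = Unshaded"

definition shade_at :: "shading \<Rightarrow> nat \<Rightarrow> shading" where
  "shade_at s a = (if even a then s else opposite s)"

datatype piece = Cup | Cap | Box nat nat \<comment> \<open>\<open>Box k i\<close>: \<open>k\<close> strands on each side, label \<open>i\<close>\<close>

type_synonym word = "(nat \<times> piece) list"

fun ins :: "piece \<Rightarrow> nat" where
  "ins Cup = 0"
| "ins Cap = 2"
| "ins (Box k i) = k"

fun outs :: "piece \<Rightarrow> nat" where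
  "outs Cup = 2"
| "outs Cap = 0"
| "outs (Box k i) = k"

fun diagram :: "nat \<Rightarrow> word \<Rightarrow> nat \<Rightarrow> bool" where
  "diagram m [] n \<longleftrightarrow> m = n"
| "diagram m ((a, e) # w) n \<longleftrightarrow> a + ins e \<le> m \<and> diagram (m - ins e + outs e) w n"

fun labels :: "word \<Rightarrow> nat list" where
  "labels [] = []"
| "labels ((a, Box k i) # w) = i # labels w"
| "labels ((a, e) # w) = labels w"

definition tangle :: "nat \<Rightarrow> word \<Rightarrow> bool" where
  "tangle k w \<longleftrightarrow> diagram k w k \<and> distinct (labels w)"

definition shift :: "nat \<Rightarrow> word \<Rightarrow> word" where
  "shift a w = map (\<lambda>(b, e). (a + b, e)) w"

text \<open>Composition of tangles: \<open>v\<close> is glued into the inner box of \<open>w\<close> labelled \<open>i\<close>.\<close>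

fun plug :: "nat \<Rightarrow> word \<Rightarrow> word \<Rightarrow> word" where
  "plug i v [] = []"
| "plug i v ((a, Box k j) # w) = (if j = i then shift a v else [(a, Box k j)]) @ plug i v w"
| "plug i v ((a, e) # w) = (a, e) # plug i v w"

fun reflect_piece :: "piece \<Rightarrow> piece" where
  "reflect_piece Cup = Cap"
| "reflect_piece Cap = Cup"
| "reflect_piece (Box k i) = Box k i"

text \<open>Reflection over a horizontal line.\<close>

definition reflect :: "word \<Rightarrow> word" where
  "reflect w = rev (map (\<lambda>(a, e). (a, reflect_piece e)) w)"

text \<open>\<open>k\<close> nested cups, or caps, whose outermost left end is strand number \<open>a\<close>.\<close>

definition ncups :: "nat \<Rightarrow> nat \<Rightarrow> word" where
  "ncups a k = map (\<lambda>b. (b, Cup)) [a..<a + k]"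

definition ncaps :: "nat \<Rightarrow> nat \<Rightarrow> word" where
  "ncaps a k = map (\<lambda>b. (b, Cap)) (rev [a..<a + k])"

inductive move :: "word \<Rightarrow> word \<Rightarrow> bool" where
  exchange: "move [(a + ins e + r, e'), (a, e)] [(a, e), (a + outs e + r, e')]"
| zigzag1: "move [(a, Cup), (Suc a, Cap)] []"
| zigzag2: "move [(Suc a, Cup), (a, Cap)] []"
| full_turn: "move (ncups a k @ [(a + k, Box k i)] @ ncaps (a + k) k)
                   (ncups (a + k) k @ [(a + k, Box k i)] @ ncaps a k)"

text \<open>Isotopy of tangles with \<open>k\<close> strands at the top and \<open>k\<close> at the bottom of the outer box.\<close>

inductive isotopic :: "nat \<Rightarrow> word \<Rightarrow> word \<Rightarrow> bool" for k where
  refl: "tangle k w \<Longrightarrow> isotopic k w w"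
| local: "tangle k (u @ x @ v) \<Longrightarrow> tangle k (u @ y @ v) \<Longrightarrow> move x y
          \<Longrightarrow> isotopic k (u @ x @ v) (u @ y @ v)"
| sym: "isotopic k w w' \<Longrightarrow> isotopic k w' w"
| trans: "isotopic k w w' \<Longrightarrow> isotopic k w' w'' \<Longrightarrow> isotopic k w w''"


section \<open>Planar algebras\<close>

text \<open>
  The spaces \<open>box_space A k s\<close> are subspaces of one ambient complex vector space; they may overlap.
  \<open>act A k s w f\<close> is the value of the map of the tangle \<open>w\<close> of type \<open>(k, s)\<close> when the inner box
  labelled \<open>i\<close> is filled with \<open>f i\<close>.  \<open>adj A k s\<close> is the adjoint of \<open>box_space A k s\<close>; it plays no
  role for planar algebras that are not equipped with one.
\<close>

record 'a planar_structure =
  box_space :: "nat \<Rightarrow> shading \<Rightarrow> 'a set"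
  scale :: "complex \<Rightarrow> 'a \<Rightarrow> 'a"
  act :: "nat \<Rightarrow> shading \<Rightarrow> word \<Rightarrow> (nat \<Rightarrow> 'a) \<Rightarrow> 'a"
  adj :: "nat \<Rightarrow> shading \<Rightarrow> 'a \<Rightarrow> 'a"

definition admissible :: "'a planar_structure \<Rightarrow> shading \<Rightarrow> word \<Rightarrow> (nat \<Rightarrow> 'a) \<Rightarrow> bool" where
  "admissible A s w f \<longleftrightarrow>
     (\<forall>a k i. (a, Box k i) \<in> set w \<longrightarrow> f i \<in> box_space A k (shade_at s a))"

locale planar_algebra =
  fixes A :: "'a::ab_group_add planar_structure"
  assumes vector_space: "vector_space (scale A)"
    and subspace: "module.subspace (scale A) (box_space A k s)"
    and act_closed:
      "tangle k w \<Longrightarrow> admissible A s w f \<Longrightarrow> act A k s w f \<in> box_space A k s"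
    and act_cong:
      "tangle k w \<Longrightarrow> admissible A s w f \<Longrightarrow> (\<And>i. i \<in> set (labels w) \<Longrightarrow> f i = g i)
       \<Longrightarrow> act A k s w f = act A k s w g"
    and act_add:
      "tangle k w \<Longrightarrow> i \<in> set (labels w)
       \<Longrightarrow> admissible A s w (f(i := x)) \<Longrightarrow> admissible A s w (f(i := y))
       \<Longrightarrow> act A k s w (f(i := x + y)) = act A k s w (f(i := x)) + act A k s w (f(i := y))"
    and act_scale:
      "tangle k w \<Longrightarrow> i \<in> set (labels w) \<Longrightarrow> admissible A s w (f(i := x))
       \<Longrightarrow> act A k s w (f(i := scale A c x)) = scale A c (act A k s w (f(i := x)))"
    and act_isotopic:
      "isotopic k w w' \<Longrightarrow> admissible A s w f \<Longrightarrow> act A k s w f = act A k s w' f"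
    and act_identity:
      "f i \<in> box_space A k s \<Longrightarrow> act A k s [(0, Box k i)] f = f i"
    and act_plug:
      "tangle k w \<Longrightarrow> (a, Box j i) \<in> set w \<Longrightarrow> tangle j v \<Longrightarrow> tangle k (plug i v w)
       \<Longrightarrow> admissible A s (plug i v w) f
       \<Longrightarrow> act A k s (plug i v w) f = act A k s w (f(i := act A j (shade_at s a) v f))"

text \<open>Tangles without inner boxes give elements; \<open>strands A k s\<close> consists of \<open>k\<close> vertical strands.\<close>

definition element :: "'a::zero planar_structure \<Rightarrow> nat \<Rightarrow> shading \<Rightarrow> word \<Rightarrow> 'a" where
  "element A k s w = act A k s w (\<lambda>i. 0)"

definition strands :: "'a::zero planar_structure \<Rightarrow> nat \<Rightarrow> shading \<Rightarrow> 'a" where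
  "strands A k s = element A k s []"

definition empty_diagram :: "'a::zero planar_structure \<Rightarrow> shading \<Rightarrow> 'a" where
  "empty_diagram A s = strands A 0 s"

definition loop :: "'a::zero planar_structure \<Rightarrow> shading \<Rightarrow> 'a" where
  "loop A s = element A 0 s [(0, Cup), (0, Cap)]"

text \<open>Stacking: \<open>f\<close> on top of \<open>g\<close>, both in \<open>box_space A k s\<close>.\<close>

definition stack :: "'a planar_structure \<Rightarrow> nat \<Rightarrow> shading \<Rightarrow> 'a \<Rightarrow> 'a \<Rightarrow> 'a" where
  "stack A k s f g = act A k s [(0, Box k 0), (0, Box k 1)] ((!) [g, f])"

text \<open>
  Juxtaposition of \<open>f\<close> in \<open>box_space A k s\<close> and \<open>g\<close> in \<open>box_space A l (shade_at s k)\<close>.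
\<close>

definition tensor :: "'a planar_structure \<Rightarrow> nat \<Rightarrow> nat \<Rightarrow> shading \<Rightarrow> 'a \<Rightarrow> 'a \<Rightarrow> 'a" where
  "tensor A k l s f g = act A (k + l) s [(0, Box k 0), (k, Box l 1)] ((!) [f, g])"

text \<open>
  Rotation by \<open>\<pi>\<close> of \<open>f\<close> in \<open>box_space A k s\<close>, drawn by bending all strands around the box; the
  result is in \<open>box_space A k (shade_at s k)\<close>.
\<close>

definition rotation :: "'a planar_structure \<Rightarrow> nat \<Rightarrow> shading \<Rightarrow> 'a \<Rightarrow> 'a" where
  "rotation A k s f = act A k (shade_at s k) (ncups 0 k @ [(k, Box k 0)] @ ncaps k k) ((!) [f])"

text \<open>
  Closing all strands of \<open>f\<close> in \<open>box_space A k s\<close> to the right, or to the left.  In the second case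
  the outside region is \<open>shade_at s k\<close>, the region to the right of \<open>f\<close>.
\<close>

definition close_right :: "'a planar_structure \<Rightarrow> nat \<Rightarrow> shading \<Rightarrow> 'a \<Rightarrow> 'a" where
  "close_right A k s f = act A 0 s (ncups 0 k @ [(0, Box k 0)] @ ncaps 0 k) ((!) [f])"

definition close_left :: "'a planar_structure \<Rightarrow> nat \<Rightarrow> shading \<Rightarrow> 'a \<Rightarrow> 'a" where
  "close_left A k s f = act A 0 (shade_at s k) (ncups 0 k @ [(k, Box k 0)] @ ncaps 0 k) ((!) [f])"

text \<open>When \<open>box_space A 0 s\<close> is one-dimensional, its elements are scalars via the empty diagram.\<close>

definition scalar :: "'a::zero planar_structure \<Rightarrow> shading \<Rightarrow> 'a \<Rightarrow> complex" where
  "scalar A s x = (THE c. x = scale A c (empty_diagram A s))"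

definition trace_right :: "'a::zero planar_structure \<Rightarrow> nat \<Rightarrow> shading \<Rightarrow> 'a \<Rightarrow> complex" where
  "trace_right A k s f = scalar A s (close_right A k s f)"

definition trace_left :: "'a::zero planar_structure \<Rightarrow> nat \<Rightarrow> shading \<Rightarrow> 'a \<Rightarrow> complex" where
  "trace_left A k s f = scalar A (shade_at s k) (close_left A k s f)"

definition inner_prod :: "'a::zero planar_structure \<Rightarrow> nat \<Rightarrow> shading \<Rightarrow> 'a \<Rightarrow> 'a \<Rightarrow> complex" where
  "inner_prod A k s f g = trace_right A k s (stack A k s (adj A k s f) g)"

text \<open>
  In \<open>adj_reflect\<close>, each input is replaced by its adjoint in the space prescribed by the shading
  at the box: \<open>G i\<close> is \<open>adj A j (shade_at s a) (F i)\<close> for the box \<open>(a, Box j i)\<close> of the tangle.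
\<close>

locale subfactor_planar_algebra = planar_algebra A
  for A :: "'a::ab_group_add planar_structure" +
  assumes dim_0: "vector_space.dim (scale A) (box_space A 0 s) = 1"
    and spherical: "f \<in> box_space A 1 s \<Longrightarrow> trace_left A 1 s f = trace_right A 1 s f"
    and adj_closed: "f \<in> box_space A k s \<Longrightarrow> adj A k s f \<in> box_space A k s"
    and adj_add: "f \<in> box_space A k s \<Longrightarrow> g \<in> box_space A k s
       \<Longrightarrow> adj A k s (f + g) = adj A k s f + adj A k s g"
    and adj_scale: "f \<in> box_space A k s
       \<Longrightarrow> adj A k s (scale A c f) = scale A (cnj c) (adj A k s f)"
    and adj_adj: "f \<in> box_space A k s \<Longrightarrow> adj A k s (adj A k s f) = f"
    and adj_reflect: "tangle k w \<Longrightarrow> admissible A s w F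
       \<Longrightarrow> (\<And>a j i. (a, Box j i) \<in> set w \<Longrightarrow> G i = adj A j (shade_at s a) (F i))
       \<Longrightarrow> adj A k s (act A k s w F) = act A k s (reflect w) G"
    and positive_definite: "f \<in> box_space A k s \<Longrightarrow> f \<noteq> 0
       \<Longrightarrow> inner_prod A k s f f \<in> \<real> \<and> Re (inner_prod A k s f f) > 0"

definition has_index :: "'a::zero planar_structure \<Rightarrow> real \<Rightarrow> bool" where
  "has_index A d \<longleftrightarrow>
     (\<exists>\<delta>>0. (\<forall>s. loop A s = scale A (complex_of_real \<delta>) (empty_diagram A s)) \<and> d = \<delta>\<^sup>2)"


section \<open>Principal graphs\<close>

text \<open>
  A diagram with \<open>m\<close> strands at the bottom and \<open>n\<close> at the top, with \<open>m + n\<close> even, is identified with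
  an element of \<open>box_space A ((m + n) div 2) s\<close> by bending strands at the right: \<open>bent_box m n i\<close> is
  the diagram from \<open>m\<close> to \<open>n\<close> strands given by the element in the box labelled \<open>i\<close>, and \<open>straighten\<close>
  is the inverse operation.  In both, at most one of the two differences of naturals is nonzero.
\<close>

definition bent_box :: "nat \<Rightarrow> nat \<Rightarrow> nat \<Rightarrow> word" where
  "bent_box m n i =
     ncups m ((n - m) div 2) @ [(0, Box ((m + n) div 2) i)] @ ncaps n ((m - n) div 2)"

definition straighten :: "nat \<Rightarrow> nat \<Rightarrow> word \<Rightarrow> word" where
  "straighten m n w =
     ncups ((m + n) div 2) ((m - n) div 2) @ w @ ncaps ((m + n) div 2) ((n - m) div 2)"

definition projection :: "'a planar_structure \<Rightarrow> nat \<Rightarrow> shading \<Rightarrow> 'a \<Rightarrow> bool" where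
  "projection A k s p \<longleftrightarrow> p \<in> box_space A k s \<and> stack A k s p p = p \<and> adj A k s p = p"

text \<open>
  \<open>Hom A s (m, p) (n, q)\<close> is the space of diagrams \<open>f\<close> from \<open>m\<close> to \<open>n\<close> strands with \<open>q f p = f\<close>;
  there is no such tangle when \<open>m + n\<close> is odd.
\<close>

fun Hom :: "'a::zero planar_structure \<Rightarrow> shading \<Rightarrow> nat \<times> 'a \<Rightarrow> nat \<times> 'a \<Rightarrow> 'a set" where
  "Hom A s (m, p) (n, q) =
     (if even (m + n)
      then {f \<in> box_space A ((m + n) div 2) s.
              act A ((m + n) div 2) s
                (straighten m n ([(0, Box m 0)] @ bent_box m n 1 @ [(0, Box n 2)]))
                ((!) [p, f, q]) = f}
      else {0})"

definition hom_dim ::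
  "'a::ab_group_add planar_structure \<Rightarrow> shading \<Rightarrow> nat \<times> 'a \<Rightarrow> nat \<times> 'a \<Rightarrow> nat" where
  "hom_dim A s x y = vector_space.dim (scale A) (Hom A s x y)"

definition minimal_projections ::
  "'a::ab_group_add planar_structure \<Rightarrow> shading \<Rightarrow> (nat \<times> 'a) set" where
  "minimal_projections A s = {(k, p). projection A k s p \<and> hom_dim A s (k, p) (k, p) = 1}"

text \<open>
  The adjoint of a bent diagram from \<open>m\<close> to \<open>n\<close> strands is the adjoint element, read from \<open>n\<close> to
  \<open>m\<close> strands, as the reflection of \<open>bent_box m n i\<close> is \<open>bent_box n m i\<close>.
\<close>

fun isomorphic :: "'a::zero planar_structure \<Rightarrow> shading \<Rightarrow> nat \<times> 'a \<Rightarrow> nat \<times> 'a \<Rightarrow> bool" where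
  "isomorphic A s (m, p) (n, q) \<longleftrightarrow> even (m + n) \<and>
     (\<exists>f \<in> Hom A s (m, p) (n, q).
        act A m s (bent_box m n 0 @ bent_box n m 1) ((!) [f, adj A ((m + n) div 2) s f]) = p \<and>
        act A n s (bent_box n m 0 @ bent_box m n 1) ((!) [adj A ((m + n) div 2) s f, f]) = q)"

definition iso_class ::
  "'a::ab_group_add planar_structure \<Rightarrow> shading \<Rightarrow> nat \<times> 'a \<Rightarrow> (nat \<times> 'a) set" where
  "iso_class A s x = {y \<in> minimal_projections A s. isomorphic A s x y}"

definition X_strand :: "'a::zero planar_structure \<Rightarrow> 'a" where
  "X_strand A = strands A 1 Unshaded"

definition Y_strand :: "'a::zero planar_structure \<Rightarrow> 'a" where
  "Y_strand A = rotation A 1 Unshaded (X_strand A)"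

fun add_strand :: "'a::zero planar_structure \<Rightarrow> shading \<Rightarrow> nat \<times> 'a \<Rightarrow> nat \<times> 'a" where
  "add_strand A s (k, p) =
     (Suc k, tensor A k 1 s p (if shade_at s k = Unshaded then X_strand A else Y_strand A))"

text \<open>
  A graph with multiple edges is a pair of a vertex set and an edge-counting function.  The number
  of edges between two classes does not depend on the representatives, so \<open>the_elem\<close> is applied to
  a singleton.  \<open>principal_graph A Unshaded\<close> is the principal graph, \<open>principal_graph A Shaded\<close> the
  dual principal graph.
\<close>

type_synonym 'v multigraph = "'v set \<times> ('v \<Rightarrow> 'v \<Rightarrow> nat)"

definition principal_graph ::
  "'a::ab_group_add planar_structure \<Rightarrow> shading \<Rightarrow> (nat \<times> 'a) set multigraph" where
  "principal_graph A s =
     (iso_class A s ` minimal_projections A s,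
      \<lambda>C D. the_elem ((\<lambda>(x, y). hom_dim A s (add_strand A s x) y) ` (C \<times> D)))"

text \<open>\<open>v\<close> exhibits the graph as the two-sided infinite path \<open>\<dots> - v (-1) - v 0 - v 1 - \<dots>\<close>.\<close>

fun two_sided_path :: "'v multigraph \<Rightarrow> (int \<Rightarrow> 'v) \<Rightarrow> bool" where
  "two_sided_path (V, E) v \<longleftrightarrow>
     bij_betw v UNIV V \<and> (\<forall>i j. E (v i) (v j) = (if \<bar>i - j\<bar> = 1 then 1 else 0))"

definition is_A_tilde_infinity :: "'v multigraph \<Rightarrow> bool" where
  "is_A_tilde_infinity G \<longleftrightarrow> (\<exists>v. two_sided_path G v)"


section \<open>The relations and the projections\<close>

text \<open>
  For \<open>a\<close> in \<open>box_space A 1 s\<close>: an arc carrying \<open>a\<close> on the leg with region \<open>s\<close> on its left, joining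
  the two top points, and another one joining the two bottom points.
\<close>

definition saddle :: "'a planar_structure \<Rightarrow> shading \<Rightarrow> 'a \<Rightarrow> 'a" where
  "saddle A s a =
     act A 2 s [(0, Box 1 0), (0, Cap), (0, Cup), (0, Box 1 1)] ((!) [a, a])"

text \<open>
  In the bubble relation, the closed loops carry \<open>P\<close> or \<open>Q\<close>; on the left leg of a loop with unshaded
  interior this is the rotated element.
\<close>

definition bubble_relation :: "'a::zero planar_structure \<Rightarrow> 'a \<Rightarrow> 'a \<Rightarrow> bool" where
  "bubble_relation A P Q \<longleftrightarrow>
     close_right A 1 Unshaded P = empty_diagram A Unshaded \<and>
     close_right A 1 Unshaded Q = empty_diagram A Unshaded \<and>
     close_right A 1 Shaded (rotation A 1 Unshaded P) = empty_diagram A Shaded \<and>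
     close_right A 1 Shaded (rotation A 1 Unshaded Q) = empty_diagram A Shaded"

definition strand_decomposition :: "'a::ab_group_add planar_structure \<Rightarrow> 'a \<Rightarrow> 'a \<Rightarrow> bool" where
  "strand_decomposition A P Q \<longleftrightarrow>
     X_strand A = P + Q \<and> Y_strand A = rotation A 1 Unshaded P + rotation A 1 Unshaded Q"

definition colour_disagreement :: "'a::zero planar_structure \<Rightarrow> 'a \<Rightarrow> 'a \<Rightarrow> bool" where
  "colour_disagreement A P Q \<longleftrightarrow> stack A 1 Unshaded P Q = 0 \<and> stack A 1 Unshaded Q P = 0"

definition saddle_relation :: "'a planar_structure \<Rightarrow> 'a \<Rightarrow> 'a \<Rightarrow> bool" where
  "saddle_relation A P Q \<longleftrightarrow>
     (\<forall>a \<in> {P, Q}. let a' = rotation A 1 Unshaded a in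
        saddle A Unshaded a = tensor A 1 1 Unshaded a a' \<and>
        saddle A Shaded a' = tensor A 1 1 Shaded a' a)"

text \<open>\<open>a \<otimes> b \<otimes> a \<otimes> \<dots>\<close> with \<open>k\<close> factors; the empty diagram for \<open>k = 0\<close>.\<close>

fun alternating :: "'a::zero planar_structure \<Rightarrow> shading \<Rightarrow> 'a \<Rightarrow> 'a \<Rightarrow> nat \<Rightarrow> 'a" where
  "alternating A s a b 0 = empty_diagram A s"
| "alternating A s a b (Suc 0) = a"
| "alternating A s a b (Suc (Suc k)) =
     tensor A (Suc k) 1 s (alternating A s a b (Suc k)) (if even k then b else a)"

text \<open>
  The sequence \<open>\<dots>, c \<otimes> d, c, \<emptyset>, a, a \<otimes> b, \<dots>\<close>, with the empty diagram in position \<open>0\<close>.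
\<close>

definition two_sided_alternating ::
  "'a::zero planar_structure \<Rightarrow> shading \<Rightarrow> 'a \<Rightarrow> 'a \<Rightarrow> 'a \<Rightarrow> 'a \<Rightarrow> int \<Rightarrow> nat \<times> 'a" where
  "two_sided_alternating A s a b c d n =
     (if n \<ge> 0 then (nat n, alternating A s a b (nat n))
      else (nat (- n), alternating A s c d (nat (- n))))"

end

theory Submission
  imports Defs
begin

text \<open>
  A neighbour of the class of the empty diagram in \<open>\<Gamma>\<^sub>+\<close> is a minimal projection that
  receives a nonzero diagram \<open>f\<close> from the single strand, and \<open>f\<^sup>* f\<close> is a multiple of a projection in the
  one-strand space. The two neighbours are not isomorphic, so Schur's lemma makes the two projections
  \<open>P\<close> and \<open>Q\<close> orthogonal (\<open>two_colours\<close>).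

  Numbers do the rest. If \<open>a\<close> is a nonzero projection on one strand, of trace \<open>\<tau>\<close>, then a multiple of the
  saddle of \<open>a\<close> is a subprojection, of trace \<open>1\<close>, of \<open>a\<close> tensored with its rotation, which has trace \<open>\<tau>\<^sup>2\<close>
  by sphericality. Positivity of the trace of the difference gives \<open>\<tau> \<ge> 1\<close>, and in case \<open>\<tau> = 1\<close> the
  difference vanishes, which is the saddle relation (\<open>tr_proj_ge_1\<close>). At index four the strand has
  trace \<open>2\<close>, so \<open>P\<close> and \<open>Q\<close> have trace one and exhaust the strand (\<open>orthogonal_colours\<close>).

  Call a one-strand projection of trace one a colour. The saddle relation says that a colour is
  invertible for the tensor product, its rotation being the inverse. Hence tensoring with a colour
  preserves minimality (\<open>minimal_ten\<close>), and tensoring with a colour and then with its rotation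
  changes nothing up to isomorphism (\<open>iso_cancel\<close>). So the alternating products are minimal; tensoring
  the one in position \<open>i\<close> with a strand gives the sum of those in positions \<open>i + 1\<close> and \<open>i - 1\<close>; and
  every minimal projection is isomorphic to one of them (\<open>minimal_iso_vproj\<close>), since \<open>k\<close> strands are the
  sum of all words of length \<open>k\<close> in the colours, in which cancellation leaves an alternating word. Were
  two of them isomorphic, the whole sequence would be periodic and there would be finitely many
  vertices; an infinite path has infinitely many (\<open>vertex_path\<close>).

  Diagrams are handled as words whose boxes carry elements. Two such words are identified if they have
  the same value in every surrounding tangle; by construction this is a congruence for stacking and
  juxtaposition, and it contains the isotopy moves. Bending strands identifies the classes of words
  from \<open>m\<close> to \<open>n\<close> strands with a box space, which turns the planar algebra into a category with adjoints in
  which the argument above can be carried out.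
\<close>

section \<open>Tangles filled with elements\<close>

text \<open>
  Carrying the elements in the boxes instead of labels makes the value of a diagram independent of
  any numbering, so that stacking words never requires a renaming.
\<close>

datatype 'a filled = FCup | FCap | FBox nat 'a

type_synonym 'a fword = "(nat \<times> 'a filled) list"

fun fins :: "'a filled \<Rightarrow> nat" where
  "fins FCup = 0"
| "fins FCap = 2"
| "fins (FBox k x) = k"

fun fouts :: "'a filled \<Rightarrow> nat" where
  "fouts FCup = 2"
| "fouts FCap = 0"
| "fouts (FBox k x) = k"

fun fill_piece :: "(nat \<Rightarrow> 'a) \<Rightarrow> piece \<Rightarrow> 'a filled" where
  "fill_piece f Cup = FCup"
| "fill_piece f Cap = FCap"
| "fill_piece f (Box k i) = FBox k (f i)"

definition fill :: "(nat \<Rightarrow> 'a) \<Rightarrow> word \<Rightarrow> 'a fword" where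
  "fill f w = map (\<lambda>(a, e). (a, fill_piece f e)) w"

fun number :: "nat \<Rightarrow> 'a fword \<Rightarrow> word" where
  "number i [] = []"
| "number i ((a, FCup) # w) = (a, Cup) # number i w"
| "number i ((a, FCap) # w) = (a, Cap) # number i w"
| "number i ((a, FBox k x) # w) = (a, Box k i) # number (Suc i) w"

fun contents :: "'a fword \<Rightarrow> 'a list" where
  "contents [] = []"
| "contents ((a, FCup) # w) = contents w"
| "contents ((a, FCap) # w) = contents w"
| "contents ((a, FBox k x) # w) = x # contents w"

definition fshift :: "nat \<Rightarrow> 'a fword \<Rightarrow> 'a fword" where
  "fshift a w = map (\<lambda>(b, e). (a + b, e)) w"

definition fcups :: "nat \<Rightarrow> nat \<Rightarrow> 'a fword" where
  "fcups a k = map (\<lambda>b. (b, FCup)) [a..<a + k]"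

definition fcaps :: "nat \<Rightarrow> nat \<Rightarrow> 'a fword" where
  "fcaps a k = map (\<lambda>b. (b, FCap)) (rev [a..<a + k])"

lemma fill_simps [simp]:
  "fill f [] = []"
  "fill f ((a, e) # w) = (a, fill_piece f e) # fill f w"
  "fill f (u @ v) = fill f u @ fill f v"
  by (simp_all add: fill_def)

lemma fill_ncups [simp]: "fill f (ncups a k) = fcups a k"
  by (simp add: fill_def ncups_def fcups_def)

lemma fill_ncaps [simp]: "fill f (ncaps a k) = fcaps a k"
  by (simp add: fill_def ncaps_def fcaps_def rev_map)

lemma fshift_simps [simp]:
  "fshift a [] = []"
  "fshift a ((b, e) # w) = (a + b, e) # fshift a w"
  "fshift a (u @ v) = fshift a u @ fshift a v"
  by (simp_all add: fshift_def)

lemma fshift_0 [simp]: "fshift 0 w = w"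
  by (induction w) auto

lemma fshift_fshift [simp]: "fshift a (fshift b w) = fshift (a + b) w"
  by (induction w) auto

lemma fill_shift [simp]: "fill f (shift a w) = fshift a (fill f w)"
  by (induction w) (auto simp: shift_def)

lemma shift_simps [simp]:
  "shift a [] = []"
  "shift a ((b, e) # w) = (a + b, e) # shift a w"
  "shift a (u @ v) = shift a u @ shift a v"
  by (simp_all add: shift_def)

lemma map_add_upt: "map (\<lambda>x. a + x) [b..<b + k] = [a + b..<a + b + k]"
  by (rule nth_equalityI) auto

lemma fshift_fcups [simp]: "fshift a (fcups b k) = fcups (a + b) k"
  using arg_cong[OF map_add_upt[of a b k], of "map (\<lambda>x. (x, FCup))"]
  by (simp add: fcups_def fshift_def comp_def)

lemma fshift_fcaps [simp]: "fshift a (fcaps b k) = fcaps (a + b) k"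
  using arg_cong[OF map_add_upt[of a b k], of "\<lambda>l. map (\<lambda>x. (x, FCap)) (rev l)"]
  by (simp add: fcaps_def fshift_def comp_def rev_map)

lemma labels_append [simp]: "labels (u @ v) = labels u @ labels v"
  by (induction u rule: labels.induct) auto

lemma labels_shift [simp]: "labels (shift a w) = labels w"
  by (induction w rule: labels.induct) auto

lemma labels_iff: "i \<in> set (labels w) \<longleftrightarrow> (\<exists>a k. (a, Box k i) \<in> set w)"
proof (induction w)
  case (Cons x w)
  then show ?case
    by (cases x; cases "snd x") auto
qed simp

lemma diagram_append:
  "diagram m (u @ v) n \<longleftrightarrow> (\<exists>l. diagram m u l \<and> diagram l v n)"
  by (induction m u n rule: diagram.induct) auto

lemma labels_number: "labels (number i w) = [i..<i + length (contents w)]"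
  by (induction i w rule: number.induct) (auto simp: upt_conv_Cons simp del: upt_Suc)

lemma contents_append [simp]: "contents (u @ v) = contents u @ contents v"
  by (induction u rule: contents.induct) auto

lemma fill_number:
  assumes "\<And>j. j < length (contents w) \<Longrightarrow> f (i + j) = contents w ! j"
  shows "fill f (number i w) = w"
  using assms
proof (induction i w rule: number.induct)
  case (4 i a k x w)
  have "f i = x"
    using "4.prems"[of 0] by simp
  moreover have "f (Suc i + j) = contents w ! j" if "j < length (contents w)" for j
    using "4.prems"[of "Suc j"] that by simp
  ultimately show ?case
    using "4.IH" by simp
qed auto

lemma fill_cong:
  "(\<And>i. i \<in> set (labels w) \<Longrightarrow> f i = g i) \<Longrightarrow> fill f w = fill g w"
  by (induction w rule: labels.induct) auto

lemma plug_append [simp]: "plug i v (u @ w) = plug i v u @ plug i v w"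
  by (induction u rule: labels.induct) auto

lemma plug_fresh: "i \<notin> set (labels w) \<Longrightarrow> plug i v w = w"
  by (induction w rule: labels.induct) auto

lemma shade_at_shade_at [simp]: "shade_at (shade_at s a) b = shade_at s (a + b)"
  by (cases s) (auto simp: shade_at_def)

lemma shade_at_0 [simp]: "shade_at s 0 = s"
  by (simp add: shade_at_def)

lemma shade_at_parity: "even (a + b) \<Longrightarrow> shade_at s a = shade_at s b"
  by (auto simp: shade_at_def)

lemma opposite_opposite [simp]: "opposite (opposite s) = s"
  by (cases s) auto

sublocale planar_algebra \<subseteq> vs: vector_space "scale A"
  by (rule vector_space)

context planar_algebra
begin

text \<open>
  Well-typedness: \<open>wt s m w n\<close> combines the strand count of \<open>diagram\<close> with \<open>admissible\<close>, for a diagram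
  whose leftmost region has shading \<open>s\<close>.
\<close>

fun wt :: "shading \<Rightarrow> nat \<Rightarrow> 'a fword \<Rightarrow> nat \<Rightarrow> bool" where
  "wt s m [] n \<longleftrightarrow> m = n"
| "wt s m ((a, FBox k x) # w) n \<longleftrightarrow>
     a + k \<le> m \<and> x \<in> box_space A k (shade_at s a) \<and> wt s m w n"
| "wt s m ((a, FCup) # w) n \<longleftrightarrow> a \<le> m \<and> wt s (m + 2) w n"
| "wt s m ((a, FCap) # w) n \<longleftrightarrow> a + 2 \<le> m \<and> wt s (m - 2) w n"

lemma wt_fill: "wt s m (fill f w) n \<longleftrightarrow> diagram m w n \<and> admissible A s w f"
proof (induction w arbitrary: m)
  case (Cons x w)
  obtain a e where x: "x = (a, e)"
    by force
  show ?case
    using Cons.IH by (cases e) (auto simp: x admissible_def)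
qed (auto simp: admissible_def)

text \<open>
  Gluing the one-box tangle with the new label into the old box changes the label and nothing else.
\<close>

lemma act_relabel:
  assumes w: "tangle k (u @ (a, Box l i) # v)" and j: "j \<notin> set (labels (u @ (a, Box l i) # v))"
    and f: "admissible A s (u @ (a, Box l i) # v) f"
  shows "act A k s (u @ (a, Box l i) # v) f = act A k s (u @ (a, Box l j) # v) (f(j := f i))"
proof -
  let ?w = "u @ (a, Box l i) # v" and ?w' = "u @ (a, Box l j) # v" and ?f = "f(j := f i)"
  have fresh: "i \<notin> set (labels u)" "i \<notin> set (labels v)"
    using w by (auto simp: tangle_def)
  then have plug: "plug i [(0, Box l j)] ?w = ?w'"
    by (simp add: plug_fresh)
  have w': "tangle k ?w'"
    using w j by (auto simp: tangle_def diagram_append)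
  have "(b, Box h j) \<notin> set ?w" for b h
    using j labels_iff[of j ?w] by blast
  then have adm: "admissible A s ?w' ?f"
    using f by (auto simp: admissible_def)
  have fi: "f i \<in> box_space A l (shade_at s a)"
    using f by (auto simp: admissible_def)
  have "act A k s ?w' ?f =
      act A k s ?w (?f(i := act A l (shade_at s a) [(0, Box l j)] ?f))"
    using act_plug[OF w, of a l i "[(0, Box l j)]" s ?f] w' adm
    unfolding plug by (simp add: tangle_def)
  also have "act A l (shade_at s a) [(0, Box l j)] ?f = f i"
    using act_identity[of ?f j l "shade_at s a"] fi by simp
  also have "act A k s ?w (?f(i := f i)) = act A k s ?w f"
    by (rule act_cong[OF w f, symmetric]) (use j in auto)
  finally show ?thesis ..
qed

text \<open>
  The labels are changed one at a time from left to right; disjointness guarantees that a new label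
  is never already in use further to the right.
\<close>

lemma act_fill_disjoint:
  assumes "tangle k (u @ v)" "tangle k (u @ v')" "set (labels v) \<inter> set (labels v') = {}"
    and "fill f v = fill f' v'" "\<And>i. i \<in> set (labels u) \<Longrightarrow> f i = f' i"
    and "admissible A s (u @ v) f"
  shows "act A k s (u @ v) f = act A k s (u @ v') f'"
  using assms
proof (induction v arbitrary: u v' f)
  case Nil
  then have "v' = []"
    by (simp add: fill_def)
  with Nil show ?case
    by (auto intro: act_cong)
next
  case (Cons x v)
  obtain a e where x: "x = (a, e)"
    by force
  obtain e' v1 where v': "v' = (a, e') # v1" "fill_piece f e = fill_piece f' e'"
      "fill f v = fill f' v1"
    using Cons.prems(4) by (cases v') (auto simp: x)
  show ?case
  proof (cases e)
    case (Box k' i)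
    then obtain j where j: "e' = Box k' j" "f i = f' j"
      using v'(2) by (cases e') auto
    have fresh: "j \<notin> set (labels (u @ (a, Box k' i) # v))"
      using Cons.prems(2,3) by (auto simp: x Box v' j tangle_def)
    let ?f = "f(j := f i)"
    have "act A k s (u @ x # v) f = act A k s (u @ (a, Box k' j) # v) ?f"
      using act_relabel[of k u a k' i v j s f] Cons.prems fresh by (simp add: x Box)
    also have "\<dots> = act A k s ((u @ [(a, Box k' j)]) @ v) ?f"
      by simp
    also have "\<dots> = act A k s ((u @ [(a, Box k' j)]) @ v1) f'"
    proof (rule Cons.IH)
      show "tangle k ((u @ [(a, Box k' j)]) @ v)"
        using Cons.prems(1) fresh by (auto simp: x Box tangle_def diagram_append)
      show "tangle k ((u @ [(a, Box k' j)]) @ v1)"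
        using Cons.prems(2) by (simp add: v' j)
      show "set (labels v) \<inter> set (labels v1) = {}"
        using Cons.prems(3) by (auto simp: x v' Box j)
      have "fill ?f v = fill f v"
        by (rule fill_cong) (use fresh in auto)
      then show "fill ?f v = fill f' v1"
        by (simp add: v'(3))
      show "?f l = f' l" if "l \<in> set (labels (u @ [(a, Box k' j)]))" for l
        using that Cons.prems(5) j by auto
      have "(b, Box h j) \<notin> set u \<union> set v" for b h
        using fresh labels_iff[of j u] labels_iff[of j v] by auto
      then show "admissible A s ((u @ [(a, Box k' j)]) @ v) ?f"
        using Cons.prems(6) by (auto simp: admissible_def x Box)
    qed
    finally show ?thesis
      by (simp add: v' j)
  next
    case Cup
    then have "e' = Cup"
      using v'(2) by (cases e') auto
    then show ?thesis
      using Cons.IH[of "u @ [(a, Cup)]" v1 f] Cons.prems v' x Cup by simp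
  next
    case Cap
    then have "e' = Cap"
      using v'(2) by (cases e') auto
    then show ?thesis
      using Cons.IH[of "u @ [(a, Cap)]" v1 f] Cons.prems v' x Cap by simp
  qed
qed

definition ev :: "nat \<Rightarrow> shading \<Rightarrow> 'a fword \<Rightarrow> 'a" where
  "ev k s w = act A k s (number 0 w) ((!) (contents w))"

lemma fill_number_nth: "fill (\<lambda>i. contents w ! (i - n)) (number n w) = w"
  by (rule fill_number) simp

lemma tangle_number: "wt s k w k \<Longrightarrow> tangle k (number n w)"
  using wt_fill[of s k "\<lambda>i. contents w ! (i - n)" "number n w" k]
  by (simp add: fill_number_nth tangle_def labels_number)

lemma admissible_number:
  "wt s k w l \<Longrightarrow> admissible A s (number n w) (\<lambda>i. contents w ! (i - n))"
  using wt_fill[of s k "\<lambda>i. contents w ! (i - n)" "number n w" l] by (simp add: fill_number_nth)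

text \<open>
  The value depends on the filled word only. Two labellings need not be disjoint, so both are compared
  with a third one whose labels lie above all others.
\<close>

lemma act_fill:
  assumes w: "tangle k w" "admissible A s w f"
  shows "act A k s w f = ev k s (fill f w)"
proof -
  let ?w = "fill f w"
  have wt: "wt s k ?w k"
    using w by (simp add: wt_fill tangle_def)
  define n where "n = Suc (Max (insert (length (contents ?w)) (set (labels w))))"
  have less: "i < n" if "i \<in> set (labels w)" for i
    using that by (auto simp: n_def less_Suc_eq_le)
  have le: "length (contents ?w) \<le> n"
    by (auto simp: n_def le_Suc_eq)
  let ?g = "\<lambda>i. contents ?w ! (i - n)"
  have "act A k s ([] @ w) f = act A k s ([] @ number n ?w) ?g"
    by (rule act_fill_disjoint)
      (use w tangle_number[OF wt, of n] less in
        \<open>auto simp: fill_number_nth labels_number simp flip: not_less\<close>)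
  moreover have "act A k s ([] @ number 0 ?w) (\<lambda>i. contents ?w ! (i - 0))
      = act A k s ([] @ number n ?w) ?g"
    by (rule act_fill_disjoint)
      (use tangle_number[OF wt] admissible_number[OF wt, of 0] le fill_number_nth[of ?w 0] in
        \<open>auto simp: fill_number_nth labels_number\<close>)
  ultimately show ?thesis
    by (simp add: ev_def)
qed

lemma ev_fillI:
  assumes "wt s k w k" "fill f x = w" "distinct (labels x)"
  shows "ev k s w = act A k s x f"
  using assms wt_fill[of s k f x k] act_fill[of k x s f] by (simp add: tangle_def)

lemma wt_append: "wt s m (u @ v) n \<longleftrightarrow> (\<exists>l. wt s m u l \<and> wt s l v n)"
  by (induction s m u n rule: wt.induct) auto

lemma wt_appendI: "wt s m u l \<Longrightarrow> wt s l v n \<Longrightarrow> wt s m (u @ v) n"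
  by (auto simp: wt_append)

lemma wt_widen: "wt s m w n \<Longrightarrow> wt s (m + b) w (n + b)"
  by (induction s m w n rule: wt.induct) auto

lemma wt_shift: "wt (shade_at s a) m w n \<Longrightarrow> wt s (a + m + b) (fshift a w) (a + n + b)"
proof (induction w arbitrary: m)
  case (Cons x w)
  obtain c e where x: "x = (c, e)"
    by force
  show ?case
  proof (cases e)
    case FCup
    then show ?thesis
      using Cons.prems Cons.IH[of "m + 2"] by (auto simp: x ac_simps)
  next
    case FCap
    then show ?thesis
      using Cons.prems Cons.IH[of "m - 2"] by (auto simp: x)
  next
    case (FBox k y)
    then show ?thesis
      using Cons.prems Cons.IH[of m] by (auto simp: x)
  qed
qed simp

lemma wt_parity: "wt s m w n \<Longrightarrow> even (m + n)"
  by (induction s m w n rule: wt.induct) auto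

lemma wt_det: "wt s m w n \<Longrightarrow> wt s m w n' \<Longrightarrow> n = n'"
  by (induction s m w n rule: wt.induct) auto

lemma ev_closed: "wt s k w k \<Longrightarrow> ev k s w \<in> box_space A k s"
  unfolding ev_def using tangle_number[of s k w 0] admissible_number[of s k w k 0]
  by (simp add: act_closed)

text \<open>
  A box may be replaced by any diagram of which it carries the value. All substitution arguments
  below rest on this form of the composition axiom.
\<close>

lemma ev_plug:
  assumes wt: "wt s k (u @ (a, FBox j (ev j (shade_at s a) w)) # v) k"
    and w: "wt (shade_at s a) j w j"
  shows "ev k s (u @ (a, FBox j (ev j (shade_at s a) w)) # v) = ev k s (u @ fshift a w @ v)"
proof -
  let ?x = "ev j (shade_at s a) w"
  let ?i = "length (contents u)"
  let ?n = "Suc ?i + length (contents v)"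
  let ?U = "number 0 u" and ?V = "number (Suc ?i) v" and ?W = "number ?n w"
  let ?F = "(!) (contents u @ [?x] @ contents v @ contents w)"
  have U: "fill ?F ?U = u" and val: "fill ?F ?V = v" and W: "fill ?F ?W = w"
    by (rule fill_number; simp add: nth_append)+
  have big: "wt s k (u @ fshift a w @ v) k"
  proof -
    obtain l where l: "wt s k u l" "a + j \<le> l" "wt s l v k"
      using wt by (auto simp: wt_append)
    have "wt s (a + j + (l - (a + j))) (fshift a w) (a + j + (l - (a + j)))"
      by (rule wt_shift[OF w])
    with l show ?thesis
      by (auto intro!: wt_appendI)
  qed
  have plug: "plug ?i ?W (?U @ (a, Box j ?i) # ?V) = ?U @ shift a ?W @ ?V"
    using plug_fresh[of ?i ?U ?W] plug_fresh[of ?i ?V ?W]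
    by (simp add: labels_number del: upt_Suc)
  have "ev k s (u @ fshift a w @ v) = act A k s (?U @ shift a ?W @ ?V) ?F"
    by (rule ev_fillI[OF big]) (use U val W in \<open>auto simp: labels_number\<close>)
  also have "\<dots> = act A k s (?U @ (a, Box j ?i) # ?V)
      (?F(?i := act A j (shade_at s a) ?W ?F))"
  proof -
    have 1: "tangle k (?U @ (a, Box j ?i) # ?V)"
      using wt wt_fill[of s k ?F "?U @ (a, Box j ?i) # ?V" k] U val
      by (auto simp: tangle_def labels_number)
    have 2: "tangle j ?W"
      by (rule tangle_number[OF w])
    have 3: "tangle k (?U @ shift a ?W @ ?V)" "admissible A s (?U @ shift a ?W @ ?V) ?F"
      using big wt_fill[of s k ?F "?U @ shift a ?W @ ?V" k] U val W
      by (auto simp: tangle_def labels_number)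
    show ?thesis
      using act_plug[OF 1 _ 2, of a ?i s ?F] 3 plug by simp
  qed
  also have "act A j (shade_at s a) ?W ?F = ?x"
    by (rule ev_fillI[OF w W, symmetric]) (simp add: labels_number)
  also have "act A k s (?U @ (a, Box j ?i) # ?V) (?F(?i := ?x)) =
      ev k s (u @ (a, FBox j ?x) # v)"
  proof (rule ev_fillI[OF wt, symmetric])
    have "?F(?i := ?x) = ?F"
      by (auto simp: nth_append)
    then show "fill (?F(?i := ?x)) (?U @ (a, Box j ?i) # ?V) = u @ (a, FBox j ?x) # v"
      using U val by simp
  qed (auto simp: labels_number)
  finally show ?thesis ..
qed

lemma ev_add:
  assumes x: "wt s k (u @ (a, FBox j x) # v) k" and y: "wt s k (u @ (a, FBox j y) # v) k"
  shows "ev k s (u @ (a, FBox j (x + y)) # v)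
    = ev k s (u @ (a, FBox j x) # v) + ev k s (u @ (a, FBox j y) # v)"
proof -
  let ?i = "length (contents u)"
  let ?W = "number 0 u @ (a, Box j ?i) # number (Suc ?i) v"
  let ?F = "\<lambda>z. ((!) (contents u @ [0] @ contents v))(?i := z)"
  have F: "fill (?F z) ?W = u @ (a, FBox j z) # v" for z
    using fill_number[of u "?F z" 0] fill_number[of v "?F z" "Suc ?i"]
    by (simp add: nth_append)
  have d: "distinct (labels ?W)"
    by (auto simp: labels_number)
  have xy: "wt s k (u @ (a, FBox j (x + y)) # v) k"
    using x y subspace by (auto simp: wt_append intro: vs.subspace_add dest: wt_det)
  have *: "ev k s (u @ (a, FBox j z) # v) = act A k s ?W (?F z)"
    if "wt s k (u @ (a, FBox j z) # v) k" for z
    by (rule ev_fillI[OF that F d])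
  have "tangle k ?W" "admissible A s ?W (?F x)" "admissible A s ?W (?F y)"
    using x y F d wt_fill[of s k "?F _" ?W k] by (auto simp: tangle_def)
  then show ?thesis
    using act_add[of k ?W ?i s "(!) (contents u @ [0] @ contents v)" x y] *[OF x] *[OF y] *[OF xy]
    by simp
qed

lemma ev_scale:
  assumes x: "wt s k (u @ (a, FBox j x) # v) k"
  shows "ev k s (u @ (a, FBox j (scale A c x)) # v) = scale A c (ev k s (u @ (a, FBox j x) # v))"
proof -
  let ?i = "length (contents u)"
  let ?W = "number 0 u @ (a, Box j ?i) # number (Suc ?i) v"
  let ?F = "\<lambda>z. ((!) (contents u @ [0] @ contents v))(?i := z)"
  have F: "fill (?F z) ?W = u @ (a, FBox j z) # v" for z
    using fill_number[of u "?F z" 0] fill_number[of v "?F z" "Suc ?i"]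
    by (simp add: nth_append)
  have d: "distinct (labels ?W)"
    by (auto simp: labels_number)
  have cx: "wt s k (u @ (a, FBox j (scale A c x)) # v) k"
    using x subspace by (auto simp: wt_append intro: vs.subspace_scale)
  have *: "ev k s (u @ (a, FBox j z) # v) = act A k s ?W (?F z)"
    if "wt s k (u @ (a, FBox j z) # v) k" for z
    by (rule ev_fillI[OF that F d])
  have "tangle k ?W" "admissible A s ?W (?F x)"
    using x F d wt_fill[of s k "?F _" ?W k] by (auto simp: tangle_def)
  then show ?thesis
    using act_scale[of k ?W ?i s "(!) (contents u @ [0] @ contents v)" x c] *[OF x] *[OF cx]
    by simp
qed

end

section \<open>Equality of filled words in every context\<close>

fun erase :: "nat \<Rightarrow> 'a filled \<Rightarrow> piece" where
  "erase i FCup = Cup"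
| "erase i FCap = Cap"
| "erase i (FBox k x) = Box k i"

fun content :: "'a filled \<Rightarrow> 'a" where
  "content (FBox k x) = x"
| "content e = undefined"

lemma erase_simps [simp]: "ins (erase i e) = fins e" "outs (erase i e) = fouts e"
    "fill_piece f (erase i e) = (case e of FCup \<Rightarrow> FCup | FCap \<Rightarrow> FCap | FBox k x \<Rightarrow> FBox k (f i))"
  by (cases e; simp)+

lemma shift_ncups [simp]: "shift a (ncups b k) = ncups (a + b) k"
  using arg_cong[OF map_add_upt[of a b k], of "map (\<lambda>x. (x, Cup))"]
  by (simp add: ncups_def shift_def comp_def)

lemma shift_ncaps [simp]: "shift a (ncaps b k) = ncaps (a + b) k"
  using arg_cong[OF map_add_upt[of a b k], of "\<lambda>l. map (\<lambda>x. (x, Cap)) (rev l)"]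
  by (simp add: ncaps_def shift_def comp_def rev_map)

lemma move_shift: "move x y \<Longrightarrow> move (shift c x) (shift c y)"
proof (induction rule: move.induct)
  case (exchange a e r e')
  show ?case
    using move.exchange[of "c + a" e r e'] by (simp add: add.assoc)
next
  case (zigzag1 a)
  show ?case
    using move.zigzag1[of "c + a"] by simp
next
  case (zigzag2 a)
  show ?case
    using move.zigzag2[of "c + a"] by simp
next
  case (full_turn a k i)
  show ?case
    using move.full_turn[of "c + a" k i] by (simp add: add.assoc)
qed

lemma fcups_0 [simp]: "fcups a 0 = []" and fcaps_0 [simp]: "fcaps a 0 = []"
  by (simp_all add: fcups_def fcaps_def)

lemma fcups_Suc: "fcups a (Suc k) = fcups a k @ [(a + k, FCup)]"
  and fcaps_Suc: "fcaps a (Suc k) = (a + k, FCap) # fcaps a k"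
  by (simp_all add: fcups_def fcaps_def)

lemma fcups_Suc': "fcups a (Suc k) = (a, FCup) # fcups (Suc a) k"
  and fcaps_Suc': "fcaps a (Suc k) = fcaps (Suc a) k @ [(a, FCap)]"
  by (simp_all add: fcups_def fcaps_def upt_conv_Cons del: upt_Suc)

lemma fcups_add: "fcups a (j + k) = fcups a j @ fcups (a + j) k"
  and fcaps_add: "fcaps a (j + k) = fcaps (a + j) k @ fcaps a j"
  by (induction k) (simp_all add: fcups_Suc fcaps_Suc add.assoc)

context planar_algebra
begin

lemma wt_fcups [simp]: "wt s m (fcups a k) n \<longleftrightarrow> (k = 0 \<or> a \<le> m) \<and> n = m + 2 * k"
  by (induction k arbitrary: n) (auto simp: fcups_Suc wt_append)

lemma wt_fcaps [simp]: "wt s m (fcaps a k) n \<longleftrightarrow> (k = 0 \<or> a + 2 * k \<le> m) \<and> m = n + 2 * k"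
proof (induction k arbitrary: m)
  case (Suc k)
  show ?case
    by (simp add: fcaps_Suc Suc.IH) arith
qed auto

definition ceq :: "shading \<Rightarrow> nat \<Rightarrow> nat \<Rightarrow> 'a fword \<Rightarrow> 'a fword \<Rightarrow> bool" where
  "ceq s m n w w' \<longleftrightarrow> wt s m w n \<and> wt s m w' n \<and>
     (\<forall>t a b k u v. shade_at t a = s \<longrightarrow> wt t k u (a + m + b) \<longrightarrow> wt t (a + n + b) v k \<longrightarrow>
        ev k t (u @ fshift a w @ v) = ev k t (u @ fshift a w' @ v))"

lemma ceq_wt: "ceq s m n w w' \<Longrightarrow> wt s m w n" "ceq s m n w w' \<Longrightarrow> wt s m w' n"
  by (auto simp: ceq_def)

lemma ceq_refl: "wt s m w n \<Longrightarrow> ceq s m n w w"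
  by (simp add: ceq_def)

lemma ceq_sym: "ceq s m n w w' \<Longrightarrow> ceq s m n w' w"
  by (simp add: ceq_def)

lemma ceq_trans [trans]: "ceq s m n w w' \<Longrightarrow> ceq s m n w' w'' \<Longrightarrow> ceq s m n w w''"
  by (auto simp: ceq_def)

text \<open>
  The quantification over all surrounding words in \<open>ceq\<close>, with strands passing on both sides, makes
  compatibility with stacking and juxtaposition a matter of reassociating lists.
\<close>

lemma ceq_ctx:
  assumes "ceq s l l' x y" "wt s m u l" "wt s l' v n"
  shows "ceq s m n (u @ x @ v) (u @ y @ v)"
  unfolding ceq_def
proof (intro conjI allI impI)
  show "wt s m (u @ x @ v) n" "wt s m (u @ y @ v) n"
    using assms by (meson ceq_wt wt_appendI)+
  fix t a b k U val
  assume t: "shade_at t a = s" "wt t k U (a + m + b)" "wt t (a + n + b) val k"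
  have "wt t k (U @ fshift a u) (a + l + b)" "wt t (a + l' + b) (fshift a v @ val) k"
    using t assms wt_shift[of t a m u l b] wt_shift[of t a l' v n b] by (auto intro: wt_appendI)
  then have "ev k t ((U @ fshift a u) @ fshift a x @ (fshift a v @ val)) =
      ev k t ((U @ fshift a u) @ fshift a y @ (fshift a v @ val))"
    using assms(1) t(1) unfolding ceq_def by blast
  then show "ev k t (U @ fshift a (u @ x @ v) @ val) = ev k t (U @ fshift a (u @ y @ v) @ val)"
    by simp
qed

lemma ceq_append: "ceq s m n u u' \<Longrightarrow> ceq s n l v v' \<Longrightarrow> ceq s m l (u @ v) (u' @ v')"
  using ceq_ctx[of s m n u u' m "[]" v l] ceq_ctx[of s n l v v' m u' "[]" l]
  by (auto dest: ceq_wt intro: ceq_trans)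

lemma ceq_shift:
  assumes "ceq (shade_at s a) m n x y"
  shows "ceq s (a + m + b) (a + n + b) (fshift a x) (fshift a y)"
  unfolding ceq_def
proof (intro conjI allI impI)
  show "wt s (a + m + b) (fshift a x) (a + n + b)" "wt s (a + m + b) (fshift a y) (a + n + b)"
    using assms by (auto intro: wt_shift dest: ceq_wt)
  fix t c d k U val
  assume t: "shade_at t c = s" "wt t k U (c + (a + m + b) + d)" "wt t (c + (a + n + b) + d) val k"
  have "shade_at t (c + a) = shade_at s a"
    using t(1) by auto
  moreover have "wt t k U ((c + a) + m + (b + d))" "wt t ((c + a) + n + (b + d)) val k"
    using t by (simp_all add: ac_simps)
  ultimately show "ev k t (U @ fshift c (fshift a x) @ val) = ev k t (U @ fshift c (fshift a y) @ val)"
    using assms unfolding ceq_def fshift_fshift by blast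
qed

lemma ceq_widen: "ceq s m n x y \<Longrightarrow> ceq s (m + b) (n + b) x y"
  using ceq_shift[of s 0 m n x y b] by simp

lemma ceq_ev: "ceq s k k w w' \<Longrightarrow> ev k s w = ev k s w'"
  unfolding ceq_def by (metis add.left_neutral add.right_neutral append.left_neutral append.right_neutral
      fshift_0 shade_at_0 wt.simps(1))

lemma ceq_box:
  assumes "wt s k w k"
  shows "ceq s k k [(0, FBox k (ev k s w))] w"
  unfolding ceq_def
proof (intro conjI allI impI)
  show "wt s k [(0, FBox k (ev k s w))] k" "wt s k w k"
    using assms by (auto intro: ev_closed)
  fix t a b j u v
  assume t: "shade_at t a = s" "wt t j u (a + k + b)" "wt t (a + k + b) v j"
  have "wt t j (u @ (a, FBox k (ev k s w)) # v) j"
    by (rule wt_appendI[OF t(2)]) (use t assms in \<open>auto intro: ev_closed\<close>)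
  then show "ev j t (u @ fshift a [(0, FBox k (ev k s w))] @ v) = ev j t (u @ fshift a w @ v)"
    using ev_plug[of t j u a k w v] assms t(1) by auto
qed

lemma ev_box: "x \<in> box_space A k s \<Longrightarrow> ev k s [(0, FBox k x)] = x"
  using act_identity[of "(!) [x]" 0 k s] by (simp add: ev_def)

text \<open>
  Labels below 2 are reserved for the boxes of the move, which has at most two; the surrounding word
  is numbered from 2 on.
\<close>

lemma ceq_move:
  assumes xy: "move x y" and labels: "set (labels x) = set (labels y)" "set (labels x) \<subseteq> {..<2}"
      "distinct (labels x)" "distinct (labels y)"
    and wt: "wt s m (fill f x) n" "wt s m (fill f y) n"
  shows "ceq s m n (fill f x) (fill f y)"
  unfolding ceq_def
proof (intro conjI allI impI wt)
  fix t a b k u v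
  assume t: "shade_at t a = s" "wt t k u (a + m + b)" "wt t (a + n + b) v k"
  let ?n = "2 + length (contents u)"
  let ?U = "number 2 u" and ?V = "number ?n v"
  let ?F = "\<lambda>i. if i < 2 then f i else (contents u @ contents v) ! (i - 2)"
  let ?W = "\<lambda>x. ?U @ shift a x @ ?V"
  have U: "fill ?F ?U = u" and val: "fill ?F ?V = v"
    by (rule fill_number; simp add: nth_append)+
  have F: "fill ?F z = fill f z" if "set (labels z) \<subseteq> {..<2}" for z
    by (rule fill_cong) (use that in auto)
  have x: "fill ?F (?W x) = u @ fshift a (fill f x) @ v"
    and y: "fill ?F (?W y) = u @ fshift a (fill f y) @ v"
    using labels U val F[of x] F[of y] by simp_all
  have wts: "wt t k (fill ?F (?W x)) k" "wt t k (fill ?F (?W y)) k"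
    unfolding x y using t wt wt_shift[of t a m _ n b] by (auto intro!: wt_appendI)
  have "i \<notin> set (labels z)" if "set (labels z) \<subseteq> {..<2}" "2 \<le> i" for z i
    using that by (auto dest: subsetD)
  then have dist: "distinct (labels (?W x))" "distinct (labels (?W y))"
    using labels by (auto simp: labels_number simp del: upt_Suc)
  have "tangle k (?W x)" "tangle k (?W y)"
    using wts dist unfolding wt_fill tangle_def by blast+
  then have "isotopic k (?W x) (?W y)"
    by (rule isotopic.local) (rule move_shift[OF xy])
  moreover have "admissible A t (?W x) ?F"
    using wts(1) by (simp only: wt_fill)
  ultimately have "act A k t (?W x) ?F = act A k t (?W y) ?F"
    by (rule act_isotopic)
  moreover have "ev k t (u @ fshift a (fill f x) @ v) = act A k t (?W x) ?F"
    by (rule ev_fillI) (use wts x dist in auto)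
  moreover have "ev k t (u @ fshift a (fill f y) @ v) = act A k t (?W y) ?F"
    by (rule ev_fillI) (use wts y dist in auto)
  ultimately show "ev k t (u @ fshift a (fill f x) @ v) = ev k t (u @ fshift a (fill f y) @ v)"
    by simp
qed

lemma ceq_zigzag1: "a < m \<Longrightarrow> ceq s m m [(a, FCup), (Suc a, FCap)] []"
  using ceq_move[OF move.zigzag1[of a], of s m "\<lambda>_. undefined" m] by simp

lemma ceq_zigzag2: "a < m \<Longrightarrow> ceq s m m [(Suc a, FCup), (a, FCap)] []"
  using ceq_move[OF move.zigzag2[of a], of s m "\<lambda>_. undefined" m] by simp

lemma wt_single: "wt s m [(a, e)] n \<longleftrightarrow> a + fins e \<le> m \<and> n = m - fins e + fouts e \<and>
    (case e of FBox k x \<Rightarrow> x \<in> box_space A k (shade_at s a) | _ \<Rightarrow> True)"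
  by (cases e) auto

lemma wt_Cons: "wt s m ((a, e) # w) n \<longleftrightarrow>
    wt s m [(a, e)] (m - fins e + fouts e) \<and> wt s (m - fins e + fouts e) w n"
  by (cases e) auto

lemma even_in_out: "even (fins e + fouts e)"
  by (cases e) auto

lemma ceq_exchange:
  assumes "wt s m [(a + fins e + r, e'), (a, e)] n"
  shows "ceq s m n [(a + fins e + r, e'), (a, e)] [(a, e), (a + fouts e + r, e')]"
proof -
  let ?f = "\<lambda>i. if i = 0 then content e else content e'"
  let ?x = "[(a + fins e + r, erase 1 e'), (a, erase 0 e)]"
  let ?y = "[(a, erase 0 e), (a + fouts e + r, erase 1 e')]"
  have move: "move ?x ?y"
    using move.exchange[of a "erase 0 e" r "erase 1 e'"] by simp
  have 1: "fill ?f ?x = [(a + fins e + r, e'), (a, e)]"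
    "fill ?f ?y = [(a, e), (a + fouts e + r, e')]"
    by (cases e; cases e'; simp)+
  have "shade_at s (a + fouts e + r) = shade_at s (a + fins e + r)"
    by (rule shade_at_parity) (use even_in_out[of e] in auto)
  then have 2: "wt s m [(a, e), (a + fouts e + r, e')] n"
    using assms by (cases e; cases e') auto
  show ?thesis
    using ceq_move[OF move, of s m ?f n] assms 2 unfolding 1
    by (cases e; cases e') auto
qed

lemma shade_at_wt: "wt s m w n \<Longrightarrow> shade_at s n = shade_at s m"
  by (rule shade_at_parity) (use wt_parity[of s m w n] in auto)

lemma ceq_interchange1:
  assumes "wt s m [(a, e)] n" "wt (shade_at s m) m' w n'"
  shows "ceq s (m + m') (n + n') ((a, e) # fshift n w) (fshift m w @ [(a, e)])"
  using assms(2)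
proof (induction w arbitrary: m')
  case Nil
  then show ?case
    using wt_widen[OF assms(1), of m'] by (auto intro: ceq_refl)
next
  case (Cons x w)
  obtain b e' where x: "x = (b, e')"
    by force
  let ?l = "m' - fins e' + fouts e'"
  have e': "wt (shade_at s m) m' [(b, e')] ?l" and w: "wt (shade_at s m) ?l w n'"
    using iffD1[OF wt_Cons Cons.prems[unfolded x]] by auto
  define r where "r = m - (a + fins e) + b"
  have r: "m + b = a + fins e + r" "n + b = a + fouts e + r"
    using assms(1) by (auto simp: r_def wt_single)
  have m: "wt s (m + m') [(m + b, e'), (a, e)] (n + ?l)"
    using wt_shift[OF e', of 0] wt_widen[OF assms(1), of ?l] wt_appendI[of s "m + m'" "[(m + b, e')]" "m + ?l" "[(a, e)]" "n + ?l"]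
    by simp
  have "ceq s (m + m') (n + n') ((a, e) # fshift n (x # w)) ([(m + b, e')] @ ((a, e) # fshift n w))"
  proof -
    have "ceq s (m + m') (n + ?l) [(a, e), (n + b, e')] [(m + b, e'), (a, e)]"
      using ceq_exchange[of s "m + m'" a e r e' "n + ?l"] m unfolding r by (auto intro: ceq_sym)
    moreover have "wt s (n + ?l) (fshift n w) (n + n')"
      using wt_shift[of s n ?l w n' 0] w shade_at_wt[OF assms(1)] by simp
    ultimately show ?thesis
      using ceq_ctx[of s "m + m'" "n + ?l" "[(a, e), (n + b, e')]" "[(m + b, e'), (a, e)]"
          "m + m'" "[]" "fshift n w" "n + n'"] by (simp add: x)
  qed
  also have "ceq s (m + m') (n + n') \<dots> ([(m + b, e')] @ (fshift m w @ [(a, e)]))"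
    using wt_shift[OF e', of 0] Cons.IH[OF w] by (intro ceq_append ceq_refl) auto
  finally show ?case
    by (simp add: x)
qed

text \<open>
  The exchange move extends from pieces to words lying side by side.
\<close>

lemma ceq_interchange:
  assumes "wt s m w n" "wt (shade_at s m) m' w' n'"
  shows "ceq s (m + m') (n + n') (w @ fshift n w') (fshift m w' @ w)"
  using assms
proof (induction w arbitrary: m)
  case Nil
  then show ?case
    using wt_shift[of s m m' w' n' 0] by (auto intro: ceq_refl)
next
  case (Cons x w)
  obtain a e where x: "x = (a, e)"
    by force
  let ?l = "m - fins e + fouts e"
  have e: "wt s m [(a, e)] ?l" and w: "wt s ?l w n"
    using iffD1[OF wt_Cons Cons.prems(1)[unfolded x]] by auto
  have w': "wt (shade_at s ?l) m' w' n'"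
    using Cons.prems shade_at_wt[OF e] by simp
  have "ceq s (m + m') (n + n') ([(a, e)] @ (w @ fshift n w')) ([(a, e)] @ (fshift ?l w' @ w))"
    by (rule ceq_append[OF ceq_refl[OF wt_widen[OF e, of m']] Cons.IH[OF w w']])
  also have "ceq s (m + m') (n + n') \<dots> ((fshift m w' @ [(a, e)]) @ w)"
    using ceq_append[OF ceq_interchange1[OF e Cons.prems(2)] ceq_refl[OF wt_widen[OF w, of n']]]
    by simp
  finally show ?case
    by (simp add: x)
qed

text \<open>
  The two zigzag moves extend to several parallel strands: the innermost zigzag is pulled straight
  after the remaining cups and caps have been moved out of its way.
\<close>

lemma ceq_snake_right: "ceq s (m + j) (m + j) (fcups m j @ fcaps (m + j) j) []"
proof (induction j)
  case (Suc j)
  let ?n = "m + Suc j"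
  have 1: "ceq s (?n + 2 * j) (?n + 2) ([(m + j, FCup)] @ fcaps (m + j + 2) j)
      (fcaps (m + j) j @ [(m + j, FCup)])"
    using ceq_interchange[of s "m + j" "[(m + j, FCup)]" "m + j + 2" "Suc (2 * j)" "fcaps 0 j" 1]
    by (simp add: numeral_2_eq_2 ac_simps)
  have "ceq s ?n ?n (fcups m (Suc j) @ fcaps ?n (Suc j))
      (fcups m j @ (fcaps (m + j) j @ [(m + j, FCup)]) @ [(Suc (m + j), FCap)])"
    using ceq_ctx[OF 1, of ?n "fcups m j" "[(Suc (m + j), FCap)]" ?n]
    by (simp add: fcups_Suc fcaps_Suc')
  also have "ceq s ?n ?n \<dots> ([] @ [(m + j, FCup), (Suc (m + j), FCap)])"
    using ceq_ctx[of s ?n ?n "fcups m j @ fcaps (m + j) j" "[]" ?n "[]"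
        "[(m + j, FCup), (Suc (m + j), FCap)]" ?n] ceq_widen[OF Suc, of 1]
    by simp
  also have "ceq s ?n ?n \<dots> []"
    using ceq_zigzag1[of "m + j" ?n] by simp
  finally show ?case .
qed (auto intro: ceq_refl)

lemma ceq_snake_left: "ceq s (a + j) (a + j) (fcups (a + j) j @ fcaps a j) []"
proof (induction j)
  case (Suc j)
  let ?n = "a + Suc j"
  have 1: "ceq s (?n + 2) (?n + 2 * j) (fcups (?n + 1) j @ [(a + j, FCap)])
      ([(a + j, FCap)] @ fcups (a + j) j)"
    using ceq_sym[OF ceq_interchange[of s "a + j + 2" "[(a + j, FCap)]" "a + j" 1 "fcups 0 j" "Suc (2 * j)"]]
    by (simp add: numeral_2_eq_2 ac_simps)
  have "ceq s ?n ?n (fcups ?n (Suc j) @ fcaps a (Suc j))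
      ([(?n, FCup)] @ ([(a + j, FCap)] @ fcups (a + j) j) @ fcaps a j)"
    using ceq_ctx[OF 1, of ?n "[(?n, FCup)]" "fcaps a j" ?n]
    by (simp add: fcups_Suc' fcaps_Suc)
  also have "ceq s ?n ?n \<dots> ([(Suc (a + j), FCup), (a + j, FCap)] @ [])"
    using ceq_ctx[of s ?n ?n "fcups (a + j) j @ fcaps a j" "[]" ?n
        "[(Suc (a + j), FCup), (a + j, FCap)]" "[]" ?n] ceq_widen[OF Suc, of 1]
    by simp
  also have "ceq s ?n ?n \<dots> []"
    using ceq_zigzag2[of "a + j" ?n] by simp
  finally show ?case .
qed (auto intro: ceq_refl)

section \<open>Diagrams with different numbers of strands at the bottom and at the top\<close>

text \<open>
  \<open>val\<close> straightens a diagram from \<open>m\<close> to \<open>n\<close> strands into an element, and \<open>bend\<close> is the diagram given by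
  an element, in accordance with \<open>straighten\<close> and \<open>bent_box\<close>. That these operations are mutually inverse
  is the content of \<open>ceq_bend_val\<close> and \<open>val_bend\<close>. The set \<open>hom s m n\<close> is empty if \<open>m + n\<close> is odd, so that
  membership carries the parity along.
\<close>

definition val :: "shading \<Rightarrow> nat \<Rightarrow> nat \<Rightarrow> 'a fword \<Rightarrow> 'a" where
  "val s m n w = ev ((m + n) div 2) s
     (fcups ((m + n) div 2) ((m - n) div 2) @ w @ fcaps ((m + n) div 2) ((n - m) div 2))"

definition bend :: "nat \<Rightarrow> nat \<Rightarrow> 'a \<Rightarrow> 'a fword" where
  "bend m n x = fcups m ((n - m) div 2) @ [(0, FBox ((m + n) div 2) x)] @ fcaps n ((m - n) div 2)"

definition hom :: "shading \<Rightarrow> nat \<Rightarrow> nat \<Rightarrow> 'a set" where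
  "hom s m n = {x \<in> box_space A ((m + n) div 2) s. even (m + n)}"

lemma even_cases:
  assumes "even (m + n :: nat)"
  obtains j where "n = m + 2 * j" | j where "m = n + 2 * j"
  using assms by (metis evenE even_diff_nat le_add_diff_inverse linorder_le_cases even_add)

lemma div_simps [simp]: "(m + (m + 2 * j)) div 2 = m + (j::nat)" "(m + 2 * j + m) div 2 = m + (j::nat)"
  by presburger+

lemma hom_even: "x \<in> hom s m n \<Longrightarrow> even (m + n)"
  by (simp add: hom_def)

lemma wt_bend: "x \<in> hom s m n \<Longrightarrow> wt s m (bend m n x) n"
  by (frule hom_even, erule even_cases) (auto simp: bend_def hom_def intro!: wt_appendI)

lemma wt_straighten:
  assumes "wt s m w n"
  defines "k \<equiv> (m + n) div 2"
  shows "wt s k (fcups k ((m - n) div 2) @ w @ fcaps k ((n - m) div 2)) k"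
  using wt_parity[OF assms(1)]
proof (cases rule: even_cases)
  case (1 j)
  then show ?thesis
    using wt_widen[OF assms(1), of j] by (auto simp: k_def intro!: wt_appendI)
next
  case (2 j)
  then show ?thesis
    using wt_widen[OF assms(1), of j] by (auto simp: k_def intro!: wt_appendI)
qed

lemma val_in_hom: "wt s m w n \<Longrightarrow> val s m n w \<in> hom s m n"
  using ev_closed[OF wt_straighten[of s m w n]] wt_parity[of s m w n] by (simp add: val_def hom_def)

lemma val_cong:
  assumes "ceq s m n w w'"
  shows "val s m n w = val s m n w'"
  using wt_parity[OF ceq_wt(1)[OF assms]]
proof (cases rule: even_cases)
  case (1 j)
  then show ?thesis
    using ceq_ev[OF ceq_ctx[OF ceq_widen[OF assms, of j], of "m + j" "[]" "fcaps (m + j) j" "m + j"]]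
    by (simp add: val_def)
next
  case (2 j)
  then show ?thesis
    using ceq_ev[OF ceq_ctx[OF ceq_widen[OF assms, of j], of "n + j" "fcups (n + j) j" "[]" "n + j"]]
    by (simp add: val_def)
qed

text \<open>
  Bending after straightening produces a zigzag at the right of the diagram; it is a right or a left
  snake according to which of the two ends has more strands.
\<close>

lemma ceq_bend_val:
  assumes w: "wt s m w n"
  shows "ceq s m n (bend m n (val s m n w)) w"
  using wt_parity[OF w]
proof (cases rule: even_cases)
  case (1 j)
  have st: "wt s (m + j) (w @ fcaps (m + j) j) (m + j)"
    using wt_straighten[OF w] 1 by simp
  have "ceq s m n (bend m n (val s m n w)) (fcups m j @ w @ fcaps (m + j) j)"
    using ceq_ctx[OF ceq_widen[OF ceq_box[OF st], of j], of m "fcups m j" "[]" n] 1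
    by (simp add: bend_def val_def)
  also have "ceq s m n \<dots> (w @ fcups n j @ fcaps (m + j) j)"
  proof -
    have "ceq s m (n + 2 * j) (fcups m j @ w) (w @ fcups n j)"
      using ceq_sym[OF ceq_interchange[OF w, of 0 "fcups 0 j" "2 * j"]] by simp
    from ceq_ctx[OF this, of m "[]" "fcaps (m + j) j" n] show ?thesis
      using 1 by simp
  qed
  also have "ceq s m n \<dots> (w @ [])"
    using ceq_snake_left[of s "m + j" j] 1 w
    by (intro ceq_append ceq_refl) (simp_all add: mult_2 add.assoc)
  finally show ?thesis
    by simp
next
  case (2 j)
  have st: "wt s (n + j) (fcups (n + j) j @ w) (n + j)"
    using wt_straighten[OF w] 2 by simp
  have "ceq s m n (bend m n (val s m n w)) ((fcups (n + j) j @ w) @ fcaps n j)"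
    using ceq_ctx[OF ceq_widen[OF ceq_box[OF st], of j], of m "[]" "fcaps n j" n] 2
    by (simp add: bend_def val_def)
  also have "ceq s m n \<dots> (fcups (n + j) j @ fcaps m j @ w)"
  proof -
    have "ceq s (m + 2 * j) n (w @ fcaps n j) (fcaps m j @ w)"
      using ceq_interchange[OF w, of "2 * j" "fcaps 0 j" 0] by simp
    from ceq_ctx[OF this, of m "fcups (n + j) j" "[]" n] show ?thesis
      using 2 by simp
  qed
  also have "ceq s m n \<dots> ([] @ w)"
    using ceq_append[OF ceq_snake_right[of s "n + j" j] ceq_refl, of w n] w 2
    by (simp add: mult_2 add.assoc)
  finally show ?thesis
    by simp
qed

lemma val_bend:
  assumes "x \<in> hom s m n"
  shows "val s m n (bend m n x) = x"
  using hom_even[OF assms]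
proof (cases rule: even_cases)
  case (1 j)
  let ?k = "m + j"
  have x: "wt s ?k [(0, FBox ?k x)] ?k"
    using assms 1 by (simp add: hom_def)
  have "ceq s (?k + 2 * j) ?k ([(0, FBox ?k x)] @ fcaps ?k j) (fcaps ?k j @ [(0, FBox ?k x)])"
    using ceq_interchange[OF x, of "2 * j" "fcaps 0 j" 0] by simp
  then have "ceq s ?k ?k (fcups m j @ [(0, FBox ?k x)] @ fcaps ?k j)
      ((fcups m j @ fcaps ?k j) @ [(0, FBox ?k x)])"
    using ceq_ctx[of s "?k + 2 * j" ?k _ _ ?k "fcups m j" "[]" ?k] by simp
  also have "ceq s ?k ?k \<dots> ([] @ [(0, FBox ?k x)])"
    by (rule ceq_append[OF ceq_snake_right ceq_refl[OF x]])
  finally have "ev ?k s (fcups m j @ [(0, FBox ?k x)] @ fcaps ?k j) = x"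
    using assms 1 by (auto dest!: ceq_ev simp: ev_box hom_def)
  then show ?thesis
    by (simp add: val_def bend_def 1)
next
  case (2 j)
  let ?k = "n + j"
  have x: "wt s ?k [(0, FBox ?k x)] ?k"
    using assms 2 by (simp add: hom_def)
  have "ceq s ?k (?k + 2 * j) (fcups ?k j @ [(0, FBox ?k x)]) ([(0, FBox ?k x)] @ fcups ?k j)"
    using ceq_sym[OF ceq_interchange[OF x, of 0 "fcups 0 j" "2 * j"]] by simp
  then have "ceq s ?k ?k ((fcups ?k j @ [(0, FBox ?k x)]) @ fcaps n j)
      ([(0, FBox ?k x)] @ fcups ?k j @ fcaps n j)"
    using ceq_ctx[of s ?k "?k + 2 * j" "fcups ?k j @ [(0, FBox ?k x)]"
        "[(0, FBox ?k x)] @ fcups ?k j" ?k "[]" "fcaps n j" ?k] by simp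
  also have "ceq s ?k ?k \<dots> ([(0, FBox ?k x)] @ [])"
    by (rule ceq_append[OF ceq_refl[OF x] ceq_snake_left])
  finally have "ev ?k s (fcups ?k j @ [(0, FBox ?k x)] @ fcaps n j) = x"
    using assms 2 by (auto dest!: ceq_ev simp: ev_box hom_def)
  then show ?thesis
    by (simp add: val_def bend_def 2)
qed

lemma ceq_iff_val: "wt s m w n \<Longrightarrow> wt s m w' n \<Longrightarrow> ceq s m n w w' \<longleftrightarrow> val s m n w = val s m n w'"
  by (metis val_cong ceq_bend_val ceq_sym ceq_trans)

lemma val_square: "val s k k w = ev k s w"
  by (simp add: val_def)

lemma bend_square: "bend k k x = [(0, FBox k x)]"
  by (simp add: bend_def)

section \<open>The category of diagrams\<close>

lemma hom_square: "hom s k k = box_space A k s"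
  by (simp add: hom_def)

lemma hom_subspace: "even (m + n) \<Longrightarrow> vs.subspace (hom s m n)"
  using subspace by (simp add: hom_def)

lemma hom_add [simp]: "x \<in> hom s m n \<Longrightarrow> y \<in> hom s m n \<Longrightarrow> x + y \<in> hom s m n"
  and hom_scale [simp]: "x \<in> hom s m n \<Longrightarrow> scale A c x \<in> hom s m n"
  and hom_diff [simp]: "x \<in> hom s m n \<Longrightarrow> y \<in> hom s m n \<Longrightarrow> x - y \<in> hom s m n"
  using hom_subspace hom_even by (blast intro: vs.subspace_add vs.subspace_scale vs.subspace_diff)+

lemma hom_zero: "even (m + n) \<Longrightarrow> 0 \<in> hom s m n"
  by (simp add: hom_subspace vs.subspace_0)

lemma val_add:
  assumes "wt s m (u @ (a, FBox j x) # v) n" "wt s m (u @ (a, FBox j y) # v) n"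
  shows "val s m n (u @ (a, FBox j (x + y)) # v)
    = val s m n (u @ (a, FBox j x) # v) + val s m n (u @ (a, FBox j y) # v)"
  using wt_straighten[OF assms(1)] wt_straighten[OF assms(2)]
    ev_add[of s "(m + n) div 2" "fcups ((m + n) div 2) ((m - n) div 2) @ u" a j x
      "v @ fcaps ((m + n) div 2) ((n - m) div 2)" y]
  by (simp add: val_def)

lemma val_scale:
  assumes "wt s m (u @ (a, FBox j x) # v) n"
  shows "val s m n (u @ (a, FBox j (scale A c x)) # v) = scale A c (val s m n (u @ (a, FBox j x) # v))"
  using wt_straighten[OF assms(1)]
    ev_scale[of s "(m + n) div 2" "fcups ((m + n) div 2) ((m - n) div 2) @ u" a j x
      "v @ fcaps ((m + n) div 2) ((n - m) div 2)" c]
  by (simp add: val_def)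

text \<open>
  Composition in diagrammatic order: \<open>f\<close> at the bottom, \<open>g\<close> on top of it.
\<close>

definition cmp :: "shading \<Rightarrow> nat \<Rightarrow> nat \<Rightarrow> nat \<Rightarrow> 'a \<Rightarrow> 'a \<Rightarrow> 'a" where
  "cmp s m n l f g = val s m l (bend m n f @ bend n l g)"

definition ident :: "shading \<Rightarrow> nat \<Rightarrow> 'a" where
  "ident s n = val s n n []"

lemma wt_bend_bend: "f \<in> hom s m n \<Longrightarrow> g \<in> hom s n l \<Longrightarrow> wt s m (bend m n f @ bend n l g) l"
  by (rule wt_appendI[OF wt_bend wt_bend])

lemma cmp_in [simp]: "f \<in> hom s m n \<Longrightarrow> g \<in> hom s n l \<Longrightarrow> cmp s m n l f g \<in> hom s m l"
  unfolding cmp_def by (intro val_in_hom wt_bend_bend)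

lemma ident_in [simp]: "ident s n \<in> hom s n n"
  unfolding ident_def by (intro val_in_hom) simp

lemma val_append:
  assumes "wt s m u n" "wt s n v l"
  shows "val s m l (u @ v) = cmp s m n l (val s m n u) (val s n l v)"
  unfolding cmp_def
  by (rule val_cong[OF ceq_sym[OF ceq_append[OF ceq_bend_val[OF assms(1)] ceq_bend_val[OF assms(2)]]]])

lemma cmp_assoc:
  assumes "f \<in> hom s m n" "g \<in> hom s n k" "h \<in> hom s k l"
  shows "cmp s m k l (cmp s m n k f g) h = cmp s m n l f (cmp s n k l g h)"
proof -
  have "val s m l ((bend m n f @ bend n k g) @ bend k l h) = cmp s m k l (cmp s m n k f g) h"
    using assms by (subst val_append[of _ _ _ k]) (auto simp: cmp_def val_bend intro: wt_bend wt_appendI)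
  moreover have "val s m l (bend m n f @ (bend n k g @ bend k l h)) = cmp s m n l f (cmp s n k l g h)"
    using assms by (subst val_append[of _ _ _ n]) (auto simp: cmp_def val_bend intro: wt_bend wt_appendI)
  ultimately show ?thesis
    by simp
qed

lemma cmp_ident [simp]:
  assumes "f \<in> hom s m n"
  shows "cmp s m n n f (ident s n) = f" "cmp s m m n (ident s m) f = f"
  using val_append[of s m "bend m n f" n "[]" n] val_append[of s m "[]" m "bend m n f" n] assms
  by (auto simp: ident_def val_bend wt_bend)

lemma cmp_add_left:
  assumes "f \<in> hom s m n" "f' \<in> hom s m n" "g \<in> hom s n l"
  shows "cmp s m n l (f + f') g = cmp s m n l f g + cmp s m n l f' g"
  unfolding cmp_def
  using val_add[of s m "fcups m ((n - m) div 2)" 0 "(m + n) div 2" f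
    "fcaps n ((m - n) div 2) @ bend n l g" l f'] assms wt_appendI[OF wt_bend wt_bend]
  by (simp add: bend_def)

lemma cmp_add_right:
  assumes "f \<in> hom s m n" "g \<in> hom s n l" "g' \<in> hom s n l"
  shows "cmp s m n l f (g + g') = cmp s m n l f g + cmp s m n l f g'"
  unfolding cmp_def
  using val_add[of s m "bend m n f @ fcups n ((l - n) div 2)" 0 "(n + l) div 2" g
    "fcaps l ((n - l) div 2)" l g'] assms wt_appendI[OF wt_bend wt_bend]
  by (simp add: bend_def)

lemma cmp_scale_left:
  assumes "f \<in> hom s m n" "g \<in> hom s n l"
  shows "cmp s m n l (scale A c f) g = scale A c (cmp s m n l f g)"
  unfolding cmp_def
  using val_scale[of s m "fcups m ((n - m) div 2)" 0 "(m + n) div 2" f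
    "fcaps n ((m - n) div 2) @ bend n l g" l] assms wt_appendI[OF wt_bend wt_bend]
  by (simp add: bend_def)

lemma cmp_scale_right:
  assumes "f \<in> hom s m n" "g \<in> hom s n l"
  shows "cmp s m n l f (scale A c g) = scale A c (cmp s m n l f g)"
  unfolding cmp_def
  using val_scale[of s m "bend m n f @ fcups n ((l - n) div 2)" 0 "(n + l) div 2" g
    "fcaps l ((n - l) div 2)" l] assms wt_appendI[OF wt_bend wt_bend]
  by (simp add: bend_def)

lemma cmp_zero_left: "g \<in> hom s n l \<Longrightarrow> even (m + n) \<Longrightarrow> cmp s m n l 0 g = 0"
  using cmp_scale_left[of 0 s m n g l 0] by (simp add: hom_zero)

lemma cmp_zero_right: "f \<in> hom s m n \<Longrightarrow> even (n + l) \<Longrightarrow> cmp s m n l f 0 = 0"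
  using cmp_scale_right[of f s m n 0 l 0] by (simp add: hom_zero)

lemma cmp_diff_left:
  assumes "f \<in> hom s m n" "f' \<in> hom s m n" "g \<in> hom s n l"
  shows "cmp s m n l (f - f') g = cmp s m n l f g - cmp s m n l f' g"
  using cmp_add_left[of "f - f'" s m n f' g l] assms by (simp add: hom_diff algebra_simps)

lemma cmp_diff_right:
  assumes "f \<in> hom s m n" "g \<in> hom s n l" "g' \<in> hom s n l"
  shows "cmp s m n l f (g - g') = cmp s m n l f g - cmp s m n l f g'"
  using cmp_add_right[of f s m n "g - g'" l g'] assms by (simp add: hom_diff algebra_simps)

text \<open>
  The strand on the right is invisible in the word, which only records the strands to the left of each
  piece; adding it amounts to reading the same word on one more strand.
\<close>

definition add_right :: "shading \<Rightarrow> nat \<Rightarrow> nat \<Rightarrow> 'a \<Rightarrow> 'a" where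
  "add_right s m n f = val s (Suc m) (Suc n) (bend m n f)"

lemma wt_Suc: "wt s m w n \<Longrightarrow> wt s (Suc m) w (Suc n)"
  using wt_widen[of s m w n 1] by simp

lemma ceq_Suc: "ceq s m n u v \<Longrightarrow> ceq s (Suc m) (Suc n) u v"
  using ceq_widen[of s m n u v 1] by simp

lemma add_right_in [simp]: "f \<in> hom s m n \<Longrightarrow> add_right s m n f \<in> hom s (Suc m) (Suc n)"
  unfolding add_right_def by (intro val_in_hom wt_Suc wt_bend)

lemma add_right_val: "wt s m w n \<Longrightarrow> add_right s m n (val s m n w) = val s (Suc m) (Suc n) w"
  unfolding add_right_def by (intro val_cong ceq_Suc ceq_bend_val)

lemma add_right_cmp:
  assumes "f \<in> hom s m n" "g \<in> hom s n l"
  shows "add_right s m l (cmp s m n l f g) = cmp s (Suc m) (Suc n) (Suc l) (add_right s m n f) (add_right s n l g)"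
  using add_right_val[of s m "bend m n f @ bend n l g" l]
    val_append[of s "Suc m" "bend m n f" "Suc n" "bend n l g" "Suc l"] assms
  by (simp add: cmp_def add_right_def wt_bend wt_Suc wt_bend_bend)

lemma add_right_ident [simp]: "add_right s m m (ident s m) = ident s (Suc m)"
  unfolding ident_def by (subst add_right_val) auto

lemma add_right_zero: "even (m + n) \<Longrightarrow> add_right s m n 0 = 0"
  using val_scale[of s "Suc m" "fcups m ((n - m) div 2)" 0 "(m + n) div 2" 0
    "fcaps n ((m - n) div 2)" "Suc n" 0] wt_Suc[OF wt_bend[OF hom_zero]]
  by (simp add: add_right_def bend_def)

lemma empty_diagram_eq: "empty_diagram A s = ident s 0"
  by (simp add: empty_diagram_def strands_def element_def ident_def val_square ev_def)
    (rule act_cong, auto simp: tangle_def admissible_def)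

lemma strands_eq: "strands A k s = ident s k"
  by (simp add: strands_def element_def ident_def val_square ev_def)
    (rule act_cong, auto simp: tangle_def admissible_def)

end

section \<open>Adjoints\<close>

fun adj_piece :: "'a planar_structure \<Rightarrow> shading \<Rightarrow> nat \<times> 'a filled \<Rightarrow> nat \<times> 'a filled" where
  "adj_piece A s (a, FCup) = (a, FCap)"
| "adj_piece A s (a, FCap) = (a, FCup)"
| "adj_piece A s (a, FBox k x) = (a, FBox k (adj A k (shade_at s a) x))"

definition adj_word :: "'a planar_structure \<Rightarrow> shading \<Rightarrow> 'a fword \<Rightarrow> 'a fword" where
  "adj_word A s w = rev (map (adj_piece A s) w)"

lemma adj_word_simps [simp]:
  "adj_word A s [] = []"
  "adj_word A s (u @ v) = adj_word A s v @ adj_word A s u"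
  "adj_word A s (x # v) = adj_word A s v @ [adj_piece A s x]"
  by (simp_all add: adj_word_def)

lemma adj_word_fcups [simp]: "adj_word A s (fcups a k) = fcaps a k"
  and adj_word_fcaps [simp]: "adj_word A s (fcaps a k) = fcups a k"
  by (induction k) (simp_all add: fcups_Suc fcaps_Suc)

lemma labels_reflect: "labels (reflect w) = rev (labels w)"
  unfolding reflect_def by (induction w rule: labels.induct) auto

lemma reflect_simps [simp]:
  "reflect [] = []" "reflect (x # w) = reflect w @ [(fst x, reflect_piece (snd x))]"
  by (auto simp: reflect_def case_prod_beta)

lemma diagram_reflect: "diagram m w n \<Longrightarrow> diagram n (reflect w) m"
proof (induction m w n rule: diagram.induct)
  case (2 m a e w n)
  then show ?case
    by (cases e) (auto simp: diagram_append)
qed auto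

context subfactor_planar_algebra
begin

text \<open>
  Reflection reverses the order of the boxes. The function \<open>G\<close> looks up the position of the box with a
  given label, because the adjoint to be taken depends on the shading there.
\<close>

lemma ev_adj:
  assumes w: "wt s k w k"
  shows "adj A k s (ev k s w) = ev k s (adj_word A s w)"
proof -
  let ?W = "number 0 w"
  define G where "G i = (case THE (a, j). (a, Box j i) \<in> set ?W of
      (a, j) \<Rightarrow> adj A j (shade_at s a) (contents w ! i))" for i
  have tangle: "tangle k ?W" and adm: "admissible A s ?W ((!) (contents w))"
    using tangle_number[OF w] admissible_number[OF w, of 0] by simp_all
  have uniq: "(a, j) = (b, l)"
    if "(a, Box j i) \<in> set W" "(b, Box l i) \<in> set W" "distinct (labels W)" for a b j l i W
    using that by (induction W rule: labels.induct) (auto simp: labels_iff)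
  have G: "G i = adj A j (shade_at s a) (contents w ! i)" if "(a, Box j i) \<in> set ?W" for a j i
  proof -
    have "(THE (a, j). (a, Box j i) \<in> set ?W) = (a, j)"
    proof (rule the_equality)
      show "case (a, j) of (a, j) \<Rightarrow> (a, Box j i) \<in> set ?W"
        using that by simp
      fix z
      assume "case z of (b, l) \<Rightarrow> (b, Box l i) \<in> set ?W"
      then show "z = (a, j)"
        using uniq[OF _ that] tangle unfolding tangle_def by (cases z) blast
    qed
    then show ?thesis
      by (simp add: G_def)
  qed
  have fill: "fill G (reflect W) = adj_word A s (fill F W)"
    if "\<And>a j i. (a, Box j i) \<in> set W \<Longrightarrow> G i = adj A j (shade_at s a) (F i)" for W F
    using that
  proof (induction W)
    case (Cons x W)
    obtain a e where "x = (a, e)"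
      by force
    then show ?case
      using Cons by (cases e) auto
  qed simp
  have eq: "fill G (reflect ?W) = adj_word A s w"
    using fill[OF G] fill_number[of w "(!) (contents w)" 0] by simp
  have "adj A k s (ev k s w) = act A k s (reflect ?W) G"
    unfolding ev_def by (rule adj_reflect[OF tangle adm G])
  also have "\<dots> = ev k s (fill G (reflect ?W))"
  proof (rule act_fill)
    show "tangle k (reflect ?W)"
      using tangle by (auto simp: tangle_def labels_reflect intro: diagram_reflect)
    show "admissible A s (reflect ?W) G"
      unfolding admissible_def
    proof (intro allI impI)
      fix a j i
      assume "(a, Box j i) \<in> set (reflect ?W)"
      then obtain e where "(a, e) \<in> set ?W" "reflect_piece e = Box j i"
        by (auto simp: reflect_def)
      then have *: "(a, Box j i) \<in> set ?W"
        by (cases e) auto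
      then show "G i \<in> box_space A j (shade_at s a)"
        using adm by (auto simp: G admissible_def intro: adj_closed)
    qed
  qed
  finally show ?thesis
    by (simp add: eq)
qed

definition dag :: "shading \<Rightarrow> nat \<Rightarrow> nat \<Rightarrow> 'a \<Rightarrow> 'a" where
  "dag s m n f = adj A ((m + n) div 2) s f"

lemma dag_in [simp]: "f \<in> hom s m n \<Longrightarrow> dag s m n f \<in> hom s n m"
  by (auto simp: dag_def hom_def add.commute intro: adj_closed)

lemma dag_dag [simp]: "f \<in> hom s m n \<Longrightarrow> dag s n m (dag s m n f) = f"
  by (auto simp: dag_def hom_def add.commute adj_adj)

lemma dag_add: "f \<in> hom s m n \<Longrightarrow> g \<in> hom s m n \<Longrightarrow> dag s m n (f + g) = dag s m n f + dag s m n g"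
  by (auto simp: dag_def hom_def adj_add)

lemma dag_scale: "f \<in> hom s m n \<Longrightarrow> dag s m n (scale A c f) = scale A (cnj c) (dag s m n f)"
  by (auto simp: dag_def hom_def adj_scale)

lemma dag_zero: "even (m + n) \<Longrightarrow> dag s m n 0 = 0"
  using dag_scale[of 0 s m n 0] by (simp add: hom_zero)

lemma dag_diff: "f \<in> hom s m n \<Longrightarrow> g \<in> hom s m n \<Longrightarrow> dag s m n (f - g) = dag s m n f - dag s m n g"
  using dag_add[of "f - g" s m n g] by (simp add: hom_diff)

lemma dag_val: "wt s m w n \<Longrightarrow> dag s m n (val s m n w) = val s n m (adj_word A s w)"
  using ev_adj[OF wt_straighten[of s m w n]] by (simp add: dag_def val_def add.commute)

lemma adj_word_bend: "adj_word A s (bend m n f) = bend n m (dag s m n f)"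
  by (simp add: bend_def dag_def add.commute)

lemma dag_cmp:
  assumes "f \<in> hom s m n" "g \<in> hom s n l"
  shows "dag s m l (cmp s m n l f g) = cmp s l n m (dag s n l g) (dag s m n f)"
  unfolding cmp_def using assms by (subst dag_val) (auto simp: adj_word_bend intro: wt_bend wt_appendI)

lemma dag_ident [simp]: "dag s m m (ident s m) = ident s m"
  unfolding ident_def by (subst dag_val) auto

lemma dag_add_right: "f \<in> hom s m n \<Longrightarrow> dag s (Suc m) (Suc n) (add_right s m n f) = add_right s n m (dag s m n f)"
  unfolding add_right_def by (subst dag_val) (auto simp: adj_word_bend intro: wt_Suc wt_bend)

lemma ident_0_nonzero: "ident s 0 \<noteq> 0"
proof
  assume 0: "ident s 0 = 0"
  have "x = 0" if "x \<in> box_space A 0 s" for x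
  proof -
    have "x \<in> hom s 0 0"
      using that by (simp add: hom_square)
    then show ?thesis
      using cmp_ident(1)[of x s 0 0] 0 cmp_zero_right[of x s 0 0 0] by simp
  qed
  then have "vs.span (box_space A 0 s) = {0}"
    using vs.span_superset subspace[of 0 s] vs.span_eq_iff vs.subspace_0 by blast
  then have "vs.dim (box_space A 0 s) = 0"
    using vs.dim_eq_card[of "{}" "box_space A 0 s"] vs.independent_empty by simp
  then show False
    using dim_0 by simp
qed

end

section \<open>Dimensions of subspaces\<close>

context planar_algebra
begin

lemma dim_eq_1_iff:
  assumes "vs.subspace S"
  shows "vs.dim S = 1 \<longleftrightarrow> (\<exists>x\<in>S. x \<noteq> 0 \<and> (\<forall>y\<in>S. \<exists>c. y = scale A c x))"
proof
  assume "vs.dim S = 1"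
  obtain C where C: "C \<subseteq> S" "vs.independent C" "S \<subseteq> vs.span C" "card C = vs.dim S"
    using vs.basis_exists by blast
  then obtain x where x: "C = {x}"
    using \<open>vs.dim S = 1\<close> by (metis card_1_singletonE)
  have "x \<noteq> 0"
    using C(2) x vs.dependent_zero by blast
  moreover have "\<exists>c. y = scale A c x" if "y \<in> S" for y
    using C(3) that unfolding x vs.span_singleton by auto
  ultimately show "\<exists>x\<in>S. x \<noteq> 0 \<and> (\<forall>y\<in>S. \<exists>c. y = scale A c x)"
    using C(1) x by auto
next
  assume "\<exists>x\<in>S. x \<noteq> 0 \<and> (\<forall>y\<in>S. \<exists>c. y = scale A c x)"
  then obtain x where x: "x \<in> S" "x \<noteq> 0" "\<And>y. y \<in> S \<Longrightarrow> \<exists>c. y = scale A c x"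
    by blast
  show "vs.dim S = 1"
  proof (rule vs.dim_unique)
    show "{x} \<subseteq> S" "vs.independent {x}" "card {x} = 1"
      using x by simp_all
    show "S \<subseteq> vs.span {x}"
      using x(3) by (force simp: vs.span_singleton)
  qed
qed

lemma dim_zero: "vs.dim {0} = 0"
  using vs.dim_eq_card[of "{}" "{0}"] by (simp add: vs.independent_empty)

text \<open>
  The map is linear on a subspace only, and no finiteness is available, so a basis is transported by
  hand.
\<close>

lemma dim_bij:
  assumes S: "vs.subspace S"
    and \<phi>: "\<phi> ` S = S'" "inj_on \<phi> S"
    and add: "\<And>x y. x \<in> S \<Longrightarrow> y \<in> S \<Longrightarrow> \<phi> (x + y) = \<phi> x + \<phi> y"
    and scl: "\<And>x c. x \<in> S \<Longrightarrow> \<phi> (scale A c x) = scale A c (\<phi> x)"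
  shows "vs.dim S' = vs.dim S"
proof -
  have zero: "\<phi> 0 = 0"
    using scl[of 0 0] vs.subspace_0[OF S] by simp
  have sum: "sum f X \<in> S \<and> \<phi> (sum f X) = (\<Sum>x\<in>X. \<phi> (f x))"
    if "finite X" "\<And>x. x \<in> X \<Longrightarrow> f x \<in> S" for f :: "'a \<Rightarrow> 'a" and X
    using that by (induction X) (auto simp: zero add vs.subspace_0[OF S] vs.subspace_add[OF S])
  obtain C where C: "C \<subseteq> S" "vs.independent C" "S \<subseteq> vs.span C" "card C = vs.dim S"
    using vs.basis_exists by blast
  have span_C: "vs.span C = S"
    using C S vs.span_minimal by blast
  have inj: "inj_on \<phi> C"
    using \<phi>(2) C(1) inj_on_subset by blast
  have indep: "vs.independent (\<phi> ` C)"
    unfolding vs.dependent_explicit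
  proof clarify
    fix t u y
    assume t: "finite t" "t \<subseteq> \<phi> ` C" "(\<Sum>v\<in>t. scale A (u v) v) = 0" "y \<in> t" "u y \<noteq> 0"
    obtain X where X: "X \<subseteq> C" "t = \<phi> ` X"
      using t(2) by (auto simp: subset_image_iff)
    have fin: "finite X"
      using t(1) X inj finite_imageD inj_on_subset by blast
    let ?f = "\<lambda>x. scale A (u (\<phi> x)) x"
    have f: "?f x \<in> S" if "x \<in> X" for x
      using that X C(1) vs.subspace_scale[OF S] by blast
    have "\<phi> (sum ?f X) = (\<Sum>x\<in>X. scale A (u (\<phi> x)) (\<phi> x))"
      using sum[OF fin f] X C(1) scl by (auto intro!: sum.cong)
    also have "\<dots> = (\<Sum>v\<in>t. scale A (u v) v)"
      unfolding X(2) by (rule sum.reindex_cong[symmetric]) (use inj X(1) inj_on_subset in auto)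
    finally have "\<phi> (sum ?f X) = \<phi> 0"
      using t(3) zero by simp
    then have "sum ?f X = 0"
      by (rule inj_onD[OF \<phi>(2)]) (use sum[of X ?f] fin f vs.subspace_0[OF S] in auto)
    moreover obtain x where "x \<in> X" "y = \<phi> x"
      using t(4) X(2) by blast
    ultimately show False
      using vs.independentD[OF C(2) fin X(1), of "\<lambda>x. u (\<phi> x)" x] t(5) by auto
  qed
  have "vs.span (\<phi> ` C) = vs.span S'"
  proof
    show "vs.span (\<phi> ` C) \<subseteq> vs.span S'"
      using C(1) \<phi>(1) by (intro vs.span_mono) auto
    have "\<phi> x \<in> vs.span (\<phi> ` C)" if x: "x \<in> S" for x
    proof -
      obtain t r where t: "finite t" "t \<subseteq> C" "x = (\<Sum>v\<in>t. scale A (r v) v)"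
        using x unfolding span_C[symmetric] vs.span_explicit by blast
      have "\<phi> x = (\<Sum>v\<in>t. scale A (r v) (\<phi> v))"
        using sum[OF t(1), of "\<lambda>v. scale A (r v) v"] t C(1) scl vs.subspace_scale[OF S]
        by (auto intro!: sum.cong simp: subset_iff)
      moreover have "\<phi> v \<in> vs.span (\<phi> ` C)" if "v \<in> t" for v
        using that t(2) vs.span_base[of "\<phi> v" "\<phi> ` C"] by blast
      ultimately show ?thesis
        using vs.span_sum[of t "\<lambda>v. scale A (r v) (\<phi> v)" "\<phi> ` C"] vs.span_scale by simp
    qed
    then have "S' \<subseteq> vs.span (\<phi> ` C)"
      using \<phi>(1) by auto
    then show "vs.span S' \<subseteq> vs.span (\<phi> ` C)"
      by (simp add: vs.span_minimal)
  qed
  then have "vs.dim S' = card (\<phi> ` C)"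
    using vs.dim_eq_card[OF _ indep] by simp
  then show ?thesis
    using C(4) inj by (simp add: card_image)
qed

end

section \<open>Traces and positivity\<close>

lemma labels_ncups [simp]: "labels (ncups a k) = []"
proof -
  have "labels (map (\<lambda>b. (b, Cup)) bs) = []" for bs
    by (induction bs) auto
  then show ?thesis
    by (simp add: ncups_def)
qed

lemma labels_ncaps [simp]: "labels (ncaps a k) = []"
proof -
  have "labels (map (\<lambda>b. (b, Cap)) bs) = []" for bs
    by (induction bs) auto
  then show ?thesis
    by (simp add: ncaps_def)
qed

context planar_algebra
begin

lemma act_ev: "wt s k (fill f x) k \<Longrightarrow> distinct (labels x) \<Longrightarrow> act A k s x f = ev k s (fill f x)"
  by (rule ev_fillI[symmetric]) auto

lemma rotation_eq:
  assumes "a \<in> hom s 1 1"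
  shows "rotation A 1 s a = val (opposite s) 1 1 [(0, FCup), (1, FBox 1 a), (1, FCap)]"
  unfolding rotation_def val_square using assms
  by (subst act_ev) (auto simp: fcups_def fcaps_def hom_def shade_at_def)

lemma tensor_eq:
  assumes "f \<in> hom s k k" "g \<in> hom (shade_at s k) l l"
  shows "tensor A k l s f g = val s (k + l) (k + l) [(0, FBox k f), (k, FBox l g)]"
  unfolding tensor_def val_square using assms by (subst act_ev) (auto simp: hom_def)

lemma saddle_eq:
  assumes "a \<in> hom s 1 1"
  shows "saddle A s a = val s 2 2 [(0, FBox 1 a), (0, FCap), (0, FCup), (0, FBox 1 a)]"
  unfolding saddle_def val_square using assms by (subst act_ev) (auto simp: hom_def)

lemma stack_eq: "f \<in> hom s k k \<Longrightarrow> g \<in> hom s k k \<Longrightarrow> stack A k s f g = cmp s k k k g f"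
  unfolding stack_def cmp_def bend_square val_square by (subst act_ev) (auto simp: hom_square)

lemma X_strand_eq: "X_strand A = ident Unshaded 1"
  by (simp add: X_strand_def strands_eq)

text \<open>
  \<open>Y_strand\<close> is defined as a rotated strand, which is a zigzag.
\<close>

lemma Y_strand_eq: "Y_strand A = ident Shaded 1"
proof -
  have "ceq Shaded 1 1 ([(0, FCup)] @ [(1, FBox 1 (ident Unshaded 1))] @ [(1, FCap)])
      ([(0, FCup)] @ [] @ [(1, FCap)])"
    using ceq_shift[of Shaded 1 1 1 "[(0, FBox 1 (ident Unshaded 1))]" "[]" 1]
      ceq_bend_val[of Unshaded 1 "[]" 1] ceq_wt
    by (intro ceq_ctx[of _ 3 3])
      (auto simp: shade_at_def ident_def bend_square numeral_3_eq_3)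
  also have "ceq Shaded 1 1 ([(0, FCup)] @ [] @ [(1, FCap)]) []"
    using ceq_zigzag1[of 0 1 Shaded] by simp
  finally show ?thesis
    using val_cong rotation_eq[OF ident_in, of Unshaded]
    by (simp add: Y_strand_def X_strand_eq ident_def[of Shaded])
qed

lemma add_strand_eq:
  assumes "p \<in> hom s k k"
  shows "add_strand A s (k, p) = (Suc k, add_right s k k p)"
proof -
  let ?s = "shade_at s k"
  have *: "(if ?s = Unshaded then X_strand A else Y_strand A) = ident ?s 1"
    by (cases ?s) (auto simp: X_strand_eq Y_strand_eq)
  have "ceq s (k + 1) (k + 1) ([(0, FBox k p)] @ [(k, FBox 1 (ident ?s 1))]) ([(0, FBox k p)] @ [])"
    using ceq_shift[of s k 1 1 "[(0, FBox 1 (ident ?s 1))]" "[]" 0] assms ceq_bend_val[of ?s 1 "[]" 1]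
    by (intro ceq_append[of _ _ "k + 1"] ceq_refl) (auto simp: ident_def bend_square hom_def)
  then show ?thesis
    using assms unfolding add_strand.simps * by (simp add: tensor_eq val_cong add_right_def bend_square)
qed

end

context subfactor_planar_algebra
begin

definition tr :: "shading \<Rightarrow> nat \<Rightarrow> 'a \<Rightarrow> complex" where
  "tr s k f = scalar A s (val s 0 0 (fcups 0 k @ [(0, FBox k f)] @ fcaps 0 k))"

lemma scale_empty_inj: "scale A c (ident s 0) = scale A d (ident s 0) \<Longrightarrow> c = d"
  using ident_0_nonzero[of s] vs.scale_right_imp_eq by blast

lemma scalar_scale: "scalar A s (scale A c (ident s 0)) = c"
  unfolding scalar_def empty_diagram_eq
  by (rule the_equality) (blast dest: scale_empty_inj)+

lemma scale_scalar:
  assumes "x \<in> box_space A 0 s"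
  shows "x = scale A (scalar A s x) (ident s 0)"
proof -
  obtain y where y: "y \<in> box_space A 0 s" "y \<noteq> 0" "\<And>x. x \<in> box_space A 0 s \<Longrightarrow> \<exists>c. x = scale A c y"
    using dim_0[of s] dim_eq_1_iff[OF subspace] by blast
  obtain c d where c: "x = scale A c y" and d: "ident s 0 = scale A d y"
    using y(3) assms ident_in[of s 0] unfolding hom_square by meson
  have "d \<noteq> 0"
    using d ident_0_nonzero[of s] by auto
  then have "x = scale A (c / d) (ident s 0)"
    using c d by simp
  then show ?thesis
    using scalar_scale by metis
qed

lemma wt_closure: "f \<in> hom s k k \<Longrightarrow> wt s 0 (fcups 0 k @ [(0, FBox k f)] @ fcaps 0 k) 0"
  by (auto simp: hom_def intro!: wt_appendI)

lemma scalar_add: "x \<in> box_space A 0 s \<Longrightarrow> y \<in> box_space A 0 s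
    \<Longrightarrow> scalar A s (x + y) = scalar A s x + scalar A s y"
  using scale_scalar scalar_scale by (metis vs.scale_left_distrib)

lemma scalar_mult: "x \<in> box_space A 0 s \<Longrightarrow> scalar A s (scale A c x) = c * scalar A s x"
  using scale_scalar scalar_scale by (metis vs.scale_scale)

lemma tr_add: "f \<in> hom s k k \<Longrightarrow> g \<in> hom s k k \<Longrightarrow> tr s k (f + g) = tr s k f + tr s k g"
  unfolding tr_def
  using val_add[of s 0 "fcups 0 k" 0 k f "fcaps 0 k" 0 g] wt_closure[of f s k] wt_closure[of g s k]
  by (simp add: scalar_add val_in_hom flip: hom_square)

lemma tr_scale: "f \<in> hom s k k \<Longrightarrow> tr s k (scale A c f) = c * tr s k f"
  unfolding tr_def
  using val_scale[of s 0 "fcups 0 k" 0 k f "fcaps 0 k" 0 c] wt_closure[of f s k]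
  by (simp add: scalar_mult val_in_hom flip: hom_square)

lemma tr_zero: "tr s k 0 = 0"
  using tr_scale[of 0 s k 0] by (simp add: hom_zero)

lemma tr_diff: "f \<in> hom s k k \<Longrightarrow> g \<in> hom s k k \<Longrightarrow> tr s k (f - g) = tr s k f - tr s k g"
  using tr_add[of "f - g" s k g] by simp

lemma tr_val:
  assumes "wt s k w k"
  shows "tr s k (val s k k w) = scalar A s (val s 0 0 (fcups 0 k @ w @ fcaps 0 k))"
proof -
  have "ceq s 0 0 (fcups 0 k @ [(0, FBox k (val s k k w))] @ fcaps 0 k) (fcups 0 k @ w @ fcaps 0 k)"
    by (rule ceq_ctx[OF ceq_widen[OF ceq_bend_val[OF assms, unfolded bend_square], of k]]) auto
  then show ?thesis
    by (simp add: tr_def val_cong)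
qed

lemma trace_right_eq:
  assumes "f \<in> hom s k k"
  shows "close_right A k s f = val s 0 0 (fcups 0 k @ [(0, FBox k f)] @ fcaps 0 k)"
    "trace_right A k s f = tr s k f"
proof -
  show "close_right A k s f = val s 0 0 (fcups 0 k @ [(0, FBox k f)] @ fcaps 0 k)"
    unfolding close_right_def val_square using wt_closure[OF assms] by (subst act_ev) auto
  then show "trace_right A k s f = tr s k f"
    by (simp add: trace_right_def tr_def)
qed

text \<open>
  If \<open>m \<le> n\<close>, closing \<open>f\<close> followed by its adjoint on \<open>m\<close> strands gives literally the word that defines the
  inner product of \<open>f\<close> with itself as an element: the cups in \<open>bend m n\<close> continue those of the closure.
\<close>

lemma tr_positive:
  assumes f: "f \<in> hom s m n" "f \<noteq> 0" and "m \<le> n"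
  shows "tr s m (cmp s m n m f (dag s m n f)) \<in> \<real>"
    "Re (tr s m (cmp s m n m f (dag s m n f))) > 0"
proof -
  obtain j where n: "n = m + 2 * j"
    using hom_even[OF f(1)]
  proof (cases rule: even_cases)
    case (2 j)
    then show ?thesis
      using \<open>m \<le> n\<close> that[of 0] by simp
  qed (rule that)
  let ?k = "m + j"
  let ?g = "adj A ?k s f"
  have k: "f \<in> hom s ?k ?k" "?g \<in> hom s ?k ?k"
    using f(1) n by (auto simp: hom_def intro: adj_closed)
  have "inner_prod A ?k s f f = tr s ?k (cmp s ?k ?k ?k f ?g)"
    using k by (simp add: inner_prod_def stack_eq trace_right_eq)
  also have "\<dots> = scalar A s (val s 0 0 (fcups 0 ?k @ ([(0, FBox ?k f)] @ [(0, FBox ?k ?g)]) @ fcaps 0 ?k))"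
    unfolding cmp_def bend_square by (rule tr_val) (use k in \<open>simp add: hom_def\<close>)
  also have "\<dots> = scalar A s (val s 0 0 (fcups 0 m @ (bend m n f @ bend n m ?g) @ fcaps 0 m))"
    by (simp add: n bend_def fcups_add fcaps_add)
  also have "\<dots> = tr s m (cmp s m n m f ?g)"
    unfolding cmp_def by (rule tr_val[symmetric]) (use f k n in \<open>auto simp: hom_def intro!: wt_bend_bend\<close>)
  also have "?g = dag s m n f"
    by (simp add: dag_def n)
  finally show "tr s m (cmp s m n m f (dag s m n f)) \<in> \<real>"
    "Re (tr s m (cmp s m n m f (dag s m n f))) > 0"
    using positive_definite[of f ?k s] k(1) f(2) by (simp_all add: hom_square)
qed

lemma dag_eq_0: "f \<in> hom s m n \<Longrightarrow> dag s m n f = 0 \<Longrightarrow> f = 0"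
  using dag_dag[of f s m n] dag_zero[of n m s] hom_even[of f s m n] by (simp add: add.commute)

text \<open>
  For \<open>m > n\<close>, the product of \<open>f\<close> and its adjoint in the other order lives on \<open>n\<close> strands and is
  selfadjoint with square zero, hence zero by the case of equal numbers of strands; then positivity
  applies to the adjoint of \<open>f\<close>. This avoids cyclicity of the trace.
\<close>

lemma cmp_dag_eq_0:
  assumes f: "f \<in> hom s m n" and 0: "cmp s m n m f (dag s m n f) = 0"
  shows "f = 0"
proof (cases "m \<le> n")
  case True
  then show ?thesis
    using tr_positive[OF f] 0 by (auto simp: tr_zero)
next
  case False
  let ?h = "cmp s n m n (dag s m n f) f"
  have h: "?h \<in> hom s n n" "dag s n n ?h = ?h"
    using f by (auto simp: dag_cmp)
  have "cmp s n n n ?h ?h = cmp s n m n (dag s m n f) (cmp s m m n (cmp s m n m f (dag s m n f)) f)"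
    using f by (simp add: cmp_assoc)
  also have "\<dots> = 0"
    using f cmp_zero_right[OF dag_in[OF f], of n] hom_even[OF f] by (simp add: 0 cmp_zero_left)
  finally have "cmp s n n n ?h (dag s n n ?h) = 0"
    by (simp add: h)
  then have "?h = 0"
    using tr_positive[OF h(1)] by (auto simp: tr_zero)
  then have "dag s m n f = 0"
    using tr_positive[of "dag s m n f" s n m] f False by (auto simp: tr_zero)
  then show ?thesis
    using dag_eq_0 f by blast
qed

section \<open>Minimal projections\<close>

definition proj :: "shading \<Rightarrow> nat \<Rightarrow> 'a \<Rightarrow> bool" where
  "proj s m p \<longleftrightarrow> p \<in> hom s m m \<and> cmp s m m m p p = p \<and> dag s m m p = p"

text \<open>
  \<open>phom s m p n q\<close> is the space \<open>Hom\<close> between the projections \<open>p\<close> and \<open>q\<close>, expressed by composition; for odd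
  \<open>m + n\<close> it is empty whereas \<open>Hom\<close> is \<open>{0}\<close>.
\<close>

definition phom :: "shading \<Rightarrow> nat \<Rightarrow> 'a \<Rightarrow> nat \<Rightarrow> 'a \<Rightarrow> 'a set" where
  "phom s m p n q = {f \<in> hom s m n. cmp s m m n p f = f \<and> cmp s m n n f q = f}"

definition minimal :: "shading \<Rightarrow> nat \<Rightarrow> 'a \<Rightarrow> bool" where
  "minimal s m p \<longleftrightarrow> proj s m p \<and> p \<noteq> 0 \<and> (\<forall>f \<in> phom s m p m p. \<exists>c. f = scale A c p)"

definition iso :: "shading \<Rightarrow> nat \<Rightarrow> 'a \<Rightarrow> nat \<Rightarrow> 'a \<Rightarrow> bool" where
  "iso s m p n q \<longleftrightarrow> (\<exists>f \<in> phom s m p n q.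
     cmp s m n m f (dag s m n f) = p \<and> cmp s n m n (dag s m n f) f = q)"

lemma projD: "proj s m p \<Longrightarrow> p \<in> hom s m m" "proj s m p \<Longrightarrow> cmp s m m m p p = p"
    "proj s m p \<Longrightarrow> dag s m m p = p"
  by (auto simp: proj_def)

lemma projection_iff: "projection A m s p \<longleftrightarrow> proj s m p"
  by (auto simp: projection_def proj_def stack_eq hom_square dag_def)

lemma phomD: "f \<in> phom s m p n q \<Longrightarrow> f \<in> hom s m n" "f \<in> phom s m p n q \<Longrightarrow> cmp s m m n p f = f"
    "f \<in> phom s m p n q \<Longrightarrow> cmp s m n n f q = f"
  by (auto simp: phom_def)

lemma Hom_eq:
  assumes p: "proj s m p" and q: "proj s n q" and even: "even (m + n)"
  shows "Hom A s (m, p) (n, q) = phom s m p n q"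
proof -
  have "act A ((m + n) div 2) s
        (straighten m n ([(0, Box m 0)] @ bent_box m n 1 @ [(0, Box n 2)])) ((!) [p, f, q])
      = cmp s m m n p (cmp s m n n f q)" if f: "f \<in> hom s m n" for f
  proof -
    have wt: "wt s m (bend m m p @ (bend m n f @ bend n n q)) n"
      using f projD[OF p] projD[OF q] by (auto intro!: wt_appendI wt_bend)
    have "act A ((m + n) div 2) s
          (straighten m n ([(0, Box m 0)] @ bent_box m n 1 @ [(0, Box n 2)])) ((!) [p, f, q])
        = val s m n (bend m m p @ (bend m n f @ bend n n q))"
      unfolding val_def using wt_straighten[OF wt]
      by (subst act_ev) (auto simp: straighten_def bent_box_def bend_def)
    also have "\<dots> = cmp s m m n p (cmp s m n n f q)"
      using f projD[OF p] projD[OF q]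
      by (subst val_append[of _ _ _ m]) (auto simp: val_bend wt_bend wt_bend_bend cmp_def)
    finally show ?thesis .
  qed
  then have "Hom A s (m, p) (n, q) = {f \<in> hom s m n. cmp s m m n p (cmp s m n n f q) = f}"
    using even by (auto simp: hom_def)
  also have "\<dots> = phom s m p n q"
  proof (intro set_eqI iffI)
    fix f
    assume "f \<in> {f \<in> hom s m n. cmp s m m n p (cmp s m n n f q) = f}"
    then have f: "f \<in> hom s m n" "cmp s m m n p (cmp s m n n f q) = f"
      by auto
    have "cmp s m m n p (cmp s m m n p (cmp s m n n f q)) = cmp s m m n p (cmp s m n n f q)"
      using f(1) projD[OF p] projD[OF q] by (simp flip: cmp_assoc)
    moreover have "cmp s m n n (cmp s m m n p (cmp s m n n f q)) q = cmp s m m n p (cmp s m n n f q)"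
      using f(1) projD[OF p] projD[OF q] by (simp add: cmp_assoc)
    ultimately show "f \<in> phom s m p n q"
      using f by (simp add: phom_def)
  qed (auto simp: phom_def)
  finally show ?thesis .
qed

lemma phom_subspace:
  assumes "proj s m p" "proj s n q" "even (m + n)"
  shows "vs.subspace (phom s m p n q)"
  using assms hom_zero[OF assms(3), of s] projD[OF assms(1)] projD[OF assms(2)]
  by (auto simp: vs.subspace_def phom_def cmp_add_left cmp_add_right cmp_scale_left cmp_scale_right
      cmp_zero_left cmp_zero_right)

lemma proj_in_phom: "proj s m p \<Longrightarrow> p \<in> phom s m p m p"
  by (auto simp: phom_def proj_def)

lemma minimal_iff: "(m, p) \<in> minimal_projections A s \<longleftrightarrow> minimal s m p"
proof (cases "proj s m p")
  case True
  have "vs.dim (phom s m p m p) = 1 \<longleftrightarrow> p \<noteq> 0 \<and> (\<forall>f \<in> phom s m p m p. \<exists>c. f = scale A c p)"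
    (is "_ \<longleftrightarrow> ?R")
  proof
    assume "vs.dim (phom s m p m p) = 1"
    then obtain x where x: "x \<in> phom s m p m p" "x \<noteq> 0"
        and xs: "\<And>y. y \<in> phom s m p m p \<Longrightarrow> \<exists>c. y = scale A c x"
      using dim_eq_1_iff[OF phom_subspace[OF True True]] by auto
    have "p \<noteq> 0"
      using x cmp_zero_left[of x s m m m] phomD[OF x(1)] by auto
    obtain c where c: "p = scale A c x"
      using xs proj_in_phom[OF True] by blast
    then have "c \<noteq> 0"
      using \<open>p \<noteq> 0\<close> by auto
    then have "x = scale A (1 / c) p"
      using c by simp
    then show ?R
      using xs \<open>p \<noteq> 0\<close> by (metis vs.scale_scale)
  next
    assume ?R
    then show "vs.dim (phom s m p m p) = 1"
      using dim_eq_1_iff[OF phom_subspace[OF True True]] proj_in_phom[OF True] by auto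
  qed
  then show ?thesis
    using True by (simp add: minimal_projections_def projection_iff hom_dim_def Hom_eq minimal_def
        del: Hom.simps)
next
  case False
  then show ?thesis
    by (simp add: minimal_projections_def projection_iff minimal_def)
qed

lemma isomorphic_iff:
  assumes p: "proj s m p" and q: "proj s n q"
  shows "isomorphic A s (m, p) (n, q) \<longleftrightarrow> iso s m p n q"
proof (cases "even (m + n)")
  case True
  have "act A m s (bent_box m n 0 @ bent_box n m 1) ((!) [f, adj A ((m + n) div 2) s f])
      = cmp s m n m f (dag s m n f)"
    and "act A n s (bent_box n m 0 @ bent_box m n 1) ((!) [adj A ((m + n) div 2) s f, f])
      = cmp s n m n (dag s m n f) f" if f: "f \<in> hom s m n" for f
    unfolding cmp_def val_square using wt_bend_bend[OF f dag_in[OF f]] wt_bend_bend[OF dag_in[OF f] f]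
    by (subst act_ev; auto simp: bent_box_def bend_def dag_def add.commute)+
  then show ?thesis
    using True phomD(1) Hom_eq[OF p q True] by (auto simp: iso_def simp del: Hom.simps)
next
  case False
  then show ?thesis
    by (auto simp: iso_def phom_def hom_def)
qed

lemma dag_phom:
  assumes "f \<in> phom s m p n q" "proj s m p" "proj s n q"
  shows "dag s m n f \<in> phom s n q m p"
proof -
  have f: "f \<in> hom s m n" "cmp s m m n p f = f" "cmp s m n n f q = f"
    using phomD[OF assms(1)] by simp_all
  have "cmp s n m m (dag s m n f) (dag s m m p) = dag s m n f"
    "cmp s n n m (dag s n n q) (dag s m n f) = dag s m n f"
    using dag_cmp[OF _ f(1), of p m] dag_cmp[OF f(1), of q n] f projD(1)[OF assms(2)]
      projD(1)[OF assms(3)] by simp_all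
  then show ?thesis
    using f(1) assms by (simp add: phom_def projD)
qed

lemma cmp_phom:
  assumes "f \<in> phom s m p n q" "g \<in> phom s n q l r" "proj s m p" "proj s l r"
  shows "cmp s m n l f g \<in> phom s m p l r"
  using phomD[OF assms(1)] phomD[OF assms(2)] projD(1)[OF assms(3)] projD(1)[OF assms(4)]
  by (simp add: phom_def cmp_assoc) (simp flip: cmp_assoc)

lemma iso_refl: "proj s m p \<Longrightarrow> iso s m p m p"
  unfolding iso_def by (rule bexI[OF _ proj_in_phom]) (auto simp: proj_def)

lemma iso_sym:
  assumes "proj s m p" "proj s n q" "iso s m p n q"
  shows "iso s n q m p"
proof -
  obtain f where f: "f \<in> phom s m p n q" "cmp s m n m f (dag s m n f) = p"
      "cmp s n m n (dag s m n f) f = q"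
    using assms(3) by (auto simp: iso_def)
  then show ?thesis
    unfolding iso_def using dag_phom[OF f(1) assms(1,2)] phomD(1)[OF f(1)]
    by (intro bexI[of _ "dag s m n f"]) auto
qed

lemma iso_trans:
  assumes "proj s m p" "proj s n q" "proj s l r" "iso s m p n q" "iso s n q l r"
  shows "iso s m p l r"
proof -
  obtain f where f: "f \<in> phom s m p n q" "cmp s m n m f (dag s m n f) = p"
      "cmp s n m n (dag s m n f) f = q"
    using assms(4) by (auto simp: iso_def)
  obtain g where g: "g \<in> phom s n q l r" "cmp s n l n g (dag s n l g) = q"
      "cmp s l n l (dag s n l g) g = r"
    using assms(5) by (auto simp: iso_def)
  note hom = phomD[OF f(1)] phomD[OF g(1)] dag_in[OF phomD(1)[OF f(1)]] dag_in[OF phomD(1)[OF g(1)]]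
  have q: "cmp s n n m q (dag s m n f) = dag s m n f"
    by (rule phomD(2)[OF dag_phom[OF f(1) assms(1,2)]])
  have "cmp s m l m (cmp s m n l f g) (dag s m l (cmp s m n l f g)) =
      cmp s m n m f (cmp s n n m (cmp s n l n g (dag s n l g)) (dag s m n f))"
    using hom by (simp add: dag_cmp cmp_assoc)
  then have 1: "cmp s m l m (cmp s m n l f g) (dag s m l (cmp s m n l f g)) = p"
    by (simp add: f g q)
  have "cmp s l m l (dag s m l (cmp s m n l f g)) (cmp s m n l f g) =
      cmp s l n l (dag s n l g) (cmp s n n l (cmp s n m n (dag s m n f) f) g)"
    using hom by (simp add: dag_cmp cmp_assoc)
  then have 2: "cmp s l m l (dag s m l (cmp s m n l f g)) (cmp s m n l f g) = r"
    by (simp add: f g phomD(2)[OF g(1)])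
  show ?thesis
    unfolding iso_def using 1 2 cmp_phom[OF f(1) g(1) assms(1,3)] by blast
qed

text \<open>
  Both \<open>f f\<^sup>*\<close> and \<open>f\<^sup>* f\<close> are scalars by minimality, and the two scalars agree as both act on \<open>f\<close>. Positivity
  of the trace, on the side with fewer strands, makes the scalar positive, so \<open>f\<close> can be normalised to an
  isomorphism.
\<close>

lemma schur:
  assumes p: "minimal s m p" and q: "minimal s n q" and f: "f \<in> phom s m p n q" "f \<noteq> 0"
  shows "iso s m p n q" "g \<in> phom s m p n q \<Longrightarrow> \<exists>c. g = scale A c f"
proof -
  let ?f = "dag s m n f"
  have pq: "proj s m p" "proj s n q" "p \<noteq> 0" "q \<noteq> 0"
    using p q by (auto simp: minimal_def)
  note hom = phomD[OF f(1)] dag_in[OF phomD(1)[OF f(1)]] projD(1)[OF pq(1)] projD(1)[OF pq(2)]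
  have f': "?f \<in> phom s n q m p"
    by (rule dag_phom[OF f(1) pq(1,2)])
  obtain c where c: "cmp s m n m f ?f = scale A c p"
    using p cmp_phom[OF f(1) f' pq(1,1)] by (auto simp: minimal_def)
  obtain d where d: "cmp s n m n ?f f = scale A d q"
    using q cmp_phom[OF f' f(1) pq(2,2)] by (auto simp: minimal_def)
  have "cmp s m m n (cmp s m n m f ?f) f = cmp s m n n f (cmp s n m n ?f f)"
    using hom by (simp add: cmp_assoc)
  then have "scale A c f = scale A d f"
    using hom by (simp add: c d cmp_scale_left cmp_scale_right)
  then have cd: "c = d"
    using f(2) vs.scale_right_imp_eq by blast
  have pos: "c \<in> \<real> \<and> Re c > 0"
  proof -
    have quotient: "x \<in> \<real> \<and> Re x > 0"
      if "x * y \<in> \<real>" "Re (x * y) > 0" "y \<in> \<real>" "Re y > 0" for x y :: complex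
    proof -
      have "y \<noteq> 0"
        using that by auto
      then have "x = (x * y) / y"
        by simp
      then have "x \<in> \<real>"
        using that Reals_divide by metis
      then show ?thesis
        using that by (auto elim!: Reals_cases simp: zero_less_mult_iff)
    qed
    show ?thesis
    proof (cases "m \<le> n")
      case True
      then show ?thesis
        using tr_positive[OF hom(1) f(2)] tr_positive[of p s m m] pq hom
        by (intro quotient[of c "tr s m p"]) (simp_all add: c tr_scale projD)
    next
      case False
      have "?f \<noteq> 0"
        using f(2) hom dag_eq_0 by blast
      then show ?thesis
        using tr_positive[of ?f s n m] tr_positive[of q s n n] pq hom False
        by (intro quotient[of c "tr s n q"]) (simp_all add: d tr_scale projD cd)
    qed
  qed
  obtain r where r: "c = of_real (r\<^sup>2)" "r > 0"
  proof
    show "c = of_real ((sqrt (Re c))\<^sup>2)" "sqrt (Re c) > 0"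
      using pos by (auto elim!: Reals_cases)
  qed
  show "iso s m p n q"
    unfolding iso_def
  proof (intro bexI[of _ "scale A (of_real (1 / r)) f"] conjI)
    have "of_real (1 / r) * (of_real (1 / r) * c) = (1 :: complex)"
      using r by (simp add: power2_eq_square)
    then show "cmp s m n m (scale A (of_real (1 / r)) f) (dag s m n (scale A (of_real (1 / r)) f)) = p"
      "cmp s n m n (dag s m n (scale A (of_real (1 / r)) f)) (scale A (of_real (1 / r)) f) = q"
      using hom by (simp_all add: dag_scale cmp_scale_left cmp_scale_right c d flip: cd)
    show "scale A (of_real (1 / r)) f \<in> phom s m p n q"
      using f(1) phom_subspace[OF pq(1,2)] hom_even[OF hom(1)] by (auto intro: vs.subspace_scale)
  qed
  show "\<exists>c. g = scale A c f" if g: "g \<in> phom s m p n q"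
  proof -
    obtain e where e: "cmp s m n m g ?f = scale A e p"
      using p cmp_phom[OF g f' pq(1,1)] by (auto simp: minimal_def)
    have "cmp s m m n (cmp s m n m g ?f) f = cmp s m n n g (cmp s n m n ?f f)"
      using hom phomD[OF g] by (simp add: cmp_assoc)
    then have "scale A e f = scale A c g"
      using hom phomD[OF g] by (simp add: e d cd cmp_scale_left cmp_scale_right)
    then have "g = scale A (e / c) f"
      using pos by (metis divide_inverse_commute less_irrefl vs.scale_left_imp_eq
          vs.scale_one vs.scale_scale left_inverse zero_complex.sel(1))
    then show ?thesis ..
  qed
qed

end

section \<open>Projections of trace one on a single strand\<close>

context planar_algebra
begin

lemma ceq_sub:
  assumes "ceq s l l' x y" "W = u @ x @ v" "W' = u @ y @ v" "wt s m u l" "wt s l' v n"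
  shows "ceq s m n W W'"
  unfolding assms(2,3) by (rule ceq_ctx[OF assms(1,4,5)])

text \<open>
  Local rewriting in concrete words: the part of the word that changes is described up to its
  horizontal position \<open>c\<close>, with \<open>b\<close> strands passing at its right.
\<close>

lemma ceq_sub_at:
  assumes "ceq t i j x y" "shade_at s c = t" "W = u @ fshift c x @ v" "W' = u @ fshift c y @ v"
    "wt s m u (c + i + b)" "wt s (c + j + b) v n"
  shows "ceq s m n W W'"
  using ceq_ctx[OF ceq_shift[of s c i j x y b] assms(5,6)] assms(1-4) by simp

lemma ceq_exch:
  assumes "wt s m [(b', e'), (a, e)] n" "a + fins e \<le> b'" "b = b' - fins e + fouts e"
  shows "ceq s m n [(b', e'), (a, e)] [(a, e), (b, e')]"
  using ceq_exchange[of s m a e "b' - (a + fins e)" e' n] assms by (simp add: add.commute)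

definition rot :: "shading \<Rightarrow> 'a \<Rightarrow> 'a" where
  "rot s a = val (opposite s) 1 1 [(0, FCup), (1, FBox 1 a), (1, FCap)]"

lemma shade_at_1 [simp]: "shade_at s 1 = opposite s" "shade_at s (Suc 0) = opposite s"
  "shade_at s 2 = s" "shade_at s (Suc (Suc n)) = shade_at s n" "shade_at (opposite s) n = opposite (shade_at s n)"
  by (auto simp: shade_at_def)

lemma hom_1: "hom s 1 1 = box_space A 1 s" "hom s (Suc 0) (Suc 0) = box_space A (Suc 0) s"
  by (simp_all add: hom_def)

lemma wt_rot:
  assumes "a \<in> box_space A 1 s"
  shows "wt (opposite s) 1 [(0, FCup), (1, FBox 1 a), (1, FCap)] 1"
    "wt (opposite s) 1 [(1, FCup), (1, FBox 1 a), (0, FCap)] 1"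
  using assms by auto

lemma rot_in: "a \<in> box_space A 1 s \<Longrightarrow> rot s a \<in> box_space A 1 (opposite s)"
  using val_in_hom[OF wt_rot(1)] unfolding rot_def hom_1 .

lemma ceq_rot1:
  assumes "a \<in> box_space A 1 s"
  shows "ceq (opposite s) 1 1 [(0, FBox 1 (rot s a))] [(0, FCup), (1, FBox 1 a), (1, FCap)]"
  using ceq_bend_val[OF wt_rot(1)[OF assms]] by (simp add: bend_square rot_def)

text \<open>
  By the full turn, bending the strand around a box to either side gives the same rotation.
\<close>

lemma ceq_rot2:
  assumes "a \<in> box_space A 1 s"
  shows "ceq (opposite s) 1 1 [(0, FBox 1 (rot s a))] [(1, FCup), (1, FBox 1 a), (0, FCap)]"
proof -
  have "ceq (opposite s) 1 1 [(0, FCup), (1, FBox 1 a), (1, FCap)] [(1, FCup), (1, FBox 1 a), (0, FCap)]"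
    using ceq_move[OF move.full_turn[of 0 1 0], of "opposite s" 1 "\<lambda>_. a" 1] wt_rot[OF assms]
    by (simp add: fcups_def fcaps_def)
  then show ?thesis
    using ceq_rot1[OF assms] ceq_trans by blast
qed

text \<open>
  The left form of the rotation is the one in which sliding the box along the cup involves no net
  turning, so that exchanges and one zigzag suffice.
\<close>

lemma ceq_slide_cup:
  assumes a: "a \<in> box_space A 1 s"
  shows "ceq s 0 2 [(0, FCup), (1, FBox 1 (rot s a))] [(0, FCup), (0, FBox 1 a)]"
proof -
  have "ceq s 0 2 [(0, FCup), (1, FBox 1 (rot s a))] [(0, FCup), (2, FCup), (2, FBox 1 a), (1, FCap)]"
    by (rule ceq_sub_at[OF ceq_rot2[OF a], where c = 1 and b = 0 and u = "[(0, FCup)]" and v = "[]"])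
      auto
  also have "ceq s 0 2 \<dots> [(0, FCup), (0, FCup), (2, FBox 1 a), (1, FCap)]"
    by (rule ceq_sub[OF ceq_sym[OF ceq_exch], where l = 0 and l' = 4 and u = "[]"
          and v = "[(2, FBox 1 a), (1, FCap)]"]) (use a in auto)
  also have "ceq s 0 2 \<dots> [(0, FCup), (0, FBox 1 a), (0, FCup), (1, FCap)]"
    by (rule ceq_sub[OF ceq_sym[OF ceq_exch], where l = 2 and l' = 4 and u = "[(0, FCup)]"
          and v = "[(1, FCap)]"]) (use a in auto)
  also have "ceq s 0 2 \<dots> [(0, FCup), (0, FBox 1 a)]"
    by (rule ceq_sub[OF ceq_zigzag1[of 0 2], where u = "[(0, FCup), (0, FBox 1 a)]" and v = "[]"])
      (use a in auto)
  finally show ?thesis .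
qed

lemma rot_rot:
  assumes a: "a \<in> box_space A 1 s"
  shows "rot (opposite s) (rot s a) = a"
proof -
  have "ceq s 1 1 [(0, FCup), (1, FBox 1 (rot s a)), (1, FCap)] [(0, FCup), (0, FBox 1 a), (1, FCap)]"
    by (rule ceq_sub_at[OF ceq_slide_cup[OF a], where c = 0 and b = 1 and u = "[]"
          and v = "[(1, FCap)]"]) auto
  also have "ceq s 1 1 \<dots> [(0, FCup), (1, FCap), (0, FBox 1 a)]"
    by (rule ceq_sub[OF ceq_sym[OF ceq_exch], where l = 3 and l' = 1 and u = "[(0, FCup)]"
          and v = "[]"]) (use a in auto)
  also have "ceq s 1 1 \<dots> [(0, FBox 1 a)]"
    by (rule ceq_sub[OF ceq_zigzag1[of 0 1], where u = "[]" and v = "[(0, FBox 1 a)]"])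
      (use a in auto)
  finally show ?thesis
    using val_cong val_bend[of a s 1 1] a by (simp add: rot_def bend_square hom_square)
qed

lemma ceq_slide_cup':
  assumes a: "a \<in> box_space A 1 s"
  shows "ceq (opposite s) 0 2 [(0, FCup), (0, FBox 1 (rot s a))] [(0, FCup), (1, FBox 1 a)]"
  using ceq_sym[OF ceq_slide_cup[OF rot_in[OF a]]] by (simp add: rot_rot[OF a])

lemma cmp_1: "cmp s 1 1 1 a b = val s 1 1 [(0, FBox 1 a), (0, FBox 1 b)]"
  by (simp add: cmp_def bend_square)

lemma ceq_cmp:
  assumes "a \<in> hom s k k" "b \<in> hom s k k"
  shows "ceq s k k [(0, FBox k a), (0, FBox k b)] [(0, FBox k (cmp s k k k a b))]"
  using ceq_bend_val[of s k "[(0, FBox k a), (0, FBox k b)]" k] assms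
  by (auto simp: cmp_def bend_square hom_square intro: ceq_sym)

lemma rot_cmp:
  assumes a: "a \<in> box_space A 1 s" and b: "b \<in> box_space A 1 s"
  shows "cmp (opposite s) 1 1 1 (rot s a) (rot s b) = rot s (cmp s 1 1 1 b a)"
proof -
  let ?a = "rot s a" and ?b = "rot s b" and ?t = "opposite s"
  note in_box = a b rot_in[OF a] rot_in[OF b]
  have "ceq ?t 1 1 [(0, FBox 1 ?a), (0, FBox 1 ?b)] [(0, FCup), (1, FBox 1 a), (1, FCap), (0, FBox 1 ?b)]"
    by (rule ceq_sub[OF ceq_rot1[OF a], where u = "[]" and v = "[(0, FBox 1 ?b)]"])
      (use in_box in auto)
  also have "ceq ?t 1 1 \<dots> [(0, FCup), (1, FBox 1 a), (0, FBox 1 ?b), (1, FCap)]"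
    by (rule ceq_sub[OF ceq_exch, where l = 3 and l' = 1 and u = "[(0, FCup), (1, FBox 1 a)]"
          and v = "[]"]) (use in_box in auto)
  also have "ceq ?t 1 1 \<dots> [(0, FCup), (0, FBox 1 ?b), (1, FBox 1 a), (1, FCap)]"
    by (rule ceq_sub[OF ceq_exch, where l = 3 and l' = 3 and u = "[(0, FCup)]"
          and v = "[(1, FCap)]"]) (use in_box in auto)
  also have "ceq ?t 1 1 \<dots> [(0, FCup), (1, FBox 1 b), (1, FBox 1 a), (1, FCap)]"
    by (rule ceq_sub_at[OF ceq_slide_cup'[OF b], where c = 0 and b = 1 and u = "[]"
          and v = "[(1, FBox 1 a), (1, FCap)]"]) (use in_box in auto)
  also have "ceq ?t 1 1 \<dots> [(0, FCup), (1, FBox 1 (cmp s 1 1 1 b a)), (1, FCap)]"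
    by (rule ceq_sub_at[OF ceq_cmp[of b s 1 a], where c = 1 and b = 1 and u = "[(0, FCup)]"
          and v = "[(1, FCap)]"]) (use in_box in \<open>auto simp: hom_1\<close>)
  finally show ?thesis
    unfolding cmp_1[of "opposite s"] rot_def[of s "cmp s 1 1 1 b a"] by (rule val_cong)
qed

end

context subfactor_planar_algebra
begin

lemma ceq_adj:
  assumes "ceq s m n w w'"
  shows "ceq s n m (adj_word A s w) (adj_word A s w')"
proof -
  have wt: "wt s n (adj_word A s w) m" if "wt s m w n" for w
    using that
  proof (induction s m w n rule: wt.induct)
    case (2 s m a k x w n)
    then show ?case
      by (auto intro!: wt_appendI adj_closed simp: shade_at_wt)
  qed (auto intro!: wt_appendI)
  show ?thesis
    using dag_val[OF ceq_wt(1)[OF assms]] dag_val[OF ceq_wt(2)[OF assms]] val_cong[OF assms]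
      wt[OF ceq_wt(1)[OF assms]] wt[OF ceq_wt(2)[OF assms]]
    by (simp add: ceq_iff_val)
qed

lemma rot_adj:
  assumes "a \<in> box_space A 1 s"
  shows "adj A 1 (opposite s) (rot s a) = rot s (adj A 1 s a)"
  using dag_val[OF wt_rot(1)[OF assms]] val_cong[OF ceq_rot2[OF adj_closed[OF assms]]]
    val_cong[OF ceq_rot1[OF adj_closed[OF assms]]]
  by (simp add: rot_def dag_def)

text \<open>
  Sliding the box around the closed loop turns the right closure of the rotation into the left closure
  of the element; sphericality compares the two.
\<close>

lemma tr_rot:
  assumes a: "a \<in> box_space A 1 s"
  shows "tr (opposite s) 1 (rot s a) = tr s 1 a"
proof -
  have "tr (opposite s) 1 (rot s a)
      = scalar A (opposite s) (val (opposite s) 0 0 [(0, FCup), (0, FBox 1 (rot s a)), (0, FCap)])"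
    by (simp add: tr_def fcups_def fcaps_def)
  also have "ceq (opposite s) 0 0 [(0, FCup), (0, FBox 1 (rot s a)), (0, FCap)]
      [(0, FCup), (1, FBox 1 a), (0, FCap)]"
    by (rule ceq_sub[OF ceq_slide_cup'[OF a], where u = "[]" and v = "[(0, FCap)]"]) auto
  then have "val (opposite s) 0 0 [(0, FCup), (0, FBox 1 (rot s a)), (0, FCap)]
      = val (opposite s) 0 0 [(0, FCup), (1, FBox 1 a), (0, FCap)]"
    by (rule val_cong)
  also have "scalar A (opposite s) \<dots> = trace_left A 1 s a"
    unfolding trace_left_def close_left_def val_square using a
    by (subst act_ev) (auto simp: fcups_def fcaps_def)
  also have "\<dots> = tr s 1 a"
    using spherical[OF a] a by (simp add: trace_right_eq hom_1)
  finally show ?thesis .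
qed

lemma proj_rot:
  assumes "proj s 1 a"
  shows "proj (opposite s) 1 (rot s a)"
proof -
  have a: "a \<in> box_space A 1 s" "cmp s 1 1 1 a a = a" "adj A 1 s a = a"
    using projD[OF assms] by (simp_all add: hom_1 dag_def)
  show ?thesis
    using rot_in[OF a(1)] rot_cmp[OF a(1) a(1)] rot_adj[OF a(1)]
    unfolding a(2,3) by (simp add: proj_def hom_1 dag_def)
qed

text \<open>
  A closed diagram is a multiple of the empty one, and the multiple can be pulled out wherever the closed
  diagram is placed.
\<close>

lemma val_closed:
  assumes x: "wt (shade_at s a) 0 x 0" "val (shade_at s a) 0 0 x = scale A c (ident (shade_at s a) 0)"
    and uv: "wt s m u l" "a \<le> l" "wt s l v n"
  shows "val s m n (u @ fshift a x @ v) = scale A c (val s m n (u @ v))"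
proof -
  let ?t = "shade_at s a"
  have 1: "ceq s l l (fshift a x) [(a, FBox 0 (scale A c (ident ?t 0)))]"
    using ceq_shift[OF ceq_sym[OF ceq_bend_val[OF x(1)]], of "l - a"] uv x(2)
    by (simp add: bend_square)
  have 2: "ceq s l l [(a, FBox 0 (ident ?t 0))] []"
    using ceq_shift[OF ceq_bend_val[of ?t 0 "[]" 0], of "l - a"] uv
    by (simp add: bend_square ident_def)
  have "val s m n (u @ fshift a x @ v) = val s m n (u @ (a, FBox 0 (scale A c (ident ?t 0))) # v)"
    using val_cong[OF ceq_ctx[OF 1 uv(1,3)]] by simp
  also have "\<dots> = scale A c (val s m n (u @ (a, FBox 0 (ident ?t 0)) # v))"
    by (rule val_scale)
      (use ceq_wt(1)[OF ceq_ctx[OF 2 uv(1,3)]] in simp)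
  also have "val s m n (u @ (a, FBox 0 (ident ?t 0)) # v) = val s m n (u @ v)"
    using val_cong[OF ceq_ctx[OF 2 uv(1,3)]] by simp
  finally show ?thesis .
qed

lemma bubble_value:
  assumes "a \<in> box_space A 1 s"
  shows "val s 0 0 [(0, FCup), (0, FBox 1 a), (0, FCap)] = scale A (tr s 1 a) (ident s 0)"
    "wt s 0 [(0, FCup), (0, FBox 1 a), (0, FCap)] 0"
proof -
  show wt: "wt s 0 [(0, FCup), (0, FBox 1 a), (0, FCap)] 0"
    using assms by auto
  have "val s 0 0 [(0, FCup), (0, FBox 1 a), (0, FCap)] \<in> box_space A 0 s"
    using val_in_hom[OF wt] by (simp add: hom_square)
  from scale_scalar[OF this] show "val s 0 0 [(0, FCup), (0, FBox 1 a), (0, FCap)] = scale A (tr s 1 a) (ident s 0)"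
    by (simp add: tr_def fcups_def fcaps_def)
qed

lemma ceq_idem: "proj s k p \<Longrightarrow> ceq s k k [(0, FBox k p), (0, FBox k p)] [(0, FBox k p)]"
  using ceq_cmp[of p s k p] by (simp add: proj_def)

lemma proj_1:
  assumes "proj s 1 a"
  shows "a \<in> box_space A 1 s" "adj A 1 s a = a" "rot s a \<in> box_space A 1 (opposite s)"
    "adj A 1 (opposite s) (rot s a) = rot s a"
  using assms projD[OF assms] projD[OF proj_rot[OF assms]] by (simp_all add: hom_1 dag_def rot_in)

lemma cup_absorb:
  assumes "proj s 1 a"
  shows "ceq s 0 2 [(0, FCup), (0, FBox 1 a), (1, FBox 1 (rot s a))] [(0, FCup), (0, FBox 1 a)]"
proof -
  note a = proj_1[OF assms]
  have "ceq s 0 2 [(0, FCup), (0, FBox 1 a), (1, FBox 1 (rot s a))]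
      [(0, FCup), (1, FBox 1 (rot s a)), (0, FBox 1 a)]"
    by (rule ceq_sub[OF ceq_sym[OF ceq_exch], where l = 2 and l' = 2 and u = "[(0, FCup)]"
          and v = "[]"]) (use a in auto)
  also have "ceq s 0 2 \<dots> [(0, FCup), (0, FBox 1 a), (0, FBox 1 a)]"
    by (rule ceq_sub[OF ceq_slide_cup[OF a(1)], where u = "[]" and v = "[(0, FBox 1 a)]"])
      (use a in auto)
  also have "ceq s 0 2 \<dots> [(0, FCup), (0, FBox 1 a)]"
    by (rule ceq_sub_at[OF ceq_idem[OF assms], where c = 0 and b = 1 and u = "[(0, FCup)]"
          and v = "[]"]) (use a in auto)
  finally show ?thesis .
qed

lemma bubble_idem:
  assumes "proj s 1 a"
  shows "ceq s 0 0 [(0, FCup), (0, FBox 1 a), (0, FBox 1 a), (0, FCap)]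
    [(0, FCup), (0, FBox 1 a), (0, FCap)]"
  by (rule ceq_sub_at[OF ceq_idem[OF assms], where c = 0 and b = 1 and u = "[(0, FCup)]"
        and v = "[(0, FCap)]"]) (use proj_1[OF assms] in auto)

text \<open>
  The two sides of the saddle relation, as words.
\<close>

abbreviation (input) side where
  "side s a \<equiv> [(0, FBox 1 a), (1, FBox 1 (rot s a))]"

abbreviation (input) arcs where
  "arcs a \<equiv> [(0, FBox 1 a), (0, FCap), (0, FCup), (0, FBox 1 a)]"

text \<open>
  With \<open>\<tau>\<close> the trace of \<open>a\<close>, these are the identities behind the fact that \<open>arcs a\<close>, divided by \<open>\<tau>\<close>, is a
  subprojection of \<open>side s a\<close>. Squaring the arcs creates a closed loop carrying \<open>a\<close>, which contributes
  the factor \<open>\<tau>\<close>; closing them on two strands straightens into a single such loop.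
\<close>

lemma side_arcs:
  assumes "proj s 1 a"
  defines "t \<equiv> val s 2 2 (side s a)" and "e \<equiv> val s 2 2 (arcs a)"
  shows "wt s 2 (side s a) 2" "wt s 2 (arcs a) 2" "t \<in> hom s 2 2" "e \<in> hom s 2 2"
    and "dag s 2 2 t = t" "dag s 2 2 e = e"
    and "cmp s 2 2 2 t t = t" "cmp s 2 2 2 e t = e" "cmp s 2 2 2 t e = e"
    and "cmp s 2 2 2 e e = scale A (tr s 1 a) e"
    and "tr s 2 t = tr s 1 a * tr s 1 a" "tr s 2 e = tr s 1 a"
proof -
  note a = proj_1[OF assms(1)]
  let ?b = "rot s a"
  show wt: "wt s 2 (side s a) 2" "wt s 2 (arcs a) 2"
    using a by auto
  show te: "t \<in> hom s 2 2" "e \<in> hom s 2 2"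
    unfolding t_def e_def by (intro val_in_hom wt)+
  show dag: "dag s 2 2 t = t"
  proof -
    have "ceq s 2 2 [(1, FBox 1 ?b), (0, FBox 1 a)] (side s a)"
      by (rule ceq_exch) (use a in auto)
    then show ?thesis
      unfolding t_def using dag_val[OF wt(1)] a by (simp add: val_cong)
  qed
  show dag_e: "dag s 2 2 e = e"
    unfolding e_def using dag_val[OF wt(2)] a by simp
  show "cmp s 2 2 2 t t = t"
  proof -
    have "ceq s 2 2 [(0, FBox 1 a), (1, FBox 1 ?b), (0, FBox 1 a), (1, FBox 1 ?b)]
        [(0, FBox 1 a), (0, FBox 1 a), (1, FBox 1 ?b), (1, FBox 1 ?b)]"
      by (rule ceq_sub[OF ceq_exch, where l = 2 and l' = 2 and u = "[(0, FBox 1 a)]"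
            and v = "[(1, FBox 1 ?b)]"]) (use a in auto)
    also have "ceq s 2 2 \<dots> [(0, FBox 1 a), (1, FBox 1 ?b), (1, FBox 1 ?b)]"
      by (rule ceq_sub_at[OF ceq_idem[OF assms(1)], where c = 0 and b = 1 and u = "[]"
          and v = "[(1, FBox 1 ?b), (1, FBox 1 ?b)]"]) (use a in auto)
    also have "ceq s 2 2 \<dots> [(0, FBox 1 a), (1, FBox 1 ?b)]"
      by (rule ceq_sub_at[OF ceq_idem[OF proj_rot[OF assms(1)]], where c = 1 and b = 0
            and u = "[(0, FBox 1 a)]" and v = "[]"]) (use a in auto)
    finally show ?thesis
      unfolding t_def val_append[OF wt(1,1), symmetric] by (auto intro: val_cong)
  qed
  show et: "cmp s 2 2 2 e t = e"
  proof -
    have "ceq s 2 2 [(0, FBox 1 a), (0, FCap), (0, FCup), (0, FBox 1 a), (0, FBox 1 a), (1, FBox 1 ?b)]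
        [(0, FBox 1 a), (0, FCap), (0, FCup), (0, FBox 1 a), (1, FBox 1 ?b)]"
      by (rule ceq_sub_at[OF ceq_idem[OF assms(1)], where c = 0 and b = 1
            and u = "[(0, FBox 1 a), (0, FCap), (0, FCup)]" and v = "[(1, FBox 1 ?b)]"]) (use a in auto)
    also have "ceq s 2 2 \<dots> (arcs a)"
      by (rule ceq_sub_at[OF cup_absorb[OF assms(1)], where c = 0 and b = 0
            and u = "[(0, FBox 1 a), (0, FCap)]" and v = "[]"]) (use a in auto)
    finally show ?thesis
      unfolding e_def t_def val_append[OF wt(2,1), symmetric] by (auto intro: val_cong)
  qed
  show "cmp s 2 2 2 t e = e"
    using dag_cmp[OF te(2,1)] by (simp add: et dag dag_e)
  note bubble = bubble_value[OF a(1)]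
  have bubble2: "val s 0 0 [(0, FCup), (0, FBox 1 a), (0, FBox 1 a), (0, FCap)]
      = scale A (tr s 1 a) (ident s 0)"
    using val_cong[OF bubble_idem[OF assms(1)]] bubble by simp
  show "cmp s 2 2 2 e e = scale A (tr s 1 a) e"
    unfolding e_def val_append[OF wt(2,2), symmetric]
    using val_closed[where s = s and a = 0 and u = "[(0, FBox 1 a), (0, FCap)]"
        and v = "[(0, FCup), (0, FBox 1 a)]" and m = 2 and n = 2 and l = 0
        and x = "[(0, FCup), (0, FBox 1 a), (0, FBox 1 a), (0, FCap)]" and c = "tr s 1 a"]
      bubble2 a by simp
  have cups: "fcups 0 2 = [(0, FCup), (1, FCup)]" "fcaps 0 2 = [(1, FCap), (0, FCap)]"
    by (simp_all add: numeral_2_eq_2 fcups_Suc fcaps_Suc)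
  have "tr s 2 t = scalar A s (val s 0 0
      [(0, FCup), (1, FCup), (0, FBox 1 a), (1, FBox 1 ?b), (1, FCap), (0, FCap)])"
    unfolding t_def tr_val[OF wt(1)] cups by simp
  also have "val s 0 0 [(0, FCup), (1, FCup), (0, FBox 1 a), (1, FBox 1 ?b), (1, FCap), (0, FCap)]
      = val s 0 0 ([(0, FCup), (0, FBox 1 a)]
          @ fshift 1 [(0, FCup), (0, FBox 1 ?b), (0, FCap)] @ [(0, FCap)])"
    by (rule val_cong, rule ceq_sub[OF ceq_exch, where l = 2 and l' = 4 and u = "[(0, FCup)]"
          and v = "[(1, FBox 1 ?b), (1, FCap), (0, FCap)]"]) (use a in auto)
  also have "\<dots> = scale A (tr s 1 a) (val s 0 0 ([(0, FCup), (0, FBox 1 a)] @ [(0, FCap)]))"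
    by (rule val_closed[where l = 2])
      (use bubble_value[OF a(3)] tr_rot[OF a(1)] a in auto)
  also have "\<dots> = scale A (tr s 1 a * tr s 1 a) (ident s 0)"
    using bubble by simp
  finally show "tr s 2 t = tr s 1 a * tr s 1 a"
    by (simp add: scalar_scale)
  have tr_e: "tr s 2 e = scalar A s (val s 0 0 [(0, FCup), (1, FCup), (0, FBox 1 a), (0, FCap), (0, FCup),
      (0, FBox 1 a), (1, FCap), (0, FCap)])"
    unfolding e_def tr_val[OF wt(2)] cups by simp
  have "ceq s 0 0 [(0, FCup), (1, FCup), (0, FBox 1 a), (0, FCap), (0, FCup),
      (0, FBox 1 a), (1, FCap), (0, FCap)]
      [(0, FCup), (0, FBox 1 a), (1, FCup), (0, FCap), (0, FCup), (0, FBox 1 a), (1, FCap), (0, FCap)]"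
    by (rule ceq_sub[OF ceq_exch, where l = 2 and l' = 4 and u = "[(0, FCup)]"
          and v = "[(0, FCap), (0, FCup), (0, FBox 1 a), (1, FCap), (0, FCap)]"]) (use a in auto)
  also have "ceq s 0 0 \<dots> [(0, FCup), (0, FBox 1 a), (0, FCup), (0, FBox 1 a), (1, FCap), (0, FCap)]"
    by (rule ceq_sub[OF ceq_zigzag2[of 0 2], where u = "[(0, FCup), (0, FBox 1 a)]"
          and v = "[(0, FCup), (0, FBox 1 a), (1, FCap), (0, FCap)]"]) (use a in auto)
  also have "ceq s 0 0 \<dots> [(0, FCup), (0, FBox 1 a), (0, FCup), (1, FCap), (0, FBox 1 a), (0, FCap)]"
    by (rule ceq_sub[OF ceq_sym[OF ceq_exch], where l = 4 and l' = 2
          and u = "[(0, FCup), (0, FBox 1 a), (0, FCup)]" and v = "[(0, FCap)]"]) (use a in auto)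
  also have "ceq s 0 0 \<dots> [(0, FCup), (0, FBox 1 a), (0, FBox 1 a), (0, FCap)]"
    by (rule ceq_sub[OF ceq_zigzag1[of 0 2], where u = "[(0, FCup), (0, FBox 1 a)]"
          and v = "[(0, FBox 1 a), (0, FCap)]"]) (use a in auto)
  finally have "val s 0 0 [(0, FCup), (1, FCup), (0, FBox 1 a), (0, FCap), (0, FCup),
      (0, FBox 1 a), (1, FCap), (0, FCap)] = scale A (tr s 1 a) (ident s 0)"
    unfolding bubble2[symmetric] by (rule val_cong)
  then show "tr s 2 e = tr s 1 a"
    by (simp only: tr_e scalar_scale)
qed

lemma tr_proj_positive:
  assumes "proj s k p" "p \<noteq> 0"
  shows "tr s k p \<in> \<real>" "Re (tr s k p) > 0"
  using tr_positive[of p s k k] assms by (auto simp: proj_def)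

text \<open>
  The difference \<open>d\<close> of the projections \<open>side s a\<close> and \<open>arcs a\<close> divided by \<open>\<tau>\<close> is a projection of
  trace \<open>\<tau>\<^sup>2 - 1\<close>, which therefore is nonnegative, and zero only for \<open>d = 0\<close>.
\<close>

lemma tr_proj_ge_1:
  assumes a: "proj s 1 a" "a \<noteq> 0"
  shows "Re (tr s 1 a) \<ge> 1"
    and "tr s 1 a = 1 \<Longrightarrow> val s 2 2 (side s a) = val s 2 2 (arcs a)"
proof -
  define \<tau> where "\<tau> = tr s 1 a"
  define t where "t = val s 2 2 (side s a)"
  define e where "e = val s 2 2 (arcs a)"
  note te = side_arcs[OF a(1), folded t_def e_def \<tau>_def]
  have \<tau>: "\<tau> \<in> \<real>" "Re \<tau> > 0"
    using tr_proj_positive[OF a] by (simp_all add: \<tau>_def)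
  then have nz: "\<tau> \<noteq> 0" and cnj: "cnj \<tau> = \<tau>"
    by (auto simp: Reals_cnj_iff)
  define d where "d = t - scale A (1 / \<tau>) e"
  have d: "d \<in> hom s 2 2"
    unfolding d_def using te by simp
  have dag_d: "dag s 2 2 d = d"
    unfolding d_def using te cnj by (simp add: dag_diff dag_scale)
  have dd: "cmp s 2 2 2 d d = d"
    unfolding d_def using te nz
    by (simp add: cmp_diff_left cmp_diff_right cmp_scale_left cmp_scale_right)
  have tr_d: "tr s 2 d = \<tau> * \<tau> - 1"
    unfolding d_def using te nz by (simp add: tr_diff tr_scale)
  show "Re (tr s 1 a) \<ge> 1"
  proof (rule ccontr)
    assume "\<not> Re (tr s 1 a) \<ge> 1"
    then have "Re \<tau> < 1"
      by (simp add: \<tau>_def)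
    then have "Re \<tau> * Re \<tau> < 1"
      using \<tau>(2) by (metis less_eq_real_def mult_less_cancel_left2 not_less order_less_trans)
    moreover have "\<tau> = of_real (Re \<tau>)"
      using \<tau>(1) by simp
    then have "Re (\<tau> * \<tau> - 1) = Re \<tau> * Re \<tau> - 1"
      by (metis Re_complex_of_real of_real_mult minus_complex.sel(1) one_complex.sel(1))
    ultimately have "Re (tr s 2 d) < 0"
      by (simp add: tr_d)
    moreover have "Re (tr s 2 d) \<ge> 0"
      using tr_positive[OF d] tr_zero[of s 2] by (cases "d = 0") (auto simp: dag_d dd)
    ultimately show False
      by simp
  qed
  show "val s 2 2 (side s a) = val s 2 2 (arcs a)" if "tr s 1 a = 1"
  proof -
    have "\<tau> = 1"
      using that by (simp add: \<tau>_def)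
    then have "d = 0"
      using tr_positive[OF d] tr_d by (auto simp: dag_d dd)
    then show ?thesis
      using \<open>\<tau> = 1\<close> by (simp add: d_def t_def e_def)
  qed
qed

text \<open>
  One condition, invariant under rotation, from which the bubble and saddle relations follow for both
  shadings.
\<close>

definition colour :: "shading \<Rightarrow> 'a \<Rightarrow> bool" where
  "colour s a \<longleftrightarrow> proj s 1 a \<and> tr s 1 a = 1"

lemma colour_nonzero: "colour s a \<Longrightarrow> a \<noteq> 0"
  using tr_zero by (auto simp: colour_def)

lemma colour_rot: "colour s a \<Longrightarrow> colour (opposite s) (rot s a)"
  using proj_rot tr_rot proj_1(1) by (auto simp: colour_def)

lemma ceq_saddle:
  assumes "colour s a"
  shows "ceq s 2 2 (arcs a) (side s a)"
  using tr_proj_ge_1(2)[of s a] side_arcs(1,2)[of s a] colour_nonzero[OF assms] assms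
  by (auto simp: ceq_iff_val colour_def)

lemma ceq_bubble:
  assumes "colour s a"
  shows "ceq s 0 0 [(0, FCup), (0, FBox 1 a), (0, FCap)] []"
  using assms bubble_value[of a s] proj_1(1)[of s a]
  by (auto simp: ceq_iff_val colour_def ident_def)

text \<open>
  A coloured strand next to a cup of the same colour reconnects: the saddle relation is applied to the
  right leg of the cup and the strand, and the resulting zigzag is straightened. The newly created cup
  lies at the right of the strand. This is the identity that makes tensoring with a colour full.
\<close>

lemma ceq_swallow:
  assumes c: "colour s a"
  shows "ceq s 1 3 [(0, FCup), (0, FBox 1 a), (2, FBox 1 a)] [(0, FBox 1 a), (1, FCup), (1, FBox 1 (rot s a))]"
proof -
  have p: "proj s 1 a"
    using c by (simp add: colour_def)
  note a = proj_1[OF p]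
  let ?b = "rot s a"
  have saddle: "ceq (opposite s) 2 2 (arcs ?b) [(0, FBox 1 ?b), (1, FBox 1 a)]"
    using ceq_saddle[OF colour_rot[OF c]] by (simp add: rot_rot[OF a(1)])
  have "ceq s 1 3 [(0, FCup), (0, FBox 1 a), (2, FBox 1 a)]
      [(0, FCup), (0, FBox 1 a), (1, FBox 1 ?b), (2, FBox 1 a)]"
    by (rule ceq_sub_at[OF ceq_sym[OF cup_absorb[OF p]], where c = 0 and b = 1 and u = "[]"
          and v = "[(2, FBox 1 a)]"]) (use a in auto)
  also have "ceq s 1 3 \<dots> [(0, FCup), (0, FBox 1 a), (1, FBox 1 ?b), (1, FCap), (1, FCup), (1, FBox 1 ?b)]"
    by (rule ceq_sub_at[OF ceq_sym[OF saddle], where c = 1 and b = 0 and u = "[(0, FCup), (0, FBox 1 a)]"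
          and v = "[]"]) (use a in auto)
  also have "ceq s 1 3 \<dots> [(0, FCup), (0, FBox 1 a), (1, FCap), (1, FCup), (1, FBox 1 ?b)]"
    by (rule ceq_sub_at[OF cup_absorb[OF p], where c = 0 and b = 1 and u = "[]"
          and v = "[(1, FCap), (1, FCup), (1, FBox 1 ?b)]"]) (use a in auto)
  also have "ceq s 1 3 \<dots> [(0, FCup), (1, FCap), (0, FBox 1 a), (1, FCup), (1, FBox 1 ?b)]"
    by (rule ceq_sub[OF ceq_sym[OF ceq_exch], where l = 3 and l' = 1
          and u = "[(0, FCup)]" and v = "[(1, FCup), (1, FBox 1 ?b)]"]) (use a in auto)
  also have "ceq s 1 3 \<dots> [(0, FBox 1 a), (1, FCup), (1, FBox 1 ?b)]"
    by (rule ceq_sub[OF ceq_zigzag1[of 0 1], where u = "[]"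
          and v = "[(0, FBox 1 a), (1, FCup), (1, FBox 1 ?b)]"]) (use a in auto)
  finally show ?thesis .
qed

lemma ceq_swallow_cap:
  assumes c: "colour s a"
  shows "ceq s 3 1 [(2, FBox 1 a), (0, FBox 1 a), (0, FCap)] [(1, FBox 1 (rot s a)), (1, FCap), (0, FBox 1 a)]"
  using ceq_adj[OF ceq_swallow[OF c]] proj_1[of s a] c by (simp add: colour_def)

section \<open>Tensoring a projection with a strand\<close>

text \<open>
  \<open>on_last s k a\<close> is \<open>k\<close> vertical strands followed by \<open>a\<close>, so that the tensor product of \<open>p\<close> and \<open>a\<close> is a
  product of two commuting elements.
\<close>

definition on_last :: "shading \<Rightarrow> nat \<Rightarrow> 'a \<Rightarrow> 'a" where
  "on_last s k a = val s (Suc k) (Suc k) [(k, FBox 1 a)]"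

definition ten :: "shading \<Rightarrow> nat \<Rightarrow> 'a \<Rightarrow> 'a \<Rightarrow> 'a" where
  "ten s k p a = cmp s (Suc k) (Suc k) (Suc k) (add_right s k k p) (on_last s k a)"

lemma wt_on_last: "a \<in> box_space A 1 (shade_at s k) \<Longrightarrow> wt s (Suc k) [(k, FBox 1 a)] (Suc k)"
  by simp

lemma on_last_in [simp]: "a \<in> box_space A 1 (shade_at s k) \<Longrightarrow> on_last s k a \<in> hom s (Suc k) (Suc k)"
  unfolding on_last_def by (intro val_in_hom wt_on_last)

lemma add_right_on_last_commute:
  assumes f: "f \<in> hom s m n" and a: "a \<in> box_space A 1 (shade_at s m)"
  shows "cmp s (Suc m) (Suc n) (Suc n) (add_right s m n f) (on_last s n a)
    = cmp s (Suc m) (Suc m) (Suc n) (on_last s m a) (add_right s m n f)"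
proof -
  have a': "a \<in> box_space A 1 (shade_at s n)"
    using a shade_at_wt[OF wt_bend[OF f]] by simp
  have "ceq s (Suc m) (Suc n) (bend m n f @ [(n, FBox 1 a)]) ([(m, FBox 1 a)] @ bend m n f)"
    using ceq_interchange[OF wt_bend[OF f], of 1 "[(0, FBox 1 a)]" 1] a by simp
  then show ?thesis
    unfolding add_right_def on_last_def val_append[OF wt_Suc[OF wt_bend[OF f]] wt_on_last[OF a'], symmetric]
      val_append[OF wt_on_last[OF a] wt_Suc[OF wt_bend[OF f]], symmetric]
    by (rule val_cong)
qed

lemma on_last_idem:
  assumes "proj (shade_at s k) 1 a"
  shows "cmp s (Suc k) (Suc k) (Suc k) (on_last s k a) (on_last s k a) = on_last s k a" "dag s (Suc k) (Suc k) (on_last s k a) = on_last s k a"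
proof -
  note a = proj_1[OF assms]
  show "cmp s (Suc k) (Suc k) (Suc k) (on_last s k a) (on_last s k a) = on_last s k a"
    unfolding on_last_def val_append[OF wt_on_last wt_on_last, OF a(1,1), symmetric]
    by (rule val_cong, rule ceq_sub_at[OF ceq_idem[OF assms], where c = k and b = 0 and u = "[]" and v = "[]"])
      (use a in auto)
  show "dag s (Suc k) (Suc k) (on_last s k a) = on_last s k a"
    unfolding on_last_def dag_val[OF wt_on_last[OF a(1)]] using a by simp
qed

lemma on_last_add:
  assumes "a \<in> box_space A 1 (shade_at s k)" "b \<in> box_space A 1 (shade_at s k)"
  shows "on_last s k (a + b) = on_last s k a + on_last s k b"
  unfolding on_last_def using val_add[of s "Suc k" "[]" k 1 a "[]" "Suc k" b] assms by simp

lemma on_last_ident: "on_last s k (ident (shade_at s k) 1) = ident s (Suc k)"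
proof -
  have "ceq s (Suc k) (Suc k) [(k, FBox 1 (ident (shade_at s k) 1))] []"
    using ceq_shift[OF ceq_bend_val[of "shade_at s k" 1 "[]" 1], of 0] by (simp add: ident_def bend_square)
  then show ?thesis
    unfolding on_last_def ident_def[of s] by (rule val_cong)
qed

lemma ten_val:
  assumes "p \<in> hom s k k" "a \<in> box_space A 1 (shade_at s k)"
  shows "ten s k p a = val s (Suc k) (Suc k) [(0, FBox k p), (k, FBox 1 a)]"
  unfolding ten_def add_right_def on_last_def val_append[OF wt_Suc[OF wt_bend[OF assms(1)]] wt_on_last[OF assms(2)], symmetric]
  by (simp add: bend_square)

lemma ten_tensor:
  assumes "p \<in> hom s k k" "a \<in> box_space A 1 (shade_at s k)"
  shows "tensor A k 1 s p a = ten s k p a"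
  using tensor_eq[of p s k a 1] assms by (simp add: ten_val hom_square)

lemma ten_in [simp]:
  "p \<in> hom s k k \<Longrightarrow> a \<in> box_space A 1 (shade_at s k) \<Longrightarrow> ten s k p a \<in> hom s (Suc k) (Suc k)"
  by (simp add: ten_def)

lemma add_right_proj:
  assumes "proj s k p"
  shows "proj s (Suc k) (add_right s k k p)"
  using projD[OF assms] add_right_cmp[of p s k k p k] by (simp add: proj_def dag_add_right)

lemma proj_ten:
  assumes p: "proj s k p" and a: "proj (shade_at s k) 1 a"
  shows "proj s (Suc k) (ten s k p a)"
proof -
  note hom = projD[OF p] proj_1[OF a] on_last_idem[OF a] projD[OF add_right_proj[OF p]] add_right_on_last_commute[of p s k k a]
  have "cmp s (Suc k) (Suc k) (Suc k) (ten s k p a) (ten s k p a) =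
     cmp s (Suc k) (Suc k) (Suc k) (add_right s k k p) (cmp s (Suc k) (Suc k) (Suc k)
       (cmp s (Suc k) (Suc k) (Suc k) (on_last s k a) (add_right s k k p)) (on_last s k a))"
    unfolding ten_def using hom(1,4) by (simp add: cmp_assoc)
  also have "\<dots> = cmp s (Suc k) (Suc k) (Suc k) (cmp s (Suc k) (Suc k) (Suc k) (add_right s k k p) (add_right s k k p))
      (cmp s (Suc k) (Suc k) (Suc k) (on_last s k a) (on_last s k a))"
    using hom(1,4) by (simp flip: add_right_on_last_commute add: cmp_assoc)
  also have "\<dots> = ten s k p a"
    using hom by (simp add: ten_def)
  finally show ?thesis
    using hom by (simp add: proj_def ten_def dag_cmp)
qed

text \<open>
  If \<open>f\<close> implements an isomorphism, so does \<open>f\<close> tensored with \<open>a\<close>. The shading at the right of \<open>p\<close> and of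
  \<open>q\<close> is the same because \<open>m + n\<close> is even.
\<close>

lemma iso_ten:
  assumes p: "proj s m p" and q: "proj s n q" and iso: "iso s m p n q"
    and a: "proj (shade_at s m) 1 a"
  shows "iso s (Suc m) (ten s m p a) (Suc n) (ten s n q a)"
proof -
  obtain f where f: "f \<in> phom s m p n q" "cmp s m n m f (dag s m n f) = p"
      "cmp s n m n (dag s m n f) f = q"
    using iso by (auto simp: iso_def)
  note fH = phomD[OF f(1)]
  have t: "shade_at s n = shade_at s m"
    using shade_at_wt[OF wt_bend[OF fH(1)]] .
  then have a': "proj (shade_at s n) 1 a"
    using a by simp
  let ?m = "Suc m" and ?n = "Suc n"
  let ?P = "add_right s m m p" and ?Q = "add_right s n n q" and ?f = "add_right s m n f" and ?g = "add_right s n m (dag s m n f)"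
  let ?R = "on_last s m a" and ?S = "on_last s n a"
  let ?F = "cmp s ?m ?n ?n ?f ?S"
  note on_last = on_last_idem[OF a] on_last_idem[OF a'] on_last_in[OF proj_1(1)[OF a]] on_last_in[OF proj_1(1)[OF a']]
  have hom: "?P \<in> hom s ?m ?m" "?Q \<in> hom s ?n ?n" "?f \<in> hom s ?m ?n" "?g \<in> hom s ?n ?m"
    using fH projD[OF p] projD[OF q] by auto
  have comm: "cmp s ?m ?m ?n ?R ?f = ?F" "cmp s ?n ?n ?m ?S ?g = cmp s ?n ?m ?m ?g ?R"
    "cmp s ?m ?m ?m ?R ?P = cmp s ?m ?m ?m ?P ?R" "cmp s ?n ?n ?n ?S ?Q = cmp s ?n ?n ?n ?Q ?S"
    using add_right_on_last_commute[OF fH(1) proj_1(1)[OF a]] add_right_on_last_commute[OF dag_in[OF fH(1)] proj_1(1)[OF a']]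
      add_right_on_last_commute[OF projD(1)[OF p] proj_1(1)[OF a]] add_right_on_last_commute[OF projD(1)[OF q] proj_1(1)[OF a']]
    by simp_all
  have add_right: "cmp s ?m ?m ?n ?P ?f = ?f" "cmp s ?m ?n ?n ?f ?Q = ?f" "cmp s ?m ?n ?m ?f ?g = ?P"
    "cmp s ?n ?m ?n ?g ?f = ?Q"
    using add_right_cmp[OF projD(1)[OF p] fH(1)] add_right_cmp[OF fH(1) projD(1)[OF q]]
      add_right_cmp[OF fH(1) dag_in[OF fH(1)]] add_right_cmp[OF dag_in[OF fH(1)] fH(1)] fH f by simp_all
  have dagF: "dag s ?m ?n ?F = cmp s ?n ?n ?m ?S ?g"
    using hom on_last fH by (simp add: dag_cmp dag_add_right)
  have FR: "cmp s ?m ?m ?n ?R ?F = ?F" "cmp s ?m ?n ?n ?F ?S = ?F"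
    using cmp_assoc[OF on_last(5,5) hom(3)] cmp_assoc[OF hom(3) on_last(6,6)] on_last by (simp_all add: comm(1))
  have F: "?F \<in> hom s ?m ?n"
    using hom on_last by simp
  have "cmp s ?m ?m ?n (ten s m p a) ?F = ?F"
    using cmp_assoc[OF hom(1) on_last(5) F] cmp_assoc[OF hom(1,3) on_last(6)] by (simp add: ten_def FR add_right)
  moreover have "cmp s ?m ?n ?n ?F (ten s n q a) = ?F"
  proof -
    have "cmp s ?m ?n ?n ?F (ten s n q a) =
        cmp s ?m ?n ?n (cmp s ?m ?n ?n ?f (cmp s ?n ?n ?n ?S ?Q)) ?S"
      unfolding ten_def using hom on_last(5,6) by (simp add: cmp_assoc)
    also have "\<dots> = cmp s ?m ?n ?n (cmp s ?m ?n ?n (cmp s ?m ?n ?n ?f ?Q) ?S) ?S"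
      unfolding comm(4) using hom on_last(5,6) by (simp add: cmp_assoc)
    finally show ?thesis
      by (simp add: add_right FR)
  qed
  moreover have "cmp s ?m ?n ?m ?F (dag s ?m ?n ?F) = ten s m p a"
  proof -
    have "cmp s ?m ?n ?m ?F (dag s ?m ?n ?F) =
        cmp s ?m ?n ?m ?f (cmp s ?n ?n ?m (cmp s ?n ?n ?n ?S ?S) ?g)"
      unfolding dagF using hom on_last(5,6) by (simp add: cmp_assoc)
    also have "\<dots> = cmp s ?m ?m ?m (cmp s ?m ?n ?m ?f ?g) ?R"
      unfolding on_last(3) comm(2) using hom on_last(5,6) by (simp add: cmp_assoc)
    finally show ?thesis
      by (simp add: add_right ten_def)
  qed
  moreover have "cmp s ?n ?m ?n (dag s ?m ?n ?F) ?F = ten s n q a"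
  proof -
    have "cmp s ?n ?m ?n (dag s ?m ?n ?F) ?F = cmp s ?n ?n ?n ?S (cmp s ?n ?n ?n (cmp s ?n ?m ?n ?g ?f) ?S)"
      unfolding dagF using hom on_last by (simp add: cmp_assoc)
    also have "\<dots> = cmp s ?n ?n ?n (cmp s ?n ?n ?n ?S ?Q) ?S"
      using hom on_last add_right by (simp add: cmp_assoc)
    also have "\<dots> = ten s n q a"
      unfolding comm(4) ten_def using hom on_last by (simp add: cmp_assoc)
    finally show ?thesis .
  qed
  ultimately show ?thesis
    unfolding iso_def phom_def using hom on_last by (intro bexI[of _ ?F]) auto
qed

lemma shade_at_Suc: "shade_at s (Suc k) = opposite (shade_at s k)"
  by (cases s) (auto simp: shade_at_def)

text \<open>
  The isomorphism is \<open>p\<close> with a coloured cup at its right. One of its products with its adjoint contains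
  a bubble, the other one a saddle.
\<close>

lemma iso_cancel:
  assumes p: "proj s k p" and c: "colour (shade_at s k) a"
  shows "iso s (Suc (Suc k)) (ten s (Suc k) (ten s k p a) (rot (shade_at s k) a)) k p"
proof -
  let ?t = "shade_at s k" and ?k = "Suc (Suc k)"
  let ?b = "rot ?t a"
  have pa: "proj ?t 1 a"
    using c by (simp add: colour_def)
  note a = proj_1[OF pa]
  note p' = projD[OF p]
  have pb: "p \<in> box_space A k s" "adj A k s p = p"
    using p' by (auto simp: hom_def dag_def)
  let ?pp = "ten s (Suc k) (ten s k p a) ?b"
  have proj: "proj s (Suc k) (ten s k p a)" "proj s ?k ?pp"
    using proj_ten[OF p pa] proj_ten[OF proj_ten[OF p pa], of ?b] proj_rot[OF pa]
    by (simp_all add: shade_at_Suc)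
  let ?w = "[(0, FBox k p), (k, FCup), (k, FBox 1 a)]"
  let ?w' = "[(k, FBox 1 a), (k, FCap), (0, FBox k p)]"
  have w: "wt s k ?w ?k" "wt s ?k ?w' k"
    using pb a by auto
  have side: "val s ?k ?k ([(0, FBox k p)] @ fshift k (side ?t a)) = ?pp"
  proof -
    have "wt s (Suc k) [(0, FBox k p), (k, FBox 1 a)] (Suc k)"
      using pb a by simp
    from add_right_val[OF this] have "add_right s (Suc k) (Suc k) (ten s k p a) = val s ?k ?k [(0, FBox k p), (k, FBox 1 a)]"
      unfolding ten_val[OF p'(1) a(1)] .
    moreover have "val s ?k ?k ([(0, FBox k p), (k, FBox 1 a)] @ [(Suc k, FBox 1 ?b)])
        = cmp s ?k ?k ?k (val s ?k ?k [(0, FBox k p), (k, FBox 1 a)]) (val s ?k ?k [(Suc k, FBox 1 ?b)])"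
      by (rule val_append) (use pb a in \<open>auto simp: shade_at_Suc\<close>)
    ultimately show ?thesis
      by (simp add: ten_def[of s "Suc k"] on_last_def)
  qed
  define f where "f = val s k ?k ?w"
  have f: "f \<in> hom s k ?k"
    unfolding f_def by (intro val_in_hom w)
  have dag_f: "dag s k ?k f = val s ?k k ?w'"
    unfolding f_def dag_val[OF w(1)] using a pb by simp
  have ff: "cmp s k ?k k f (dag s k ?k f) = p"
  proof -
    have "ceq s k k (?w @ ?w') [(0, FBox k p), (k, FCup), (k, FBox 1 a), (k, FCap), (0, FBox k p)]"
      by (rule ceq_sub_at[OF ceq_idem[OF pa], where c = k and b = 1 and u = "[(0, FBox k p), (k, FCup)]"
            and v = "[(k, FCap), (0, FBox k p)]"]) (use a pb in auto)
    also have "ceq s k k \<dots> [(0, FBox k p), (0, FBox k p)]"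
      by (rule ceq_sub_at[OF ceq_bubble[OF c], where c = k and b = 0 and u = "[(0, FBox k p)]"
            and v = "[(0, FBox k p)]"]) (use a pb in auto)
    also have "ceq s k k \<dots> [(0, FBox k p)]"
      by (rule ceq_idem[OF p])
    finally have "val s k k (?w @ ?w') = val s k k [(0, FBox k p)]"
      by (rule val_cong)
    then show ?thesis
      unfolding dag_f unfolding f_def val_append[OF w, symmetric]
      using val_bend[OF p'(1)] by (simp add: bend_square)
  qed
  have ff': "cmp s ?k k ?k (dag s k ?k f) f = ?pp"
  proof -
    have w2: "ceq s ?k ?k (?w' @ ?w) [(k, FBox 1 a), (k, FCap), (0, FBox k p), (k, FCup), (k, FBox 1 a)]"
      by (rule ceq_sub_at[OF ceq_idem[OF p], where c = 0 and b = 0 and u = "[(k, FBox 1 a), (k, FCap)]"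
            and v = "[(k, FCup), (k, FBox 1 a)]"]) (use a pb in auto)
    also have "ceq s ?k ?k \<dots> [(k, FBox 1 a), (0, FBox k p), (k, FCap), (k, FCup), (k, FBox 1 a)]"
      by (rule ceq_sub[OF ceq_exch, where l = ?k and l' = k and u = "[(k, FBox 1 a)]"
            and v = "[(k, FCup), (k, FBox 1 a)]"]) (use a pb in auto)
    also have "ceq s ?k ?k \<dots> ([(0, FBox k p)] @ fshift k (arcs a))"
      by (rule ceq_sub[OF ceq_exch, where l = ?k and l' = ?k and u = "[]"
            and v = "[(k, FCap), (k, FCup), (k, FBox 1 a)]"]) (use a pb in auto)
    also have "ceq s ?k ?k \<dots> ([(0, FBox k p)] @ fshift k (side ?t a))"
      by (rule ceq_sub_at[OF ceq_saddle[OF c], where c = k and b = 0 and u = "[(0, FBox k p)]"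
            and v = "[]"]) (use a pb in auto)
    finally have "val s ?k ?k (?w' @ ?w) = ?pp"
      using side val_cong by simp
    then show ?thesis
      unfolding dag_f unfolding f_def val_append[OF w(2,1), symmetric] .
  qed
  have "f \<in> phom s k p ?k ?pp"
  proof -
    have "cmp s k k ?k p f = f"
    proof -
      have "ceq s k ?k ([(0, FBox k p)] @ ?w) ?w"
        by (rule ceq_sub_at[OF ceq_idem[OF p], where c = 0 and b = 0 and u = "[]"
              and v = "[(k, FCup), (k, FBox 1 a)]"]) (use a pb in auto)
      from val_cong[OF this] have "val s k ?k ([(0, FBox k p)] @ ?w) = f"
        by (simp add: f_def)
      moreover have "val s k ?k ([(0, FBox k p)] @ ?w) = cmp s k k ?k (val s k k [(0, FBox k p)]) f"
        unfolding f_def by (rule val_append[OF _ w(1)]) (use pb in simp)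
      ultimately show ?thesis
        using val_bend[OF p'(1)] by (simp add: bend_square)
    qed
    moreover from this have "cmp s k ?k ?k f ?pp = f"
      unfolding ff'[symmetric] using f ff by (simp flip: cmp_assoc)
    ultimately show ?thesis
      using f by (simp add: phom_def)
  qed
  then have "iso s k p ?k ?pp"
    using ff ff' by (auto simp: iso_def)
  then show ?thesis
    by (rule iso_sym[OF p proj(2)])
qed

lemma iso_nonzero:
  assumes "proj s m p" "proj s n q" "iso s m p n q" "p \<noteq> 0"
  shows "q \<noteq> 0"
proof
  assume "q = 0"
  obtain f where f: "f \<in> hom s m n" "cmp s m n m f (dag s m n f) = p"
      "cmp s n m n (dag s m n f) f = q"
    using assms(3) by (auto simp: iso_def dest: phomD)
  have "dag s m n f = 0"
    by (rule cmp_dag_eq_0[of _ s n m]) (use f \<open>q = 0\<close> in simp_all)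
  then show False
    using f(2) cmp_zero_right[OF f(1), of m] hom_even[OF f(1)] \<open>p \<noteq> 0\<close> by (simp add: add.commute)
qed

text \<open>
  An endomorphism \<open>g\<close> of the tensor product is recovered from its partial trace \<open>h\<close> over the last strand,
  as \<open>h\<close> tensored with \<open>a\<close>: by \<open>ceq_swallow_cap\<close> the loop closing \<open>g\<close> can be reconnected with the extra
  strand. As \<open>h\<close> is an endomorphism of \<open>p\<close>, it is a scalar.
\<close>

lemma minimal_ten:
  assumes m: "minimal s k p" and c: "colour (shade_at s k) a"
  shows "minimal s (Suc k) (ten s k p a)"
proof -
  let ?t = "shade_at s k" and ?k = "Suc k"
  let ?b = "rot ?t a"
  let ?q = "ten s k p a"
  have p: "proj s k p" and "p \<noteq> 0"
    using m by (auto simp: minimal_def)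
  have pa: "proj ?t 1 a"
    using c by (simp add: colour_def)
  note a = proj_1[OF pa] and p' = projD[OF p]
  have pb: "p \<in> box_space A k s"
    using p' by (auto simp: hom_def dag_def)
  have q: "proj s ?k ?q"
    by (rule proj_ten[OF p pa])
  have pc: "proj s (Suc ?k) (ten s ?k ?q ?b)"
    using proj_ten[OF q, of ?b] proj_rot[OF pa] by (simp add: shade_at_Suc)
  have "ten s ?k ?q ?b \<noteq> 0"
    using iso_nonzero[OF p pc iso_sym[OF pc p iso_cancel[OF p c]] \<open>p \<noteq> 0\<close>] .
  then have "?q \<noteq> 0"
    using add_right_zero[of ?k ?k s] cmp_zero_left[OF on_last_in[of ?b s ?k], of "Suc ?k"] a
    by (auto simp: ten_def[of s ?k] shade_at_Suc)
  moreover have "\<exists>d. g = scale A d ?q" if g: "g \<in> phom s ?k ?q ?k ?q" for g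
  proof -
    have gH: "g \<in> hom s ?k ?k" "cmp s ?k ?k ?k ?q g = g" "cmp s ?k ?k ?k g ?q = g"
      using phomD[OF g] .
    have gb: "g \<in> box_space A ?k s"
      using gH by (simp add: hom_def)
    let ?w = "[(k, FCup), (k, FBox 1 a), (0, FBox ?k g), (k, FBox 1 a), (k, FCap)]"
    have w: "wt s k ?w k"
      using gb a by auto
    define h where "h = val s k k ?w"
    have h: "h \<in> hom s k k"
      unfolding h_def by (intro val_in_hom w)
    have abs: "ceq s ?k ?k [(k, FBox 1 a), (0, FBox ?k g)] [(0, FBox ?k g)]"
      "ceq s ?k ?k [(0, FBox ?k g), (k, FBox 1 a)] [(0, FBox ?k g)]"
      "ceq s ?k ?k [(0, FBox k p), (0, FBox ?k g)] [(0, FBox ?k g)]"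
      "ceq s ?k ?k [(0, FBox ?k g), (0, FBox k p)] [(0, FBox ?k g)]"
    proof -
      note on_last = on_last_idem[OF pa] on_last_in[OF a(1)] and add_right = projD[OF add_right_proj[OF p]]
      have q': "?q = cmp s ?k ?k ?k (on_last s k a) (add_right s k k p)"
        unfolding ten_def by (rule add_right_on_last_commute[OF p'(1) a(1)])
      have "cmp s ?k ?k ?k (on_last s k a) ?q = ?q" "cmp s ?k ?k ?k (add_right s k k p) ?q = ?q"
        "cmp s ?k ?k ?k ?q (on_last s k a) = ?q" "cmp s ?k ?k ?k ?q (add_right s k k p) = ?q"
        using cmp_assoc[OF on_last(3,3) add_right(1)] cmp_assoc[OF add_right(1,1) on_last(3)] cmp_assoc[OF add_right(1) on_last(3,3)]
          cmp_assoc[OF on_last(3) add_right(1,1)] on_last add_right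
        by (auto simp: q') (simp_all add: ten_def flip: q')
      then have "cmp s ?k ?k ?k (on_last s k a) g = g" "cmp s ?k ?k ?k (add_right s k k p) g = g"
        "cmp s ?k ?k ?k g (on_last s k a) = g" "cmp s ?k ?k ?k g (add_right s k k p) = g"
        using gH cmp_assoc[OF on_last(3) projD(1)[OF q] gH(1)] cmp_assoc[OF add_right(1) projD(1)[OF q] gH(1)]
          cmp_assoc[OF gH(1) projD(1)[OF q] on_last(3)] cmp_assoc[OF gH(1) projD(1)[OF q] add_right(1)]
        by simp_all
      then have val: "val s ?k ?k ([(k, FBox 1 a)] @ [(0, FBox ?k g)]) = val s ?k ?k [(0, FBox ?k g)]"
        "val s ?k ?k ([(0, FBox ?k g)] @ [(k, FBox 1 a)]) = val s ?k ?k [(0, FBox ?k g)]"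
        "val s ?k ?k ([(0, FBox k p)] @ [(0, FBox ?k g)]) = val s ?k ?k [(0, FBox ?k g)]"
        "val s ?k ?k ([(0, FBox ?k g)] @ [(0, FBox k p)]) = val s ?k ?k [(0, FBox ?k g)]"
        using val_append[of s ?k "[(k, FBox 1 a)]" ?k "[(0, FBox ?k g)]" ?k]
          val_append[of s ?k "[(0, FBox ?k g)]" ?k "[(k, FBox 1 a)]" ?k]
          val_append[of s ?k "[(0, FBox k p)]" ?k "[(0, FBox ?k g)]" ?k]
          val_append[of s ?k "[(0, FBox ?k g)]" ?k "[(0, FBox k p)]" ?k]
          val_bend[OF gH(1)] gb pb a by (simp_all add: on_last_def add_right_def bend_square)
      show "ceq s ?k ?k [(k, FBox 1 a), (0, FBox ?k g)] [(0, FBox ?k g)]"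
        "ceq s ?k ?k [(0, FBox ?k g), (k, FBox 1 a)] [(0, FBox ?k g)]"
        "ceq s ?k ?k [(0, FBox k p), (0, FBox ?k g)] [(0, FBox ?k g)]"
        "ceq s ?k ?k [(0, FBox ?k g), (0, FBox k p)] [(0, FBox ?k g)]"
        using val gb pb a by (subst ceq_iff_val; simp)+
    qed
    have "h \<in> phom s k p k p"
    proof -
      have "ceq s k k ([(0, FBox k p)] @ ?w) [(k, FCup), (0, FBox k p), (k, FBox 1 a), (0, FBox ?k g), (k, FBox 1 a), (k, FCap)]"
        by (rule ceq_sub[OF ceq_sym[OF ceq_exch], where l = k and l' = "Suc ?k" and u = "[]"
              and v = "[(k, FBox 1 a), (0, FBox ?k g), (k, FBox 1 a), (k, FCap)]"]) (use a pb gb in auto)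
      also have "ceq s k k \<dots> [(k, FCup), (k, FBox 1 a), (0, FBox k p), (0, FBox ?k g), (k, FBox 1 a), (k, FCap)]"
        by (rule ceq_sub[OF ceq_sym[OF ceq_exch], where l = "Suc ?k" and l' = "Suc ?k" and u = "[(k, FCup)]"
              and v = "[(0, FBox ?k g), (k, FBox 1 a), (k, FCap)]"]) (use a pb gb in auto)
      also have "ceq s k k \<dots> ?w"
        by (rule ceq_sub_at[OF abs(3), where c = 0 and b = 1 and u = "[(k, FCup), (k, FBox 1 a)]"
              and v = "[(k, FBox 1 a), (k, FCap)]"]) (use a pb gb in auto)
      finally have 1: "val s k k ([(0, FBox k p)] @ ?w) = h"
        unfolding h_def by (rule val_cong)
      have "ceq s k k (?w @ [(0, FBox k p)]) [(k, FCup), (k, FBox 1 a), (0, FBox ?k g), (k, FBox 1 a), (0, FBox k p), (k, FCap)]"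
        by (rule ceq_sub[OF ceq_exch, where l = "Suc ?k" and l' = k
              and u = "[(k, FCup), (k, FBox 1 a), (0, FBox ?k g), (k, FBox 1 a)]"
              and v = "[]"]) (use a pb gb in auto)
      also have "ceq s k k \<dots> [(k, FCup), (k, FBox 1 a), (0, FBox ?k g), (0, FBox k p), (k, FBox 1 a), (k, FCap)]"
        by (rule ceq_sub[OF ceq_exch, where l = "Suc ?k" and l' = "Suc ?k"
              and u = "[(k, FCup), (k, FBox 1 a), (0, FBox ?k g)]"
              and v = "[(k, FCap)]"]) (use a pb gb in auto)
      also have "ceq s k k \<dots> ?w"
        by (rule ceq_sub_at[OF abs(4), where c = 0 and b = 1 and u = "[(k, FCup), (k, FBox 1 a)]"
              and v = "[(k, FBox 1 a), (k, FCap)]"]) (use a pb gb in auto)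
      finally have 2: "val s k k (?w @ [(0, FBox k p)]) = h"
        unfolding h_def by (rule val_cong)
      have box: "wt s k [(0, FBox k p)] k" "val s k k [(0, FBox k p)] = p"
        using pb val_bend[OF p'(1)] by (simp_all add: bend_square)
      show ?thesis
        using val_append[OF box(1) w] val_append[OF w box(1)] h
        unfolding 1 2 box(2) h_def[symmetric] by (simp add: phom_def)
    qed
    then obtain d where d: "h = scale A d p"
      using m by (auto simp: minimal_def)
    have "ten s k h a = val s ?k ?k (?w @ [(k, FBox 1 a)])"
    proof -
      have "val s ?k ?k (?w @ [(k, FBox 1 a)]) = cmp s ?k ?k ?k (val s ?k ?k ?w) (on_last s k a)"
        unfolding on_last_def by (rule val_append[OF wt_Suc[OF w] wt_on_last[OF a(1)]])
      then show ?thesis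
        unfolding ten_def h_def add_right_val[OF w] by simp
    qed
    also have "val s ?k ?k (?w @ [(k, FBox 1 a)]) = val s ?k ?k [(0, FBox ?k g)]"
    proof (rule val_cong)
      let ?a = "(k, FBox 1 a)" and ?g = "(0, FBox ?k g)" and ?c = "(k + 2, FBox 1 a)"
      have "ceq s ?k ?k (?w @ [?a]) [(k, FCup), ?a, ?g, ?a, (k, FCap), ?a, ?a]"
        by (rule ceq_sub_at[OF ceq_sym[OF ceq_idem[OF pa]], where c = k and b = 0 and u = ?w
              and v = "[]"]) (use a pb gb in auto)
      also have "ceq s ?k ?k \<dots> [(k, FCup), ?a, ?g, ?a, ?c, (k, FCap), ?a]"
        by (rule ceq_sub[OF ceq_sym[OF ceq_exch], where l = "Suc (Suc ?k)" and l' = ?k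
              and u = "[(k, FCup), ?a, ?g, ?a]" and v = "[?a]"]) (use a pb gb in auto)
      also have "ceq s ?k ?k \<dots> [(k, FCup), ?a, ?g, ?c, ?a, (k, FCap), ?a]"
        by (rule ceq_sub[OF ceq_sym[OF ceq_exch], where l = "Suc (Suc ?k)" and l' = "Suc (Suc ?k)"
              and u = "[(k, FCup), ?a, ?g]" and v = "[(k, FCap), ?a]"]) (use a pb gb in auto)
      also have "ceq s ?k ?k \<dots> [(k, FCup), ?a, ?g, (Suc k, FBox 1 ?b), (Suc k, FCap), ?a, ?a]"
        by (rule ceq_sub_at[OF ceq_swallow_cap[OF c], where c = k and b = 0
              and u = "[(k, FCup), ?a, ?g]" and v = "[?a]"]) (use a pb gb in \<open>auto simp: shade_at_Suc\<close>)
      also have "ceq s ?k ?k \<dots> [(k, FCup), ?a, (Suc k, FBox 1 ?b), ?g, (Suc k, FCap), ?a, ?a]"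
        by (rule ceq_sub[OF ceq_sym[OF ceq_exch], where l = "Suc (Suc ?k)" and l' = "Suc (Suc ?k)"
              and u = "[(k, FCup), ?a]" and v = "[(Suc k, FCap), ?a, ?a]"])
          (use a pb gb in \<open>auto simp: shade_at_Suc\<close>)
      also have "ceq s ?k ?k \<dots> [(k, FCup), ?a, (Suc k, FBox 1 ?b), (Suc k, FCap), ?g, ?a, ?a]"
        by (rule ceq_sub[OF ceq_sym[OF ceq_exch], where l = "Suc (Suc ?k)" and l' = ?k
              and u = "[(k, FCup), ?a, (Suc k, FBox 1 ?b)]" and v = "[?a, ?a]"])
          (use a pb gb in \<open>auto simp: shade_at_Suc\<close>)
      also have "ceq s ?k ?k \<dots> [(k, FCup), ?a, (Suc k, FCap), ?g, ?a, ?a]"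
        by (rule ceq_sub_at[OF cup_absorb[OF pa], where c = k and b = 1 and u = "[]"
              and v = "[(Suc k, FCap), ?g, ?a, ?a]"]) (use a pb gb in \<open>auto simp: shade_at_Suc\<close>)
      also have "ceq s ?k ?k \<dots> [(k, FCup), (Suc k, FCap), ?a, ?g, ?a, ?a]"
        by (rule ceq_sub[OF ceq_sym[OF ceq_exch], where l = "Suc (Suc ?k)" and l' = ?k
              and u = "[(k, FCup)]" and v = "[?g, ?a, ?a]"]) (use a pb gb in auto)
      also have "ceq s ?k ?k \<dots> [?a, ?g, ?a, ?a]"
        by (rule ceq_sub[OF ceq_zigzag1[of k ?k], where u = "[]" and v = "[?a, ?g, ?a, ?a]"])
          (use a pb gb in auto)
      also have "ceq s ?k ?k \<dots> [?g, ?a, ?a]"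
        by (rule ceq_sub[OF abs(1), where u = "[]" and v = "[?a, ?a]"]) (use a pb gb in auto)
      also have "ceq s ?k ?k \<dots> [?g, ?a]"
        by (rule ceq_sub[OF abs(2), where u = "[]" and v = "[?a]"]) (use a pb gb in auto)
      also have "ceq s ?k ?k \<dots> [?g]"
        by (rule abs(2))
      finally show "ceq s ?k ?k (?w @ [?a]) [?g]" .
    qed
    also have "\<dots> = g"
      using val_bend[OF gH(1)] by (simp add: bend_square)
    finally have "g = ten s k (scale A d p) a"
      by (simp add: d)
    also have "\<dots> = scale A d ?q"
    proof -
      have "add_right s k k (scale A d p) = scale A d (add_right s k k p)"
        using val_scale[of s ?k "[]" 0 k p "[]" ?k d] pb by (simp add: add_right_def bend_square)
      then show ?thesis
        using p' a by (simp add: ten_def cmp_scale_left)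
    qed
    finally show ?thesis ..
  qed
  ultimately show ?thesis
    using q by (simp add: minimal_def)
qed

end

section \<open>Principal graphs\<close>

lemma finite_range_periodic:
  fixes f :: "int \<Rightarrow> 'b"
  assumes d: "d > 0" and f: "\<And>m. f (m + d) = f m"
  shows "finite (range f)"
proof -
  have step: "f (m + d * int k) = f m" for m k
  proof (induction k)
    case (Suc k)
    have "f (m + d * int (Suc k)) = f ((m + d * int k) + d)"
      by (simp add: algebra_simps)
    then show ?case
      by (simp only: f Suc)
  qed simp
  have mult: "f (m + d * q) = f m" for m q
  proof (cases "q \<ge> 0")
    case True
    then show ?thesis
      using step[of m "nat q"] by simp
  next
    case False
    then show ?thesis
      using step[of "m + d * q" "nat (- q)"] by simp
  qed
  have "f m \<in> f ` {0..<d}" for m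
    using mult[of "m mod d" "m div d"] d by (intro image_eqI[of _ _ "m mod d"]) simp_all
  then have "range f \<subseteq> f ` {0..<d}"
    by blast
  then show ?thesis
    using finite_surj by blast
qed

context subfactor_planar_algebra
begin

lemma minimal_empty: "minimal s 0 (ident s 0)"
proof -
  have "\<exists>c. f = scale A c (ident s 0)" if "f \<in> phom s 0 (ident s 0) 0 (ident s 0)" for f
    using scale_scalar[of f s] phomD(1)[OF that] by (auto simp: hom_square)
  then show ?thesis
    using ident_0_nonzero by (auto simp: minimal_def proj_def)
qed

lemma hom_dim_minimal:
  assumes p: "minimal s m p" and q: "minimal s n q"
  shows "hom_dim A s (m, p) (n, q) = (if iso s m p n q then 1 else 0)"
proof (cases "even (m + n)")
  case True
  have pq: "proj s m p" "proj s n q" "p \<noteq> 0"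
    using p q by (auto simp: minimal_def)
  have dim: "hom_dim A s (m, p) (n, q) = vs.dim (phom s m p n q)"
    unfolding hom_dim_def Hom_eq[OF pq(1,2) True] ..
  show ?thesis
  proof (cases "iso s m p n q")
    case iso: True
    then obtain f where f: "f \<in> phom s m p n q" "cmp s m n m f (dag s m n f) = p"
      by (auto simp: iso_def)
    have "f \<noteq> 0"
      using f pq(3) cmp_zero_left[OF dag_in[OF phomD(1)[OF f(1)]], of m] True
      by (auto simp: add.commute)
    then have "vs.dim (phom s m p n q) = 1"
      using dim_eq_1_iff[OF phom_subspace[OF pq(1,2) True]] schur(2)[OF p q f(1)] f(1) by blast
    then show ?thesis
      using dim iso by simp
  next
    case False
    then have "phom s m p n q = {0}"
      using schur(1)[OF p q] vs.subspace_0[OF phom_subspace[OF pq(1,2) True]] by blast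
    then show ?thesis
      using dim False dim_zero by simp
  qed
next
  case False
  then show ?thesis
    by (auto simp: hom_dim_def dim_zero iso_def dest!: phomD(1) hom_even)
qed

lemma hom_dim_iso_left:
  assumes p: "proj s m p" "proj s m' p'" "iso s m p m' p'" and q: "proj s n q"
  shows "hom_dim A s (m', p') (n, q) = hom_dim A s (m, p) (n, q)"
proof -
  obtain t where t: "t \<in> phom s m p m' p'" "cmp s m m' m t (dag s m m' t) = p"
      "cmp s m' m m' (dag s m m' t) t = p'"
    using p(3) by (auto simp: iso_def)
  note tH = phomD[OF t(1)]
  have par: "even (m + m')"
    by (rule hom_even[OF tH(1)])
  show ?thesis
  proof (cases "even (m + n)")
    case True
    then have even: "even (m' + n)"
      using par by presburger
    have t': "dag s m m' t \<in> phom s m' p' m p"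
      by (rule dag_phom[OF t(1) p(1,2)])
    let ?\<phi> = "\<lambda>f. cmp s m' m n (dag s m m' t) f"
    have inv: "cmp s m m' n t (?\<phi> f) = f" if "f \<in> phom s m p n q" for f
      using phomD[OF that] t tH(1) by (simp flip: cmp_assoc)
    have "vs.dim (phom s m' p' n q) = vs.dim (phom s m p n q)"
    proof (rule dim_bij[OF phom_subspace[OF p(1) q True]])
      show "?\<phi> ` phom s m p n q = phom s m' p' n q"
      proof (intro equalityI subsetI)
        fix g
        assume g: "g \<in> phom s m' p' n q"
        have "?\<phi> (cmp s m m' n t g) = g"
          using phomD[OF g] t tH(1) by (simp flip: cmp_assoc)
        then show "g \<in> ?\<phi> ` phom s m p n q"
          using cmp_phom[OF t(1) g p(1) q] by force
      qed (use cmp_phom[OF t' _ p(2) q] in blast)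
      show "inj_on ?\<phi> (phom s m p n q)"
        by (rule inj_onI) (use inv in metis)
    qed (use tH(1) in \<open>auto simp: cmp_add_right cmp_scale_right dest!: phomD(1)\<close>)
    then show ?thesis
      unfolding hom_dim_def Hom_eq[OF p(1) q True] Hom_eq[OF p(2) q even] .
  next
    case False
    then have "odd (m' + n)"
      using par by presburger
    then show ?thesis
      using False by (simp add: hom_dim_def)
  qed
qed

lemma hom_dim_iso_right:
  assumes p: "proj s m p" and q: "proj s n q" "proj s n' q'" "iso s n q n' q'"
  shows "hom_dim A s (m, p) (n', q') = hom_dim A s (m, p) (n, q)"
proof -
  obtain t where t: "t \<in> phom s n q n' q'" "cmp s n n' n t (dag s n n' t) = q"
      "cmp s n' n n' (dag s n n' t) t = q'"
    using q(3) by (auto simp: iso_def)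
  note tH = phomD[OF t(1)]
  have par: "even (n + n')"
    by (rule hom_even[OF tH(1)])
  show ?thesis
  proof (cases "even (m + n)")
    case True
    then have even: "even (m + n')"
      using par by presburger
    have t': "dag s n n' t \<in> phom s n' q' n q"
      by (rule dag_phom[OF t(1) q(1,2)])
    let ?\<phi> = "\<lambda>f. cmp s m n n' f t"
    have inv: "cmp s m n' n (?\<phi> f) (dag s n n' t) = f" if "f \<in> phom s m p n q" for f
      using phomD[OF that] t tH(1) by (simp add: cmp_assoc)
    have "vs.dim (phom s m p n' q') = vs.dim (phom s m p n q)"
    proof (rule dim_bij[OF phom_subspace[OF p(1) q(1) True]])
      show "?\<phi> ` phom s m p n q = phom s m p n' q'"
      proof (intro equalityI subsetI)
        fix g
        assume g: "g \<in> phom s m p n' q'"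
        have "?\<phi> (cmp s m n' n g (dag s n n' t)) = g"
          using phomD[OF g] t tH(1) by (simp add: cmp_assoc)
        then show "g \<in> ?\<phi> ` phom s m p n q"
          using cmp_phom[OF g t' p q(1)] by force
      qed (use cmp_phom[OF _ t(1) p q(2)] in blast)
      show "inj_on ?\<phi> (phom s m p n q)"
        by (rule inj_onI) (use inv in metis)
    qed (use tH(1) in \<open>auto simp: cmp_add_left cmp_scale_left dest!: phomD(1)\<close>)
    then show ?thesis
      unfolding hom_dim_def Hom_eq[OF p q(1) True] Hom_eq[OF p q(2) even] .
  next
    case False
    then have "odd (m + n')"
      using par by presburger
    then show ?thesis
      using False by (simp add: hom_dim_def)
  qed
qed

lemma proj_ident: "proj s k (ident s k)"
  by (simp add: proj_def)

lemma ten_ident: "p \<in> hom s k k \<Longrightarrow> ten s k p (ident (shade_at s k) 1) = add_right s k k p"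
  unfolding ten_def on_last_ident by simp

lemma iso_even: "iso s m x n y \<Longrightarrow> even (m + n)"
  by (auto simp: iso_def phom_def hom_def)

lemma iso_add_right:
  assumes "proj s m p" "proj s n q" "iso s m p n q"
  shows "iso s (Suc m) (add_right s m m p) (Suc n) (add_right s n n q)"
proof -
  have "shade_at s n = shade_at s m"
    using iso_even[OF assms(3)] by (intro shade_at_parity) (simp add: add.commute)
  then show ?thesis
    using iso_ten[OF assms proj_ident] ten_ident[OF projD(1)[OF assms(1)]] ten_ident[OF projD(1)[OF assms(2)]]
    by simp
qed

lemma mem_iso_class:
  assumes "minimal s m p"
  shows "(n, q) \<in> iso_class A s (m, p) \<longleftrightarrow> minimal s n q \<and> iso s m p n q"
  using assms isomorphic_iff[of s m p n q] unfolding iso_class_def mem_Collect_eq minimal_iff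
  by (auto simp: minimal_def simp del: isomorphic.simps)

lemma iso_class_eq_iff:
  assumes p: "minimal s m p" and q: "minimal s n q"
  shows "iso_class A s (m, p) = iso_class A s (n, q) \<longleftrightarrow> iso s m p n q"
proof
  have pq: "proj s m p" "proj s n q"
    using p q by (auto simp: minimal_def)
  {
    assume "iso_class A s (m, p) = iso_class A s (n, q)"
    moreover have "(n, q) \<in> iso_class A s (n, q)"
      using mem_iso_class[OF q, of n q] q iso_refl[OF pq(2)] by simp
    ultimately show "iso s m p n q"
      using mem_iso_class[OF p, of n q] by simp
  }
  assume iso: "iso s m p n q"
  show "iso_class A s (m, p) = iso_class A s (n, q)"
  proof (intro set_eqI)
    fix z :: "nat \<times> 'a"
    obtain l r where z: "z = (l, r)"
      by force
    show "z \<in> iso_class A s (m, p) \<longleftrightarrow> z \<in> iso_class A s (n, q)"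
      unfolding z mem_iso_class[OF p] mem_iso_class[OF q]
      using iso iso_sym[OF pq iso] iso_trans[OF pq, of l r] iso_trans[OF pq(2,1), of l r]
      by (auto simp: minimal_def)
  qed
qed

text \<open>
  The edge count of the principal graph is a value of \<open>the_elem\<close>; invariance of dimensions under
  isomorphism in both arguments shows that it is applied to a singleton.
\<close>

lemma edges_eq:
  assumes p: "minimal s m p" and q: "minimal s n q"
  shows "snd (principal_graph A s) (iso_class A s (m, p)) (iso_class A s (n, q))
    = hom_dim A s (Suc m, add_right s m m p) (n, q)"
proof -
  have pq: "proj s m p" "proj s n q"
    using p q by (auto simp: minimal_def)
  let ?d = "hom_dim A s (Suc m, add_right s m m p) (n, q)"
  have "hom_dim A s (add_strand A s (m', p')) (n', q') = ?d"
    if "(m', p') \<in> iso_class A s (m, p)" "(n', q') \<in> iso_class A s (n, q)" for m' p' n' q'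
  proof -
    have "iso s m p m' p'" "iso s n q n' q'" and pq': "proj s m' p'" "proj s n' q'"
      using that mem_iso_class[OF p, of m' p'] mem_iso_class[OF q, of n' q']
      by (auto simp: minimal_def)
    then show ?thesis
      using hom_dim_iso_left[OF add_right_proj[OF pq(1)] add_right_proj[OF pq'(1)] iso_add_right[OF pq(1) pq'(1)] pq'(2)]
        hom_dim_iso_right[OF add_right_proj[OF pq(1)] pq(2) pq'(2)]
      by (simp add: add_strand_eq[OF projD(1)[OF pq'(1)]] del: add_strand.simps)
  qed
  moreover have "(m, p) \<in> iso_class A s (m, p)" "(n, q) \<in> iso_class A s (n, q)"
    using mem_iso_class[OF p, of m p] mem_iso_class[OF q, of n q] p q iso_refl pq by auto
  ultimately have "(\<lambda>(x, y). hom_dim A s (add_strand A s x) y)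
      ` (iso_class A s (m, p) \<times> iso_class A s (n, q)) = {?d}"
    by (auto simp del: add_strand.simps) (force simp del: add_strand.simps)
  then show ?thesis
    by (simp add: principal_graph_def del: add_strand.simps)
qed

end

section \<open>The path of alternating products\<close>

text \<open>
  Two colours that add up to the strand. The tensor factors of the vertices depend on the parity of
  the position only: \<open>up k\<close> and \<open>dn k\<close> are the colours by which a vertex at level \<open>k\<close> has to be
  multiplied to move one step up or down the path. For positive positions, moving down cancels
  the last factor; for negative ones, moving up does.
\<close>

locale coloured = subfactor_planar_algebra A
  for A :: "'a::ab_group_add planar_structure" +
  fixes s :: shading and a b :: 'a
  assumes a: "colour s a" and b: "colour s b" and ab: "a + b = ident s 1"
begin

abbreviation a' where "a' \<equiv> rot s a"
abbreviation b' where "b' \<equiv> rot s b"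

definition up :: "nat \<Rightarrow> 'a" where "up k = (if even k then a else b')"
definition dn :: "nat \<Rightarrow> 'a" where "dn k = (if even k then b else a')"

definition vertex :: "int \<Rightarrow> nat \<times> 'a" where
  "vertex = two_sided_alternating A s a b' b a'"

abbreviation level :: "int \<Rightarrow> nat" where "level n \<equiv> nat \<bar>n\<bar>"

definition vproj :: "int \<Rightarrow> 'a" where "vproj n = snd (vertex n)"

lemma vertex_eq: "vertex n = (level n, vproj n)"
  by (simp add: vertex_def vproj_def two_sided_alternating_def)

lemma colours_in_box: "a \<in> box_space A 1 s" "b \<in> box_space A 1 s"
  using a b proj_1 by (auto simp: colour_def)

lemma colour_up: "colour (shade_at s k) (up k)" and colour_dn: "colour (shade_at s k) (dn k)"
  using a b colour_rot by (auto simp: up_def dn_def shade_at_def)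

lemma proj_up: "proj (shade_at s k) 1 (up k)" and proj_dn: "proj (shade_at s k) 1 (dn k)"
  using colour_up colour_dn by (auto simp: colour_def)

lemma rot_up: "rot (shade_at s k) (up k) = dn (Suc k)" and rot_dn: "rot (shade_at s k) (dn k) = up (Suc k)"
  using rot_rot[OF colours_in_box(1)] rot_rot[OF colours_in_box(2)] by (auto simp: up_def dn_def shade_at_def)

lemma up_dn: "up k + dn k = ident (shade_at s k) 1"
proof (cases "even k")
  case True
  then show ?thesis
    using ab by (simp add: up_def dn_def shade_at_def)
next
  case False
  have "rot s (a + b) = rot s a + rot s b"
    unfolding rot_def using val_add[of "opposite s" 1 "[(0, FCup)]" 1 1 a "[(1, FCap)]" 1 b] colours_in_box by simp
  moreover have "rot s (ident s 1) = ident (opposite s) 1"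
  proof -
    have "ceq (opposite s) 1 1 [(0, FCup), (1, FBox 1 (ident s 1)), (1, FCap)] [(0, FCup), (1, FCap)]"
      by (rule ceq_sub_at[OF ceq_bend_val[of s 1 "[]" 1], where c = 1 and b = 1 and u = "[(0, FCup)]"
            and v = "[(1, FCap)]"]) (auto simp: ident_def bend_square)
    also have "ceq (opposite s) 1 1 [(0, FCup), (1, FCap)] []"
      using ceq_zigzag1[of 0 1] by simp
    finally show ?thesis
      unfolding rot_def ident_def[of "opposite s"] by (rule val_cong)
  qed
  ultimately show ?thesis
    using False ab by (simp add: up_def dn_def shade_at_def add.commute)
qed

lemma alternating_Suc:
  assumes "proj s 1 c" "proj (opposite s) 1 d"
  shows "proj s k (alternating A s c d k) \<and>
    alternating A s c d (Suc k) = ten s k (alternating A s c d k) (if even k then c else d)"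
proof (induction k)
  case 0
  have "val s 1 1 [(0, FBox 1 c)] = c"
    using val_bend[OF projD(1)[OF assms(1)]] by (simp add: bend_square)
  then have "on_last s 0 c = c"
    by (simp add: on_last_def)
  then show ?case
    using projD(1)[OF assms(1)] by (simp add: empty_diagram_eq proj_ident ten_def)
next
  case (Suc k)
  have pr: "proj (shade_at s k) 1 (if even k then c else d)" for k
    using assms by (auto simp: shade_at_def)
  have "proj s (Suc k) (alternating A s c d (Suc k))"
    using proj_ten[of s k _ "if even k then c else d"] Suc pr[of k] by simp
  then show ?case
    using ten_tensor[of "alternating A s c d (Suc k)" s "Suc k" "if even k then d else c"]
      pr[of "Suc k"] projD(1) proj_1(1) by auto
qed

lemma vproj_0: "vproj 0 = ident s 0"
  by (simp add: vproj_def vertex_def two_sided_alternating_def empty_diagram_eq)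

lemma vproj_up: "n \<ge> 0 \<Longrightarrow> vproj (n + 1) = ten s (level n) (vproj n) (up (level n))"
  using alternating_Suc[of a b' "nat n"] a b proj_rot
  by (simp add: vproj_def vertex_def two_sided_alternating_def up_def nat_add_distrib colour_def)

lemma vproj_dn:
  assumes "n \<le> 0"
  shows "vproj (n - 1) = ten s (level n) (vproj n) (dn (level n))"
proof -
  have "nat (1 - n) = Suc (nat (- n))"
    using assms by simp
  then show ?thesis
    using alternating_Suc[of b a' "nat (- n)"] a b proj_rot assms
    by (cases "n = 0") (auto simp: vproj_def vertex_def two_sided_alternating_def dn_def colour_def)
qed

lemma minimal_vproj: "minimal s (level n) (vproj n)"
proof -
  have pos: "minimal s (level (int k)) (vproj (int k))" for k
  proof (induction k)
    case (Suc k)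
    have 1: "level (int (Suc k)) = Suc (level (int k))"
      by simp
    have 2: "vproj (int (Suc k)) = ten s (level (int k)) (vproj (int k)) (up (level (int k)))"
      using vproj_up[of "int k"] by (simp add: add.commute)
    show ?case
      unfolding 1 2 by (rule minimal_ten[OF Suc colour_up])
  qed (simp add: vproj_0 minimal_empty)
  have neg: "minimal s (level (- int k)) (vproj (- int k))" for k
  proof (induction k)
    case (Suc k)
    have 1: "level (- int (Suc k)) = Suc (level (- int k))"
      by simp
    have neg: "- int (Suc k) = - int k - 1"
      by simp
    have 2: "vproj (- int (Suc k)) = ten s (level (- int k)) (vproj (- int k)) (dn (level (- int k)))"
      unfolding neg by (rule vproj_dn) simp
    show ?case
      unfolding 1 2 by (rule minimal_ten[OF Suc colour_dn])
  qed (simp add: vproj_0 minimal_empty)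
  show ?thesis
    using pos[of "nat n"] neg[of "nat (- n)"] by (cases "n \<ge> 0") auto
qed

lemma proj_vproj: "proj s (level n) (vproj n)"
  using minimal_vproj by (simp add: minimal_def)

lemma iso_up: "iso s (Suc (level n)) (ten s (level n) (vproj n) (up (level n))) (level (n + 1)) (vproj (n + 1))"
proof (cases "n \<ge> 0")
  case True
  then have level: "level (n + 1) = Suc (level n)"
    by simp
  show ?thesis
    using iso_refl[OF proj_vproj[of "n + 1"]] unfolding vproj_up[OF True] level .
next
  case False
  then have n: "level n = Suc (level (n + 1))" "n + 1 \<le> 0"
    by simp_all
  have pn: "vproj n = ten s (level (n + 1)) (vproj (n + 1)) (dn (level (n + 1)))"
    using vproj_dn[OF n(2)] by simp
  show ?thesis
    using iso_cancel[OF proj_vproj[of "n + 1"] colour_dn] unfolding rot_dn n(1) pn .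
qed

lemma iso_dn: "iso s (Suc (level n)) (ten s (level n) (vproj n) (dn (level n))) (level (n - 1)) (vproj (n - 1))"
proof (cases "n \<le> 0")
  case True
  then have level: "level (n - 1) = Suc (level n)"
    by simp
  show ?thesis
    using iso_refl[OF proj_vproj[of "n - 1"]] unfolding vproj_dn[OF True] level .
next
  case False
  then have n: "level n = Suc (level (n - 1))" "n - 1 \<ge> 0"
    by simp_all
  have pn: "vproj n = ten s (level (n - 1)) (vproj (n - 1)) (up (level (n - 1)))"
    using vproj_up[OF n(2)] by simp
  show ?thesis
    using iso_cancel[OF proj_vproj[of "n - 1"] colour_up] unfolding rot_up n(1) pn .
qed

lemma up_parity: "even (k + l) \<Longrightarrow> up k = up l" and dn_parity: "even (k + l) \<Longrightarrow> dn k = dn l"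
  by (auto simp: up_def dn_def)

lemma iso_vproj_shift:
  assumes "iso s (level i) (vproj i) (level j) (vproj j)"
  shows "iso s (level (i + 1)) (vproj (i + 1)) (level (j + 1)) (vproj (j + 1))"
    "iso s (level (i - 1)) (vproj (i - 1)) (level (j - 1)) (vproj (j - 1))"
proof -
  have par: "even (level i + level j)"
    using iso_even[OF assms] .
  have t: "shade_at s (level j) = shade_at s (level i)"
    by (rule shade_at_parity) (use par in \<open>simp add: add.commute\<close>)
  note pr = proj_vproj[of i] proj_vproj[of j]
  have "iso s (Suc (level i)) (ten s (level i) (vproj i) (up (level i))) (Suc (level j)) (ten s (level j) (vproj j) (up (level j)))"
    using iso_ten[OF pr assms proj_up] up_parity[OF par] by simp
  note 1 = iso_trans[OF _ _ _ iso_trans[OF _ _ _ iso_sym[OF _ _ iso_up] this] iso_up]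
  show "iso s (level (i + 1)) (vproj (i + 1)) (level (j + 1)) (vproj (j + 1))"
    by (rule 1) (simp_all add: proj_vproj proj_ten[OF proj_vproj proj_up])
  have "iso s (Suc (level i)) (ten s (level i) (vproj i) (dn (level i))) (Suc (level j)) (ten s (level j) (vproj j) (dn (level j)))"
    using iso_ten[OF pr assms proj_dn] dn_parity[OF par] by simp
  note 2 = iso_trans[OF _ _ _ iso_trans[OF _ _ _ iso_sym[OF _ _ iso_dn] this] iso_dn]
  show "iso s (level (i - 1)) (vproj (i - 1)) (level (j - 1)) (vproj (j - 1))"
    by (rule 2) (simp_all add: proj_vproj proj_ten[OF proj_vproj proj_dn])
qed

lemma iso_vproj_period:
  assumes "iso s (level i) (vproj i) (level j) (vproj j)"
  shows "iso s (level (i + m)) (vproj (i + m)) (level (j + m)) (vproj (j + m))"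
proof (induction m rule: int_induct[where k = 0])
  case (step1 m)
  then show ?case
    using iso_vproj_shift(1)[OF step1(2)] by (simp add: add.assoc)
next
  case (step2 m)
  then show ?case
    using iso_vproj_shift(2)[OF step2(2)] by (simp add: add_diff_eq)
qed (use assms in simp)

text \<open>
  This expresses without sums over words that the strands decompose into the projections \<open>vproj i\<close>.
  In the induction step, \<open>f\<close> is nonzero on one colour of the last strand; that strand is bent to the top,
  the induction hypothesis is applied, and the resulting diagram tensored with the colour starts at a
  projection isomorphic to a neighbour of \<open>vproj i\<close>.
\<close>

lemma vproj_detects:
  assumes "f \<in> hom s k n" "f \<noteq> 0"
  shows "\<exists>i g. g \<in> hom s (level i) k \<and> cmp s (level i) (level i) k (vproj i) g = g \<and> cmp s (level i) k n g f \<noteq> 0"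
  using assms
proof (induction k arbitrary: n f)
  case 0
  then show ?case
    using cmp_ident(2)[OF 0(1)] by (intro exI[of _ 0] exI[of _ "ident s 0"]) (simp add: vproj_0)
next
  case (Suc k)
  let ?k = "Suc k"
  have ud: "up k \<in> box_space A 1 (shade_at s k)" "dn k \<in> box_space A 1 (shade_at s k)"
    using proj_1(1) proj_up proj_dn by blast+
  have "f = cmp s ?k ?k n (on_last s k (up k) + on_last s k (dn k)) f"
    using Suc.prems(1) on_last_add[OF ud] on_last_ident[of s k] up_dn by simp
  also have "\<dots> = cmp s ?k ?k n (on_last s k (up k)) f + cmp s ?k ?k n (on_last s k (dn k)) f"
    using Suc.prems(1) ud by (simp add: cmp_add_left)
  finally obtain c where c: "c = up k \<or> c = dn k" "cmp s ?k ?k n (on_last s k c) f \<noteq> 0"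
    using Suc.prems(2) by (metis add_0)
  have cb: "c \<in> box_space A 1 (shade_at s k)" "proj (shade_at s k) 1 c"
    using c(1) ud proj_up proj_dn by auto
  define g where "g = cmp s ?k ?k n (on_last s k c) f"
  have g: "g \<in> hom s ?k n" "g \<noteq> 0"
    using Suc.prems(1) cb c(2) by (simp_all add: g_def)
  let ?w = "[(k, FCup)] @ bend ?k n g"
  have wB: "wt s ?k (bend ?k n g) n"
    by (rule wt_bend[OF g(1)])
  have w: "wt s k ?w (Suc n)"
    using wt_Suc[OF wB] by simp
  define F where "F = val s k (Suc n) ?w"
  have F: "F \<in> hom s k (Suc n)"
    unfolding F_def by (rule val_in_hom[OF w])
  have par: "even (k + Suc n)"
    using hom_even[OF F] .
  \<comment> \<open>bending the last strand is invertible\<close>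
  have "F \<noteq> 0"
  proof
    assume "F = 0"
    have "ceq s ?k n ([(k, FCup)] @ (bend ?k n g @ [(n, FCap)])) ([(k, FCup)] @ ([(?k, FCap)] @ bend ?k n g))"
    proof (rule ceq_append[OF ceq_refl])
      show "ceq s (?k + 2) n (bend ?k n g @ [(n, FCap)]) ([(?k, FCap)] @ bend ?k n g)"
        using ceq_interchange[OF wB, of 2 "[(0, FCap)]" 0] by simp
    qed simp
    also have "ceq s ?k n \<dots> (bend ?k n g)"
      by (rule ceq_sub[OF ceq_zigzag1[of k ?k], where u = "[]" and v = "bend ?k n g"]) (use wB in auto)
    finally have "val s ?k n (?w @ [(n, FCap)]) = g"
      using val_bend[OF g(1)] val_cong by simp
    moreover have "val s ?k n (?w @ [(n, FCap)])
        = cmp s ?k (Suc (Suc n)) n (add_right s k (Suc n) F) (val s (Suc (Suc n)) n [(n, FCap)])"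
      unfolding F_def add_right_val[OF w] by (rule val_append[OF wt_Suc[OF w]]) simp
    moreover have "val s (Suc (Suc n)) n [(n, FCap)] \<in> hom s (Suc (Suc n)) n"
      by (rule val_in_hom) simp
    ultimately show False
      using \<open>F = 0\<close> g(2) par add_right_zero[of k "Suc n" s] by (simp add: cmp_zero_left)
  qed
  from Suc.IH[OF F this] obtain i x where x: "x \<in> hom s (level i) k"
      "cmp s (level i) (level i) k (vproj i) x = x" "cmp s (level i) k (Suc n) x F \<noteq> 0"
    by blast
  let ?i = "level i"
  have pi: "even (?i + k)"
    using hom_even[OF x(1)] .
  then have t: "shade_at s ?i = shade_at s k"
    by (rule shade_at_parity)
  have wx: "wt s ?i (bend ?i k x) k"
    by (rule wt_bend[OF x(1)])
  have Txg: "cmp s (Suc ?i) ?k n (add_right s ?i k x) g \<noteq> 0"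
  proof
    assume 0: "cmp s (Suc ?i) ?k n (add_right s ?i k x) g = 0"
    have word: "wt s (Suc ?i) (bend ?i k x @ bend ?k n g) n"
      by (rule wt_appendI[OF wt_Suc[OF wx] wB])
    have "val s (Suc ?i) n (bend ?i k x @ bend ?k n g) = cmp s (Suc ?i) ?k n (add_right s ?i k x) g"
      unfolding add_right_def val_append[OF wt_Suc[OF wx] wB] val_bend[OF g(1)] ..
    then have zero: "val s (Suc (Suc ?i)) (Suc n) (bend ?i k x @ bend ?k n g) = 0"
      using add_right_val[OF word] 0 add_right_zero[of "Suc ?i" n s] wt_parity[OF word] by simp
    have cup: "wt s ?i [(?i, FCup)] (Suc (Suc ?i))"
      by simp
    have "cmp s ?i k (Suc n) x F = val s ?i (Suc n) (bend ?i k x @ ?w)"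
      unfolding F_def val_append[OF wx w] val_bend[OF x(1)] ..
    also have "\<dots> = val s ?i (Suc n) ([(?i, FCup)] @ (bend ?i k x @ bend ?k n g))"
    proof (rule val_cong)
      have "ceq s ?i (Suc ?k) (bend ?i k x @ [(k, FCup)]) ([(?i, FCup)] @ bend ?i k x)"
        using ceq_interchange[OF wx, of 0 "[(0, FCup)]" 2] by simp
      from ceq_append[OF this ceq_refl[OF wt_Suc[OF wB]]]
      show "ceq s ?i (Suc n) (bend ?i k x @ ?w) ([(?i, FCup)] @ (bend ?i k x @ bend ?k n g))"
        by simp
    qed
    also have "\<dots> = cmp s ?i (Suc (Suc ?i)) (Suc n) (val s ?i (Suc (Suc ?i)) [(?i, FCup)]) 0"
      unfolding val_append[OF cup wt_Suc[OF word]] zero ..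
    also have "\<dots> = 0"
      using cmp_zero_right[OF val_in_hom[OF cup], of "Suc n"] wt_parity[OF word] by simp
    finally show False
      using x(3) by simp
  qed
  let ?q = "ten s ?i (vproj i) c"
  let ?y = "cmp s (Suc ?i) (Suc ?i) ?k (on_last s ?i c) (add_right s ?i k x)"
  have ci: "c \<in> box_space A 1 (shade_at s ?i)" "proj (shade_at s ?i) 1 c"
    using cb t by simp_all
  have q: "proj s (Suc ?i) ?q"
    by (rule proj_ten[OF proj_vproj ci(2)])
  have y: "?y \<in> hom s (Suc ?i) ?k"
    using ci x by simp
  have y': "?y = cmp s (Suc ?i) ?k ?k (add_right s ?i k x) (on_last s k c)"
    using add_right_on_last_commute[OF x(1) ci(1)] by simp
  have yf: "cmp s (Suc ?i) ?k n ?y f \<noteq> 0"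
    using Txg unfolding y' g_def using x(1) cb(1) Suc.prems(1) by (simp add: cmp_assoc)
  have qy: "cmp s (Suc ?i) (Suc ?i) ?k ?q ?y = ?y"
  proof -
    note on_last = on_last_idem(1)[OF ci(2)] on_last_in[OF ci(1)]
    have pT: "add_right s ?i ?i (vproj i) \<in> hom s (Suc ?i) (Suc ?i)" "add_right s ?i k x \<in> hom s (Suc ?i) ?k"
      using x projD(1)[OF proj_vproj] by auto
    have "cmp s (Suc ?i) (Suc ?i) ?k ?q ?y = cmp s (Suc ?i) (Suc ?i) ?k (on_last s ?i c)
        (cmp s (Suc ?i) (Suc ?i) ?k (add_right s ?i ?i (vproj i)) (cmp s (Suc ?i) (Suc ?i) ?k (on_last s ?i c) (add_right s ?i k x)))"
      unfolding ten_def add_right_on_last_commute[OF projD(1)[OF proj_vproj] ci(1)] using on_last pT by (simp add: cmp_assoc)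
    also have "\<dots> = cmp s (Suc ?i) (Suc ?i) ?k (on_last s ?i c)
        (cmp s (Suc ?i) (Suc ?i) ?k (cmp s (Suc ?i) (Suc ?i) (Suc ?i) (on_last s ?i c) (add_right s ?i ?i (vproj i))) (add_right s ?i k x))"
      unfolding add_right_on_last_commute[OF projD(1)[OF proj_vproj] ci(1), symmetric] using on_last pT by (simp add: cmp_assoc)
    also have "\<dots> = cmp s (Suc ?i) (Suc ?i) ?k (cmp s (Suc ?i) (Suc ?i) (Suc ?i) (on_last s ?i c) (on_last s ?i c))
        (cmp s (Suc ?i) (Suc ?i) ?k (add_right s ?i ?i (vproj i)) (add_right s ?i k x))"
      using on_last(2) pT by (simp add: cmp_assoc)
    also have "cmp s (Suc ?i) (Suc ?i) ?k (add_right s ?i ?i (vproj i)) (add_right s ?i k x) = add_right s ?i k x"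
      using add_right_cmp[OF projD(1)[OF proj_vproj] x(1)] x(2) by simp
    finally show ?thesis
      by (simp add: on_last)
  qed
  obtain j where "iso s (Suc ?i) ?q (level j) (vproj j)"
    using c(1) iso_up[of i] iso_dn[of i] up_parity[OF pi] dn_parity[OF pi] by auto
  then have "iso s (level j) (vproj j) (Suc ?i) ?q"
    by (rule iso_sym[OF q proj_vproj])
  then obtain t where t: "t \<in> phom s (level j) (vproj j) (Suc ?i) ?q"
      "cmp s (Suc ?i) (level j) (Suc ?i) (dag s (level j) (Suc ?i) t) t = ?q"
    by (auto simp: iso_def)
  note tH = phomD[OF t(1)]
  let ?z = "cmp s (level j) (Suc ?i) ?k t ?y"
  have "cmp s (level j) ?k n ?z f \<noteq> 0"
  proof
    assume 0: "cmp s (level j) ?k n ?z f = 0"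
    have "cmp s (Suc ?i) ?k n ?y f = cmp s (Suc ?i) ?k n (cmp s (Suc ?i) (Suc ?i) ?k
        (cmp s (Suc ?i) (level j) (Suc ?i) (dag s (level j) (Suc ?i) t) t) ?y) f"
      by (simp only: t(2) qy)
    also have eq: "\<dots> = cmp s (Suc ?i) (level j) n (dag s (level j) (Suc ?i) t) (cmp s (level j) ?k n ?z f)"
      using tH(1) y Suc.prems(1) by (simp add: cmp_assoc del: hom_add)
    have "even (level j + n)"
      using hom_even[OF tH(1)] hom_even[OF y] hom_even[OF Suc.prems(1)] unfolding even_add by blast
    then have "cmp s (Suc ?i) (level j) n (dag s (level j) (Suc ?i) t) (cmp s (level j) ?k n ?z f) = 0"
      unfolding 0 by (rule cmp_zero_right[OF dag_in[OF tH(1)]])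
    with calculation eq show False
      using yf by simp
  qed
  moreover have "cmp s (level j) (level j) ?k (vproj j) ?z = ?z"
    using cmp_assoc[OF projD(1)[OF proj_vproj] tH(1) y] tH(2) by simp
  ultimately show ?case
    using cmp_in[OF tH(1) y] by blast
qed

lemma minimal_iso_vproj:
  assumes "minimal s k q"
  shows "\<exists>i. iso s (level i) (vproj i) k q"
proof -
  have q: "proj s k q" "q \<noteq> 0"
    using assms by (auto simp: minimal_def)
  obtain i g where g: "g \<in> hom s (level i) k" "cmp s (level i) (level i) k (vproj i) g = g" "cmp s (level i) k k g q \<noteq> 0"
    using vproj_detects[OF projD(1)[OF q(1)] q(2)] by blast
  have "cmp s (level i) k k g q \<in> phom s (level i) (vproj i) k q"
    using g projD[OF q(1)] cmp_assoc[OF projD(1)[OF proj_vproj] g(1) projD(1)[OF q(1)]]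
    by (simp add: phom_def cmp_assoc)
  then show ?thesis
    using schur(1)[OF minimal_vproj assms] g(3) by blast
qed

end

context subfactor_planar_algebra
begin

text \<open>
  A summand of the source without diagrams to the target can be dropped. Since positions \<open>i + 1\<close> and
  \<open>i - 1\<close> are not isomorphic, one of two summands always is of this kind, so that dimensions of
  direct sums do not have to be added.
\<close>

lemma hom_dim_summand:
  assumes e: "proj s k e" "proj s k e1" "proj s k e2" "e = e1 + e2" and q: "proj s n q"
    and zero: "\<And>f. f \<in> phom s k e2 n q \<Longrightarrow> f = 0" and e1: "cmp s k k k e e1 = e1"
  shows "hom_dim A s (k, e) (n, q) = hom_dim A s (k, e1) (n, q)"
proof (cases "even (k + n)")
  case True
  have "phom s k e n q = phom s k e1 n q"
  proof (intro equalityI subsetI)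
    fix f
    assume "f \<in> phom s k e n q"
    note f = phomD[OF this]
    have "cmp s k k n e2 f \<in> phom s k e2 n q"
      using f e projD[OF e(3)] projD[OF q] cmp_assoc[OF projD(1)[OF e(3)] projD(1)[OF e(3)] f(1)]
      by (simp add: phom_def cmp_assoc)
    then have "cmp s k k n e2 f = 0"
      by (rule zero)
    then have "cmp s k k n e1 f = f"
      using f(2) cmp_add_left[OF projD(1)[OF e(2)] projD(1)[OF e(3)] f(1)] by (simp add: e(4))
    then show "f \<in> phom s k e1 n q"
      using f by (simp add: phom_def)
  next
    fix f
    assume "f \<in> phom s k e1 n q"
    note f = phomD[OF this]
    have "cmp s k k n e f = f"
      using cmp_assoc[OF projD(1)[OF e(1)] projD(1)[OF e(2)] f(1)] e1 f(2) by simp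
    then show "f \<in> phom s k e n q"
      using f by (simp add: phom_def)
  qed
  then show ?thesis
    unfolding hom_dim_def Hom_eq[OF e(1) q True] Hom_eq[OF e(2) q True] by simp
qed (simp add: hom_dim_def)

end

context coloured
begin

lemma add_right_split:
  fixes i
  defines "k \<equiv> level i"
  shows "add_right s k k (vproj i) = ten s k (vproj i) (up k) + ten s k (vproj i) (dn k)"
    "cmp s (Suc k) (Suc k) (Suc k) (add_right s k k (vproj i)) (ten s k (vproj i) (up k)) = ten s k (vproj i) (up k)"
    "cmp s (Suc k) (Suc k) (Suc k) (add_right s k k (vproj i)) (ten s k (vproj i) (dn k)) = ten s k (vproj i) (dn k)"
proof -
  have pi: "vproj i \<in> hom s k k"
    unfolding k_def by (rule projD(1)[OF proj_vproj])
  have pT: "proj s (Suc k) (add_right s k k (vproj i))"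
    unfolding k_def by (rule add_right_proj[OF proj_vproj])
  have ud: "up k \<in> box_space A 1 (shade_at s k)" "dn k \<in> box_space A 1 (shade_at s k)"
    using proj_1(1) proj_up proj_dn by blast+
  have "add_right s k k (vproj i) = ten s k (vproj i) (up k + dn k)"
    unfolding up_dn ten_ident[OF pi] ..
  also have "\<dots> = ten s k (vproj i) (up k) + ten s k (vproj i) (dn k)"
    unfolding ten_def on_last_add[OF ud] by (rule cmp_add_right) (use pi ud in auto)
  finally show "add_right s k k (vproj i) = ten s k (vproj i) (up k) + ten s k (vproj i) (dn k)" .
  show "cmp s (Suc k) (Suc k) (Suc k) (add_right s k k (vproj i)) (ten s k (vproj i) (up k)) = ten s k (vproj i) (up k)"
    "cmp s (Suc k) (Suc k) (Suc k) (add_right s k k (vproj i)) (ten s k (vproj i) (dn k)) = ten s k (vproj i) (dn k)"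
    unfolding ten_def using projD[OF pT] cmp_assoc[OF projD(1)[OF pT] projD(1)[OF pT] on_last_in[OF ud(1)]]
      cmp_assoc[OF projD(1)[OF pT] projD(1)[OF pT] on_last_in[OF ud(2)]] by simp_all
qed

lemma hom_dim_neighbours:
  assumes inj: "\<And>i j. iso s (level i) (vproj i) (level j) (vproj j) \<Longrightarrow> i = j"
  shows "hom_dim A s (Suc (level i), add_right s (level i) (level i) (vproj i)) (level j, vproj j) = (if \<bar>i - j\<bar> = 1 then 1 else 0)"
proof -
  let ?k = "level i"
  let ?U = "ten s ?k (vproj i) (up ?k)" and ?D = "ten s ?k (vproj i) (dn ?k)"
  have U: "minimal s (Suc ?k) ?U" and D: "minimal s (Suc ?k) ?D"
    using minimal_ten[OF minimal_vproj colour_up] minimal_ten[OF minimal_vproj colour_dn] by auto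
  then have UD: "proj s (Suc ?k) ?U" "proj s (Suc ?k) ?D"
    by (auto simp: minimal_def)
  have isoU: "iso s (Suc ?k) ?U (level j) (vproj j) \<longleftrightarrow> j = i + 1"
    using inj[of "i + 1" j] iso_up[of i] iso_trans[OF proj_vproj UD(1) proj_vproj iso_sym[OF UD(1) proj_vproj iso_up]]
    by auto
  have isoD: "iso s (Suc ?k) ?D (level j) (vproj j) \<longleftrightarrow> j = i - 1"
    using inj[of "i - 1" j] iso_dn[of i] iso_trans[OF proj_vproj UD(2) proj_vproj iso_sym[OF UD(2) proj_vproj iso_dn]]
    by auto
  show ?thesis
  proof (cases "j = i - 1")
    case False
    have "hom_dim A s (Suc ?k, add_right s ?k ?k (vproj i)) (level j, vproj j) = hom_dim A s (Suc ?k, ?U) (level j, vproj j)"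
      by (rule hom_dim_summand[OF add_right_proj[OF proj_vproj] UD add_right_split(1) proj_vproj _ add_right_split(2)])
        (use schur(1)[OF D minimal_vproj] isoD False in blast)
    also have "\<dots> = (if j = i + 1 then 1 else 0)"
      using hom_dim_minimal[OF U minimal_vproj] isoU by simp
    finally show ?thesis
      using False by auto
  next
    case True
    have "hom_dim A s (Suc ?k, add_right s ?k ?k (vproj i)) (level j, vproj j) = hom_dim A s (Suc ?k, ?D) (level j, vproj j)"
      by (rule hom_dim_summand[OF add_right_proj[OF proj_vproj] UD(2,1) _ proj_vproj _ add_right_split(3)])
        (use schur(1)[OF U minimal_vproj] isoU True add_right_split(1)[of i] in \<open>auto simp: add.commute\<close>)
    also have "\<dots> = 1"
      using hom_dim_minimal[OF D minimal_vproj] isoD True by simp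
    finally show ?thesis
      using True by simp
  qed
qed

text \<open>
  An isomorphism between different positions propagates along the path in both directions, so it would
  make the sequence of classes periodic, hence finite.
\<close>

theorem vertex_path:
  assumes inf: "infinite (iso_class A s ` minimal_projections A s)"
  shows "range vertex \<subseteq> minimal_projections A s"
    and "two_sided_path (principal_graph A s) (\<lambda>n. iso_class A s (vertex n))"
proof -
  let ?v = "\<lambda>n. iso_class A s (vertex n)"
  show range: "range vertex \<subseteq> minimal_projections A s"
    using minimal_vproj by (auto simp: vertex_eq minimal_iff)
  have surj: "iso_class A s ` minimal_projections A s = range ?v"
  proof
    show "range ?v \<subseteq> iso_class A s ` minimal_projections A s"
      using range by auto
    show "iso_class A s ` minimal_projections A s \<subseteq> range ?v"
    proof
      fix C
      assume "C \<in> iso_class A s ` minimal_projections A s"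
      then obtain k q where q: "minimal s k q" "C = iso_class A s (k, q)"
        by (auto simp: minimal_iff)
      then obtain i where "iso s (level i) (vproj i) k q"
        using minimal_iso_vproj by blast
      then have "?v i = C"
        using iso_class_eq_iff[OF minimal_vproj q(1)] q(2) by (simp add: vertex_eq)
      then show "C \<in> range ?v"
        by blast
    qed
  qed
  have v_eq: "?v i = ?v j \<longleftrightarrow> iso s (level i) (vproj i) (level j) (vproj j)" for i j
    unfolding vertex_eq by (rule iso_class_eq_iff[OF minimal_vproj minimal_vproj])
  have "\<not> iso s (level i) (vproj i) (level j) (vproj j)" if "i < j" for i j
  proof
    assume iso: "iso s (level i) (vproj i) (level j) (vproj j)"
    have "?v (m + (j - i)) = ?v m" for m
      using iso_vproj_period[OF iso, of "m - i"] v_eq[of m "m + (j - i)"]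
      by (simp add: add_diff_eq diff_add_eq add.commute)
    then have "finite (range ?v)"
      using finite_range_periodic[of "j - i" ?v] that by simp
    then show False
      using inf surj by simp
  qed
  then have inj: "i = j" if "iso s (level i) (vproj i) (level j) (vproj j)" for i j
    using that iso_sym[OF proj_vproj proj_vproj that] by (metis linorder_neqE)
  have "bij_betw ?v UNIV (iso_class A s ` minimal_projections A s)"
    unfolding surj bij_betw_def using v_eq inj by (auto simp: inj_on_def)
  moreover have "snd (principal_graph A s) (?v i) (?v j) = (if \<bar>i - j\<bar> = 1 then 1 else 0)" for i j
    unfolding vertex_eq edges_eq[OF minimal_vproj minimal_vproj] by (rule hom_dim_neighbours[OF inj])
  ultimately show "two_sided_path (principal_graph A s) ?v"
    by (simp add: principal_graph_def)
qed

end

section \<open>The two colours\<close>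

context subfactor_planar_algebra
begin

text \<open>
  By minimality, the adjoint of \<open>f\<close> followed by \<open>f\<close> is \<open>c q\<close> for a scalar \<open>c\<close>, which is real since the
  product is selfadjoint. The factor \<open>1 / c\<close> makes the product in the other order idempotent.
\<close>

lemma compression:
  assumes f: "f \<in> phom s m p n q" "f \<noteq> 0" and q: "minimal s n q" and p: "proj s m p"
  obtains d where "proj s m (scale A d (cmp s m n m f (dag s m n f)))"
    "scale A d (cmp s m n m f (dag s m n f)) \<noteq> 0"
proof -
  let ?g = "dag s m n f"
  have qp: "proj s n q"
    using q by (simp add: minimal_def)
  note fH = phomD[OF f(1)] dag_in[OF phomD(1)[OF f(1)]]
  have g: "?g \<in> phom s n q m p"
    by (rule dag_phom[OF f(1) p qp])
  obtain c where c: "cmp s n m n ?g f = scale A c q"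
    using q cmp_phom[OF g f(1) qp qp] by (auto simp: minimal_def)
  have "c \<noteq> 0"
  proof
    assume "c = 0"
    then have "cmp s n m n ?g (dag s n m ?g) = 0"
      using c fH by simp
    then show False
      using cmp_dag_eq_0[OF fH(4)] dag_eq_0[OF fH(1)] f(2) by blast
  qed
  have "dag s n n (cmp s n m n ?g f) = cmp s n m n ?g f"
    using fH by (simp add: dag_cmp)
  then have "scale A (cnj c) q = scale A c q"
    using projD[OF qp] by (simp add: c dag_scale)
  then have cnj: "cnj c = c"
    using q vs.scale_right_imp_eq by (auto simp: minimal_def)
  let ?P = "cmp s m n m f ?g"
  have "cmp s m m m ?P ?P = cmp s m n m f (cmp s n n m (cmp s n m n ?g f) ?g)"
    using fH by (simp add: cmp_assoc)
  also have "\<dots> = scale A c ?P"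
    unfolding c using fH projD[OF qp] phomD(2)[OF g] by (simp add: cmp_scale_left cmp_scale_right)
  finally have PP: "cmp s m m m ?P ?P = scale A c ?P" .
  have P: "?P \<in> hom s m m" "dag s m m ?P = ?P" "?P \<noteq> 0"
    using fH cmp_dag_eq_0[OF fH(1)] f(2) by (auto simp: dag_cmp)
  have "proj s m (scale A (1 / c) ?P)"
    using P PP \<open>c \<noteq> 0\<close> cnj by (simp add: proj_def cmp_scale_left cmp_scale_right dag_scale)
  moreover have "scale A (1 / c) ?P \<noteq> 0"
    using P(3) \<open>c \<noteq> 0\<close> by simp
  ultimately show thesis
    using that by blast
qed

lemma tr_ident: "loop A s = scale A (of_real \<delta>) (empty_diagram A s) \<Longrightarrow> tr s 1 (ident s 1) = of_real \<delta>"
proof -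
  assume loop: "loop A s = scale A (of_real \<delta>) (empty_diagram A s)"
  have "loop A s = val s 0 0 [(0, FCup), (0, FCap)]"
    unfolding loop_def element_def val_square by (subst act_ev) auto
  then have "val s 0 0 [(0, FCup), (0, FCap)] = scale A (of_real \<delta>) (ident s 0)"
    using loop by (simp add: empty_diagram_eq)
  moreover have "tr s 1 (ident s 1) = scalar A s (val s 0 0 (fcups 0 1 @ [] @ fcaps 0 1))"
    unfolding ident_def by (rule tr_val) simp
  ultimately show "tr s 1 (ident s 1) = of_real \<delta>"
    by (simp add: fcups_def fcaps_def scalar_scale)
qed

text \<open>
  The remainder of the strand is a projection of trace \<open>2\<close> minus two numbers that are at least \<open>1\<close>;
  as the trace of a projection is nonnegative, all bounds are attained.
\<close>

lemma orthogonal_colours: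
  assumes p: "proj s 1 a" "a \<noteq> 0" and q: "proj s 1 b" "b \<noteq> 0"
    and ab: "cmp s 1 1 1 a b = 0" and two: "tr s 1 (ident s 1) = 2"
  shows "colour s a" "colour s b" "a + b = ident s 1"
proof -
  note hom = projD[OF p(1)] projD[OF q(1)] ident_in[of s 1]
  have ba: "cmp s 1 1 1 b a = 0"
    using dag_cmp[OF hom(1,4)] ab hom dag_zero[of 1 1 s] by simp
  let ?r = "ident s 1 - (a + b)"
  have r: "?r \<in> hom s 1 1"
    using hom by simp
  have "cmp s 1 1 1 (a + b) (a + b) = a + b"
    using hom ab ba by (simp only: cmp_add_left cmp_add_right hom_add) simp
  then have rr: "cmp s 1 1 1 ?r (dag s 1 1 ?r) = ?r"
    using hom by (simp only: dag_diff dag_add dag_ident hom_add cmp_diff_left cmp_diff_right hom_diff cmp_ident) simp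
  have tr: "tr s 1 ?r = 2 - (tr s 1 a + tr s 1 b)"
    using hom by (simp only: tr_diff tr_add hom_add two)
  have ge: "Re (tr s 1 a) \<ge> 1" "Re (tr s 1 b) \<ge> 1" "tr s 1 a \<in> \<real>" "tr s 1 b \<in> \<real>"
    using tr_proj_ge_1(1) tr_proj_positive(1) p q by blast+
  have "Re (tr s 1 ?r) \<ge> 0"
    using tr_positive[OF r] tr_zero[of s 1] unfolding rr by (cases "?r = 0") auto
  then have "Re (tr s 1 a) = 1" "Re (tr s 1 b) = 1"
    using ge unfolding tr by auto
  then have one: "tr s 1 a = 1" "tr s 1 b = 1"
    using ge(3,4) by (auto simp: complex_eq_iff complex_is_Real_iff)
  then show "colour s a" "colour s b"
    using p q by (auto simp: colour_def)
  have "?r = 0"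
    using tr_positive(2)[OF r] unfolding rr tr one by auto
  then show "a + b = ident s 1"
    by simp
qed

text \<open>
  If \<open>f\<close> and \<open>g\<close> lead from the strand to the two neighbours of the empty diagram, then the adjoint of \<open>f\<close>
  followed by \<open>g\<close> is a diagram between nonisomorphic minimal projections. So it vanishes, and with it
  the product of the two compressions.
\<close>

lemma two_colours:
  assumes path: "is_A_tilde_infinity (principal_graph A s)" and two: "tr s 1 (ident s 1) = 2"
  obtains a b where "colour s a" "colour s b" "a + b = ident s 1" "cmp s 1 1 1 a b = 0"
proof -
  obtain v where v: "two_sided_path (principal_graph A s) v"
    using path by (auto simp: is_A_tilde_infinity_def)
  let ?E = "snd (principal_graph A s)"
  have bij: "bij_betw v UNIV (iso_class A s ` minimal_projections A s)"
    and E: "\<And>i j. ?E (v i) (v j) = (if \<bar>i - j\<bar> = 1 then 1 else 0)"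
    using v by (simp_all add: principal_graph_def)
  have "iso_class A s (0, ident s 0) \<in> range v"
    using bij minimal_empty by (auto simp: bij_betw_def minimal_iff)
  then obtain i where i: "v i = iso_class A s (0, ident s 0)"
    by auto
  have edge: "\<exists>n q f. v j = iso_class A s (n, q) \<and> minimal s n q \<and> f \<in> phom s 1 (ident s 1) n q \<and> f \<noteq> 0"
    if "\<bar>i - j\<bar> = 1" for j
  proof -
    have "v j \<in> iso_class A s ` minimal_projections A s"
      using bij by (auto simp: bij_betw_def)
    then obtain n q where q: "v j = iso_class A s (n, q)" "minimal s n q"
      by (auto simp: minimal_iff)
    have "hom_dim A s (1, ident s 1) (n, q) = 1"
      using E[of i j] that edges_eq[OF minimal_empty q(2)] by (simp add: i q(1))
    then have "vs.dim (Hom A s (1, ident s 1) (n, q)) = 1"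
      by (simp add: hom_dim_def)
    moreover have qp: "proj s n q"
      using q by (simp add: minimal_def)
    moreover have "even (1 + n)"
      using calculation dim_zero by (cases "even (1 + n)") auto
    ultimately have "vs.dim (phom s 1 (ident s 1) n q) = 1"
      by (simp only: Hom_eq[OF proj_ident])
    then obtain f where "f \<in> phom s 1 (ident s 1) n q" "f \<noteq> 0"
      using dim_eq_1_iff[OF phom_subspace[OF proj_ident qp \<open>even (1 + n)\<close>]] by blast
    then show ?thesis
      using q by blast
  qed
  obtain m p f where f: "v (i + 1) = iso_class A s (m, p)" "minimal s m p"
      "f \<in> phom s 1 (ident s 1) m p" "f \<noteq> 0"
    using edge[of "i + 1"] by auto
  obtain n q g where g: "v (i - 1) = iso_class A s (n, q)" "minimal s n q"
      "g \<in> phom s 1 (ident s 1) n q" "g \<noteq> 0"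
    using edge[of "i - 1"] by auto
  have pq: "proj s m p" "proj s n q"
    using f g by (simp_all add: minimal_def)
  have "v (i + 1) \<noteq> v (i - 1)"
    using bij injD[of v "i + 1" "i - 1"] by (auto simp: bij_betw_def)
  then have "\<not> iso s m p n q"
    using f(1) g(1) iso_class_eq_iff[OF f(2) g(2)] by simp
  moreover have "cmp s m 1 n (dag s 1 m f) g \<in> phom s m p n q"
    by (rule cmp_phom[OF dag_phom[OF f(3) proj_ident pq(1)] g(3) pq])
  ultimately have zero: "cmp s m 1 n (dag s 1 m f) g = 0"
    using schur(1)[OF f(2) g(2)] by blast
  obtain c where c: "proj s 1 (scale A c (cmp s 1 m 1 f (dag s 1 m f)))"
      "scale A c (cmp s 1 m 1 f (dag s 1 m f)) \<noteq> 0"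
    using compression[OF f(3,4,2) proj_ident] .
  obtain d where d: "proj s 1 (scale A d (cmp s 1 n 1 g (dag s 1 n g)))"
      "scale A d (cmp s 1 n 1 g (dag s 1 n g)) \<noteq> 0"
    using compression[OF g(3,4,2) proj_ident] .
  let ?f = "dag s 1 m f" and ?g = "dag s 1 n g"
  note hom = phomD(1)[OF f(3)] phomD(1)[OF g(3)] dag_in[OF phomD(1)[OF f(3)]] dag_in[OF phomD(1)[OF g(3)]]
  have "cmp s 1 1 1 (cmp s 1 m 1 f ?f) (cmp s 1 n 1 g ?g) = cmp s 1 m 1 f (cmp s m n 1 (cmp s m 1 n ?f g) ?g)"
    using hom by (simp only: cmp_assoc cmp_in)
  also have "\<dots> = 0"
    unfolding zero using hom_even[OF hom(1)] hom_even[OF hom(2)]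
    by (subst cmp_zero_left[OF hom(4)], simp) (rule cmp_zero_right[OF hom(1)], simp)
  finally have "cmp s 1 1 1 (scale A c (cmp s 1 m 1 f ?f)) (scale A d (cmp s 1 n 1 g ?g)) = 0"
    using hom by (simp only: cmp_scale_left cmp_scale_right cmp_in hom_scale vs.scale_zero_right)
  with orthogonal_colours[OF c d _ two] that show thesis
    by blast
qed

lemma infinite_vertices:
  assumes "is_A_tilde_infinity (principal_graph A s)"
  shows "infinite (iso_class A s ` minimal_projections A s)"
proof -
  obtain v where "bij_betw v (UNIV :: int set) (iso_class A s ` minimal_projections A s)"
    using assms by (auto simp: is_A_tilde_infinity_def principal_graph_def)
  then show ?thesis
    using bij_betw_finite infinite_UNIV_int by blast
qed

end

theorem mainTheorem15:
  fixes A :: "'a::ab_group_add planar_structure"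
  assumes "subfactor_planar_algebra A"
    and "has_index A 4"
    and "is_A_tilde_infinity (principal_graph A Unshaded)"
    and "is_A_tilde_infinity (principal_graph A Shaded)"
  shows "\<exists>P \<in> box_space A 1 Unshaded. \<exists>Q \<in> box_space A 1 Unshaded.
    bubble_relation A P Q \<and>
    strand_decomposition A P Q \<and>
    colour_disagreement A P Q \<and>
    saddle_relation A P Q \<and>
    (let P' = rotation A 1 Unshaded P; Q' = rotation A 1 Unshaded Q;
         u = two_sided_alternating A Unshaded P Q' Q P';
         v = two_sided_alternating A Shaded P' Q Q' P
     in range u \<subseteq> minimal_projections A Unshaded \<and>
        range v \<subseteq> minimal_projections A Shaded \<and>
        two_sided_path (principal_graph A Unshaded) (\<lambda>n. iso_class A Unshaded (u n)) \<and>
        two_sided_path (principal_graph A Shaded) (\<lambda>n. iso_class A Shaded (v n)))"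
proof -
  interpret subfactor_planar_algebra A
    by (rule assms(1))
  obtain \<delta> :: real where \<delta>: "\<delta> > 0" "loop A Unshaded = scale A (of_real \<delta>) (empty_diagram A Unshaded)"
      "4 = \<delta>\<^sup>2"
    using assms(2) by (auto simp: has_index_def)
  have "\<delta> = 2"
    using \<delta>(1,3) by (metis less_imp_le numeral_power_eq_of_nat_cancel_iff power2_eq_iff_nonneg
        power2_eq_square zero_le_numeral mult_2 numeral_Bit0 numeral_times_numeral)
  then have "tr Unshaded 1 (ident Unshaded 1) = 2"
    using tr_ident[OF \<delta>(2)] by simp
  from two_colours[OF assms(3) this] obtain P Q where PQ: "colour Unshaded P" "colour Unshaded Q"
      "P + Q = ident Unshaded 1" "cmp Unshaded 1 1 1 P Q = 0" .
  interpret U: coloured A Unshaded P Q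
    by unfold_locales (rule PQ)+
  let ?P = "rot Unshaded P" and ?Q = "rot Unshaded Q"
  have rot: "rotation A 1 Unshaded P = ?P" "rotation A 1 Unshaded Q = ?Q"
    using rotation_eq U.colours_in_box by (simp_all add: rot_def hom_1)
  have sum: "?P + ?Q = ident Shaded 1"
    using U.up_dn[of 1] by (simp add: U.up_def U.dn_def add.commute)
  interpret S: coloured A Shaded ?P ?Q
    by unfold_locales (use colour_rot[OF PQ(1)] colour_rot[OF PQ(2)] sum in auto)
  have rot_rot': "rot Shaded ?P = P" "rot Shaded ?Q = Q"
    using rot_rot[OF U.colours_in_box(1)] rot_rot[OF U.colours_in_box(2)] by simp_all
  have QP: "cmp Unshaded 1 1 1 Q P = 0"
    using dag_cmp[of P Unshaded 1 1 Q 1] PQ U.colours_in_box dag_zero[of 1 1 Unshaded] proj_1(2)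
    by (simp add: colour_def hom_1 dag_def)
  have close: "close_right A 1 s x = empty_diagram A s" if "colour s x" for s x
    using trace_right_eq(1)[of x s 1] val_cong[OF ceq_bubble[OF that]] that proj_1(1)[of s x]
    by (simp add: colour_def hom_1 fcups_def fcaps_def empty_diagram_eq ident_def)
  have saddle: "saddle A s x = tensor A 1 1 s x (rot s x)" if "colour s x" for s x
    using val_cong[OF ceq_saddle[OF that]] saddle_eq[of x s] tensor_eq[of x s 1 "rot s x" 1] that
      proj_1(1,3)[of s x] by (simp add: colour_def hom_1 numeral_2_eq_2)
  have "bubble_relation A P Q"
    unfolding bubble_relation_def rot using close PQ(1,2) S.a S.b by blast
  moreover have "strand_decomposition A P Q"
    unfolding strand_decomposition_def rot by (simp add: X_strand_eq Y_strand_eq PQ(3) sum)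
  moreover have "colour_disagreement A P Q"
    using stack_eq[of P Unshaded 1 Q] stack_eq[of Q Unshaded 1 P] U.colours_in_box PQ(4) QP
    by (simp add: colour_disagreement_def hom_1)
  moreover have "saddle_relation A P Q"
    using saddle[OF PQ(1)] saddle[OF PQ(2)] saddle[OF S.a] saddle[OF S.b]
    unfolding saddle_relation_def Let_def by (simp add: rot rot_rot' del: One_nat_def)
  moreover note U.vertex_path[OF infinite_vertices[OF assms(3)]] S.vertex_path[OF infinite_vertices[OF assms(4)]]
  ultimately show ?thesis
    unfolding U.vertex_def S.vertex_def rot_rot' Let_def
    by (intro bexI[of _ P] bexI[of _ Q]) (simp_all add: rot U.colours_in_box del: One_nat_def)
qed

end
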